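(* Let $(E,A,B,Q,S,R)\in\Sigma^w_{m,n}(\mathbb K)$ with Popov function $\Phi(z)\in\mathbb K(z)^{m\times m}$ and $\operatorname{rk}_{\mathbb K(z)}\Phi(z)=q$ for some $q\in\mathbb N_0$. Assume that $(E,A,B)$ has no uncontrollable modes on the unit circle. Let $z\mathcal A^*-\mathcal A$ be the associated palindromic pencil. Then the following are equivalent: (a) $\Phi(z)$ is positive semi-definite on the unit circle, i.e. $\Phi(e^{i\omega})\succeq0$ for all $\omega\in[0,2\pi)$ with $\det(e^{i\omega}E-A)\neq0$. (b) The palindromic Kronecker canonical form (PKCF) of $z\mathcal A^*-\mathcal A$ satisfies: (i) there are no blocks of type P2 corresponding to eigenvalues $\lambda=e^{i\theta}$ with $\theta\neq0$ (that is, with $\theta\in(0,2\pi)$), and all blocks of type P3 have negative sign-characteristic; (ii) the number of blocks of type P2 corresponding to the eigenvalue $\lambda=1$ with positive sign-characteristic is greater by $q$ than the number of those with negative sign-characteristic. (c) The PKCF of $z\mathcal A^*-\mathcal A$ satisfies: (i') there are no blocks of type P2 corresponding to eigenvalues $\lambda=e^{i\theta}$ with $\theta\neq0$; (ii') the number of blocks of type P2 corresponding to the eigenvalue $\lambda=1$ with positive sign-characteristic is greater by $q$ than the number of those with negative sign-characteristic.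
   Context: $\mathbb K\in\{\mathbb R,\mathbb C\}$. $\Sigma_{m,n}(\mathbb K)$ is the set of triples $(E,A,B)\in\mathbb K^{n\times n}\times\mathbb K^{n\times n}\times\mathbb K^{n\times m}$ with $\det(zE-A)\not\equiv 0$. $\Sigma^w_{m,n}(\mathbb K)$ is the set of $(E,A,B,Q,S,R)$ with $(E,A,B)\in\Sigma_{m,n}(\mathbb K)$, $Q=Q^*\in\mathbb K^{n\times n}$, $S\in\mathbb K^{n\times m}$, $R=R^*\in\mathbb K^{m\times m}$. $(E,A,B)$ has an uncontrollable mode at $\lambda\in\mathbb C$ if $\operatorname{rk}\begin{bmatrix}\lambda E-A&B\end{bmatrix}\neq n$. Popov function: $\Phi(z)=\begin{bmatrix}(zE-A)^{-1}B\\ I_m\end{bmatrix}^{\sim}\begin{bmatrix}Q&S\\ S^*&R\end{bmatrix}\begin{bmatrix}(zE-A)^{-1}B\\ I_m\end{bmatrix}$, where $G^\sim(z)=G(\overline z^{\,-1})^*$; $\operatorname{rk}_{\mathbb K(z)}$ denotes rank over the field of rational functions. The associated palindromic pencil is $$z\mathcal A^*-\mathcal A=\begin{bmatrix}0&zE-A&-B\\ zA^*-E^*&(z-1)Q&(z-1)S\\ zB^*&(z-1)S^*&(z-1)R\end{bmatrix}\in\mathbb K[z]^{(2n+m)\times(2n+m)},\qquad \mathcal A=\begin{bmatrix}0&A&B\\ E^*&Q&S\\ 0&S^*&R\end{bmatrix}.$$ PKCF: for every square pencil $z\mathcal A^*-\mathcal A$ of size $N$ there is an invertible $U\in\mathbb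 C^{N\times N}$ such that $U^*(z\mathcal A^*-\mathcal A)U=\operatorname{diag}(D_1(z),\dots,D_l(z))$, where each (nonempty) block $D_j(z)$ has one of the forms P1–P5 below; this form, the PKCF, is unique up to permutation of the blocks (the sign in blocks of type P1 plays no role). Let $e_1^k$ be the first unit vector of $\mathbb K^k$; $F_k\in\mathbb C^{k\times k}$ the matrix with ones on the antidiagonal (positions $(i,k+1-i)$) and zeros elsewhere; $J_k(\lambda)\in\mathbb C^{k\times k}$ the matrix with $\lambda$ at positions $(i,k+1-i)$, $i=1,\dots,k$, ones at positions $(i,k+2-i)$, $i=2,\dots,k$, and zeros elsewhere; $S_R\in\mathbb C^{(k+1)\times k}$ the matrix with ones at positions $(i,k+1-i)$, $i=1,\dots,k$, and zeros elsewhere; $S_L\in\mathbb C^{k\times(k+1)}$ the matrix with ones at positions $(i,k+2-i)$, $i=1,\dots,k$, and zeros elsewhere. With $\varepsilon\in\{-1,1\}$ (the sign-characteristic) and $k\in\mathbb N_0$: P1 (size $2k$): $\varepsilon\begin{bmatrix}0&zF_k-J_k(\lambda)\\ zJ_k(\overline\lambda)-F_k&0\end{bmatrix}$, $|\lambda|<1$. P2 (size $2k+1$): $\varepsilon\begin{bmatrix}0&0&zF_k-J_k(\lambda)\\ 0&ze^{-i\theta/2}-e^{i\theta/2}&-(e_1^k)^T\\ zJ_k(\overline\lambda)-F_k&ze_1^k&0\end{bmatrix}$, $\lambda=e^{i\theta}$, $\theta\in[0,2\pi)$. P3 (size $2k$): $\varepsilon\begin{bmatrix}0&zF_k-J_k(\lambda)\\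 zJ_k(\overline\lambda)-F_k&(z-1)e_1^k(e_1^k)^T\end{bmatrix}$, $\lambda=e^{i\theta}$, $\theta\in(0,2\pi)$. P4 (size $2k$): $\varepsilon\begin{bmatrix}0&zF_k-J_k(1)\\ zJ_k(1)-F_k&i(z+1)e_1^k(e_1^k)^T\end{bmatrix}$ (eigenvalue $\lambda=1$). P5 (size $2k+1$): $\begin{bmatrix}0&zS_R-S_L^T\\ zS_L-S_R^T&0\end{bmatrix}$. *)

theory Defs
  imports
    "Jordan_Normal_Form.Schur_Decomposition"
    "Jordan_Normal_Form.DL_Rank"
    "HOL-Computational_Algebra.Polynomial_Factorial"
    "HOL-Computational_Algebra.Field_as_Ring"
begin

section \<open>The scalar field: the real or the complex numbers\<close>

text \<open>The axioms admit, up to isomorphism, exactly the real numbers with trivial conjugation and the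
  complex numbers with the usual one. The superclass \<open>field_gcd\<close> is only there to have
  \<open>quot_of_fract\<close> (representation in lowest terms) for rational functions.\<close>

class real_or_complex = conjugatable_field + field_gcd +
  fixes to_complex :: "'a \<Rightarrow> complex"
  assumes to_complex_add: "to_complex (a + b) = to_complex a + to_complex b"
    and to_complex_mult: "to_complex (a * b) = to_complex a * to_complex b"
    and to_complex_one: "to_complex 1 = 1"
    and to_complex_conjugate: "to_complex (conjugate a) = cnj (to_complex a)"
    and range_to_complex: "range to_complex = \<real> \<or> range to_complex = UNIV"

instantiation real :: real_or_complex
begin
definition to_complex_real :: "real \<Rightarrow> complex" where "to_complex_real = of_real"
instance
  by intro_classes (auto simp: to_complex_real_def Reals_def)
end

instantiation complex :: real_or_complex
begin
definition to_complex_complex :: "complex \<Rightarrow> complex" where "to_complex_complex = id"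
instance
  by intro_classes (auto simp: to_complex_complex_def)
end

section \<open>Block matrices and matrix pencils\<close>

definition append_cols :: "'a::zero mat \<Rightarrow> 'a mat \<Rightarrow> 'a mat" where
  "append_cols A B = four_block_mat A B (0\<^sub>m 0 (dim_col A)) (0\<^sub>m 0 (dim_col B))"

definition nine_block_mat ::
  "'a::zero mat \<Rightarrow> 'a mat \<Rightarrow> 'a mat \<Rightarrow> 'a mat \<Rightarrow> 'a mat \<Rightarrow> 'a mat \<Rightarrow> 'a mat \<Rightarrow> 'a mat \<Rightarrow> 'a mat \<Rightarrow> 'a mat" where
  "nine_block_mat A11 A12 A13 A21 A22 A23 A31 A32 A33 =
     four_block_mat A11 (append_cols A12 A13)
                    (A21 @\<^sub>r A31) (four_block_mat A22 A23 A32 A33)"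

definition const_mat :: "'a::zero mat \<Rightarrow> 'a poly mat" where
  "const_mat M = map_mat (\<lambda>a. [:a:]) M"

text \<open>The pencil $z X - Y$.\<close>
definition pencil :: "'a::comm_ring_1 mat \<Rightarrow> 'a mat \<Rightarrow> 'a poly mat" where
  "pencil X Y = [:0, 1:] \<cdot>\<^sub>m const_mat X - const_mat Y"

section \<open>Systems and weights\<close>

definition Sigma_sys :: "nat \<Rightarrow> nat \<Rightarrow> ('a::real_or_complex mat \<times> 'a mat \<times> 'a mat) set" where
  "Sigma_sys m n = {(E, A, B). E \<in> carrier_mat n n \<and> A \<in> carrier_mat n n \<and> B \<in> carrier_mat n m
      \<and> det (pencil E A) \<noteq> 0}"

definition Sigma_w :: "nat \<Rightarrow> nat \<Rightarrow>
    ('a::real_or_complex mat \<times> 'a mat \<times> 'a mat \<times> 'a mat \<times> 'a mat \<times> 'a mat) set" where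
  "Sigma_w m n = {(E, A, B, Q, S, R). (E, A, B) \<in> Sigma_sys m n
      \<and> Q \<in> carrier_mat n n \<and> mat_adjoint Q = Q
      \<and> S \<in> carrier_mat n m
      \<and> R \<in> carrier_mat m m \<and> mat_adjoint R = R}"

definition uncontrollable_mode ::
  "'a::real_or_complex mat \<Rightarrow> 'a mat \<Rightarrow> 'a mat \<Rightarrow> complex \<Rightarrow> bool" where
  "uncontrollable_mode E A B \<mu> \<longleftrightarrow>
     vec_space.rank (dim_row E)
       (append_cols (\<mu> \<cdot>\<^sub>m map_mat to_complex E - map_mat to_complex A) (map_mat to_complex B))
     \<noteq> dim_row E"

section \<open>Rational matrices and the Popov function\<close>

definition rat_mat :: "'a::idom poly mat \<Rightarrow> 'a poly fract mat" where
  "rat_mat M = map_mat to_fract M"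

text \<open>For a rational function $r$, the rational function $z \mapsto \overline{r(\overline z^{-1})}$:
  the coefficients of numerator and denominator are conjugated and $z$ is replaced by $1/z$.\<close>

definition poly_tilde :: "'a::{conjugatable_field} poly \<Rightarrow> 'a poly fract" where
  "poly_tilde p = poly (map_poly (\<lambda>c. to_fract [:conjugate c:]) p) (inverse (to_fract [:0, 1:]))"

definition fract_tilde :: "'a::real_or_complex poly fract \<Rightarrow> 'a poly fract" where
  "fract_tilde r = poly_tilde (fst (quot_of_fract r)) / poly_tilde (snd (quot_of_fract r))"

definition mat_tilde :: "'a::real_or_complex poly fract mat \<Rightarrow> 'a poly fract mat" where
  "mat_tilde G = map_mat fract_tilde (transpose_mat G)"

text \<open>Value at a complex point, computed from the representation in lowest terms; it is the
  value of the rational function at every point that is not a pole.\<close>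
definition eval_fract :: "'a::real_or_complex poly fract \<Rightarrow> complex \<Rightarrow> complex" where
  "eval_fract r z = poly (map_poly to_complex (fst (quot_of_fract r))) z
                  / poly (map_poly to_complex (snd (quot_of_fract r))) z"

definition popov :: "'a::real_or_complex mat \<Rightarrow> 'a mat \<Rightarrow> 'a mat \<Rightarrow> 'a mat \<Rightarrow> 'a mat \<Rightarrow> 'a mat
    \<Rightarrow> 'a poly fract mat" where
  "popov E A B Q S R =
     (let G = (the (mat_inverse (rat_mat (pencil E A))) * rat_mat (const_mat B)) @\<^sub>r 1\<^sub>m (dim_col B)
      in mat_tilde G * rat_mat (const_mat (four_block_mat Q S (mat_adjoint S) R)) * G)"

definition psd_mat :: "complex mat \<Rightarrow> bool" where
  "psd_mat M \<longleftrightarrow> square_mat M \<and> mat_adjoint M = M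
     \<and> (\<forall>v \<in> carrier_vec (dim_row M). 0 \<le> (M *\<^sub>v v) \<bullet>c v)"

definition psd_on_unit_circle ::
  "'a::real_or_complex mat \<Rightarrow> 'a mat \<Rightarrow> 'a poly fract mat \<Rightarrow> bool" where
  "psd_on_unit_circle E A \<Phi> \<longleftrightarrow>
     (\<forall>\<omega> \<in> {0..<2 * pi}. det (cis \<omega> \<cdot>\<^sub>m map_mat to_complex E - map_mat to_complex A) \<noteq> 0 \<longrightarrow>
        psd_mat (map_mat (\<lambda>r. eval_fract r (cis \<omega>)) \<Phi>))"

section \<open>The associated palindromic pencil\<close>

text \<open>The matrix $\mathcal A$ of the palindromic pencil $z \mathcal A^* - \mathcal A$.\<close>
definition pal_mat :: "'a::real_or_complex mat \<Rightarrow> 'a mat \<Rightarrow> 'a mat \<Rightarrow> 'a mat \<Rightarrow> 'a mat \<Rightarrow> 'a mat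
    \<Rightarrow> 'a mat" where
  "pal_mat E A B Q S R = (let n = dim_row B; m = dim_col B in
     nine_block_mat
       (0\<^sub>m n n)         A               B
       (mat_adjoint E)  Q               S
       (0\<^sub>m m n)         (mat_adjoint S) R)"

definition pal_pencil :: "'a::conjugatable_field mat \<Rightarrow> 'a poly mat" where
  "pal_pencil M = pencil (mat_adjoint M) M"

lemma pal_pencil_pal_mat:
  assumes "(E, A, B, Q, S, R) \<in> Sigma_w m n"
  shows "pal_pencil (pal_mat E A B Q S R) =
    nine_block_mat
      (0\<^sub>m n n) (pencil E A) (- const_mat B)
      (pencil (mat_adjoint A) (mat_adjoint E)) ([:-1, 1:] \<cdot>\<^sub>m const_mat Q) ([:-1, 1:] \<cdot>\<^sub>m const_mat S)
      ([:0, 1:] \<cdot>\<^sub>m const_mat (mat_adjoint B)) ([:-1, 1:] \<cdot>\<^sub>m const_mat (mat_adjoint S))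
        ([:-1, 1:] \<cdot>\<^sub>m const_mat R)"
proof -
  have dims: "E \<in> carrier_mat n n" "A \<in> carrier_mat n n" "B \<in> carrier_mat n m"
    "Q \<in> carrier_mat n n" "S \<in> carrier_mat n m" "R \<in> carrier_mat m m"
    and herm: "mat_adjoint Q = Q" "mat_adjoint R = R"
    using assms by (auto simp: Sigma_w_def Sigma_sys_def)
  have adj: "mat_adjoint M = mat (dim_col M) (dim_row M) (\<lambda>(i, j). conjugate (M $$ (j, i)))"
    for M :: "'a mat"
    by (rule eq_matI) (auto simp: mat_adjoint_def mat_of_rows_def)
  have Qij: "conjugate (Q $$ (j, i)) = Q $$ (i, j)" if "i < n" "j < n" for i j
    using arg_cong[OF herm(1), of "\<lambda>M. M $$ (i, j)"] that dims by (auto simp: adj)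
  have Rij: "conjugate (R $$ (j, i)) = R $$ (i, j)" if "i < m" "j < m" for i j
    using arg_cong[OF herm(2), of "\<lambda>M. M $$ (i, j)"] that dims by (auto simp: adj)
  show ?thesis
    using dims
    by (intro eq_matI)
      (auto simp: pal_pencil_def pencil_def const_mat_def pal_mat_def nine_block_mat_def
        append_cols_def append_rows_def adj Let_def Qij Rij)
qed

section \<open>The palindromic Kronecker canonical form\<close>

text \<open>Matrix indices start at 0, so the position $(i, k + 1 - i)$ becomes $i + j + 1 = k$
  and the position $(i, k + 2 - i)$ becomes $i + j = k$.\<close>

definition e1_mat :: "nat \<Rightarrow> complex mat" where
  "e1_mat k = mat k 1 (\<lambda>(i, j). if i = 0 then 1 else 0)"

definition F_mat :: "nat \<Rightarrow> complex mat" where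
  "F_mat k = mat k k (\<lambda>(i, j). if i + j + 1 = k then 1 else 0)"

definition J_mat :: "nat \<Rightarrow> complex \<Rightarrow> complex mat" where
  "J_mat k \<mu> = mat k k (\<lambda>(i, j). if i + j + 1 = k then \<mu> else if i + j = k then 1 else 0)"

definition SR_mat :: "nat \<Rightarrow> complex mat" where
  "SR_mat k = mat (k + 1) k (\<lambda>(i, j). if i + j + 1 = k then 1 else 0)"

definition SL_mat :: "nat \<Rightarrow> complex mat" where
  "SL_mat k = mat k (k + 1) (\<lambda>(i, j). if i + j = k then 1 else 0)"

text \<open>The arguments are the sign-characteristic (not for \<open>P5\<close>), the size parameter $k$, and,
  for \<open>P1\<close>, the eigenvalue $\lambda$, for \<open>P2\<close> and \<open>P3\<close>, the angle $\theta$ with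
  $\lambda = e^{i\theta}$.\<close>
datatype pkcf_block =
    P1 int nat complex
  | P2 int nat real
  | P3 int nat real
  | P4 int nat
  | P5 nat

fun admissible_block :: "pkcf_block \<Rightarrow> bool" where
  "admissible_block (P1 \<epsilon> k \<mu>) \<longleftrightarrow> \<epsilon> \<in> {-1, 1} \<and> k \<ge> 1 \<and> cmod \<mu> < 1"
| "admissible_block (P2 \<epsilon> k \<theta>) \<longleftrightarrow> \<epsilon> \<in> {-1, 1} \<and> 0 \<le> \<theta> \<and> \<theta> < 2 * pi"
| "admissible_block (P3 \<epsilon> k \<theta>) \<longleftrightarrow> \<epsilon> \<in> {-1, 1} \<and> k \<ge> 1 \<and> 0 < \<theta> \<and> \<theta> < 2 * pi"
| "admissible_block (P4 \<epsilon> k) \<longleftrightarrow> \<epsilon> \<in> {-1, 1} \<and> k \<ge> 1"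
| "admissible_block (P5 k) \<longleftrightarrow> True"

fun block_pencil :: "pkcf_block \<Rightarrow> complex poly mat" where
  "block_pencil (P1 \<epsilon> k \<mu>) = of_int \<epsilon> \<cdot>\<^sub>m
     four_block_mat
       (0\<^sub>m k k)                              (pencil (F_mat k) (J_mat k \<mu>))
       (pencil (J_mat k (cnj \<mu>)) (F_mat k))  (0\<^sub>m k k)"
| "block_pencil (P2 \<epsilon> k \<theta>) = of_int \<epsilon> \<cdot>\<^sub>m
     nine_block_mat
       (0\<^sub>m k k)  (0\<^sub>m k 1)  (pencil (F_mat k) (J_mat k (cis \<theta>)))
       (0\<^sub>m 1 k)  (mat 1 1 (\<lambda>_. [:- cis (\<theta> / 2), cis (- \<theta> / 2):]))  (- const_mat (transpose_mat (e1_mat k)))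
       (pencil (J_mat k (cnj (cis \<theta>))) (F_mat k))  ([:0, 1:] \<cdot>\<^sub>m const_mat (e1_mat k))  (0\<^sub>m k k)"
| "block_pencil (P3 \<epsilon> k \<theta>) = of_int \<epsilon> \<cdot>\<^sub>m
     four_block_mat
       (0\<^sub>m k k)  (pencil (F_mat k) (J_mat k (cis \<theta>)))
       (pencil (J_mat k (cnj (cis \<theta>))) (F_mat k))
         ([:-1, 1:] \<cdot>\<^sub>m const_mat (e1_mat k * transpose_mat (e1_mat k)))"
| "block_pencil (P4 \<epsilon> k) = of_int \<epsilon> \<cdot>\<^sub>m
     four_block_mat
       (0\<^sub>m k k)  (pencil (F_mat k) (J_mat k 1))
       (pencil (J_mat k 1) (F_mat k))
         ([:\<i>, \<i>:] \<cdot>\<^sub>m const_mat (e1_mat k * transpose_mat (e1_mat k)))"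
| "block_pencil (P5 k) =
     four_block_mat
       (0\<^sub>m (k + 1) (k + 1))  (pencil (SR_mat k) (transpose_mat (SL_mat k)))
       (pencil (SL_mat k) (transpose_mat (SR_mat k)))  (0\<^sub>m k k)"

text \<open>The pencil $z M^* - M$ has the PKCF $\mathrm{diag}(D_1(z), \dots, D_l(z))$ with the
  blocks \<open>bs\<close>.\<close>
definition is_pkcf :: "complex mat \<Rightarrow> pkcf_block list \<Rightarrow> bool" where
  "is_pkcf M bs \<longleftrightarrow> (\<forall>b \<in> set bs. admissible_block b) \<and>
     (\<exists>U \<in> carrier_mat (dim_row M) (dim_row M). invertible_mat U \<and>
        const_mat (mat_adjoint U) * pal_pencil M * const_mat U
          = diag_block_mat (map block_pencil bs))"

definition no_P2_off_one :: "pkcf_block list \<Rightarrow> bool" where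
  "no_P2_off_one bs \<longleftrightarrow> (\<forall>\<epsilon> k \<theta>. P2 \<epsilon> k \<theta> \<in> set bs \<longrightarrow> \<theta> = 0)"

definition all_P3_negative :: "pkcf_block list \<Rightarrow> bool" where
  "all_P3_negative bs \<longleftrightarrow> (\<forall>\<epsilon> k \<theta>. P3 \<epsilon> k \<theta> \<in> set bs \<longrightarrow> \<epsilon> = -1)"

text \<open>The number of blocks of type P2 with eigenvalue 1, i.e.\ $\theta = 0$, and sign
  \<open>\<epsilon>\<close>.\<close>
definition num_P2_at_one :: "int \<Rightarrow> pkcf_block list \<Rightarrow> nat" where
  "num_P2_at_one \<epsilon> bs = length (filter (\<lambda>b. \<exists>k. b = P2 \<epsilon> k 0) bs)"

end

theory Submission
  imports Defs
begin

text \<open>Fix \<open>z = cis \<omega>\<close> with \<open>0 < \<omega> < 2 * pi\<close> and let \<open>c = - \<i> * cis (- \<omega> / 2)\<close>. Because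
  \<open>cnj c = - c * z\<close>, the matrix \<open>H = c * (z M\<^sup>* - M)\<close>, where \<open>M\<close> is the matrix of the palindromic
  pencil, is Hermitian, and each condition in the theorem is a statement about the inertia of \<open>H\<close> as
  \<open>\<omega>\<close> varies.

  The system determines the inertia in one way. Write \<open>N = 2 n + m\<close> for the size of the pencil. In block form \<open>H\<close> is
  \<open>[0, Y; Y\<^sup>*, s W]\<close> with \<open>Y = c [z E - A, -B]\<close>, the Hermitian weight \<open>W = [Q, S; S\<^sup>*, R]\<close> and
  \<open>s = 2 sin (\<omega> / 2) > 0\<close>. As \<open>Y\<close> has full row rank \<open>n\<close> (no uncontrollable mode on the circle), \<open>H\<close> has
  \<open>n\<close> negative and \<open>n\<close> positive squares plus those of \<open>s W\<close> restricted to the kernel of \<open>Y\<close>. If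
  \<open>z E - A\<close> is invertible, this kernel is the graph of \<open>(z E - A)\<^sup>-\<^sup>1 B\<close> and the restriction is \<open>s \<Phi> z\<close>. So
  \<open>\<Phi> z\<close> is positive semidefinite iff \<open>H\<close> has exactly \<open>n\<close> negative squares, and at least \<open>n\<close> are present at
  every point of the circle other than 1, also where \<open>z E - A\<close> is singular.

  The canonical form determines it in a second way, since \<open>H\<close> is congruent to the direct sum of the blocks. Off the angles
  of the blocks, P1, P3, P4 and P5 contribute equally many positive and negative squares, and a block P2 with
  sign \<open>\<epsilon>\<close> and angle \<open>\<theta>\<close> contributes one square more of the sign of \<open>\<epsilon> * sin ((\<omega> - \<theta>) / 2)\<close> than of the
  other. At \<open>\<omega> = \<theta>\<close> this extra square degenerates to zero, while in a block P3 with \<open>\<epsilon> = 1\<close> a negative square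
  does.

  Let \<open>\<Phi>\<close> be positive semidefinite. Nearby the number of negative squares is \<open>n\<close>, so it cannot drop at
  any angle \<open>\<theta> \<noteq> 0\<close>. A block P2 makes it drop when \<open>\<theta>\<close> is approached from one of the two sides, and a block P3
  with positive sign makes it drop from both (\<open>psd_imp_pointwise\<close>); so neither occurs. The jump of the
  blocks P2 with \<open>\<theta> = 0\<close> takes place at \<open>\<omega> = 0\<close>, where \<open>s\<close> vanishes, and is not excluded: in \<open>(0, 2 pi)\<close>
  each of them contributes its sign to the signature of \<open>H\<close>, which at generic points is
  the signature \<open>q\<close> of \<open>\<Phi>\<close> (\<open>psd_imp_count\<close>). Conversely, if the signature of \<open>\<Phi>\<close> is \<open>q\<close> at generic points,
  then, the rank being \<open>q\<close>, there is no negative square (\<open>count_imp_generic_psd\<close>); the remaining points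
  follow by continuity (\<open>generic_psd_imp_psd\<close>).

  The numbers of squares are compared by means of subspaces alone: if a
  Hermitian form of size \<open>N\<close> is negative definite on a space of dimension \<open>k\<close> and nonnegative on one of
  dimension \<open>l\<close>, then \<open>k + l \<le> N\<close> (\<open>neg_nonneg_dim_le\<close>). Both the system and the blocks
  supply such spaces, from the same description of forms \<open>[0, Y; Y\<^sup>*, D]\<close>
  (\<open>neg_on_dim_saddle\<close> and \<open>nonneg_on_dim_saddle\<close>). Positive squares are negative squares of \<open>-H\<close>; the
  parameter \<open>\<sigma> \<in> {1, -1}\<close> below serves to treat \<open>H\<close> and \<open>-H\<close> together.\<close>

section \<open>Rank splittings of matrices over a field\<close>

lemma mult_mat_unit_vec_col:
  fixes A :: "'a::semiring_1 mat"
  assumes "A \<in> carrier_mat nr nc" "j < nc"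
  shows "A *\<^sub>v unit_vec nc j = col A j"
  using assms by (intro eq_vecI) auto

text \<open>Padding with zero rows gives a square matrix of determinant zero.\<close>

lemma wide_matrix_kernel:
  fixes A :: "'a::field mat"
  assumes A: "A \<in> carrier_mat nr nc" and less: "nr < nc"
  shows "\<exists>v \<in> carrier_vec nc. v \<noteq> 0\<^sub>v nc \<and> A *\<^sub>v v = 0\<^sub>v nr"
proof -
  define B where "B = mat nc nc (\<lambda>(i, j). if i < nr then A $$ (i, j) else 0)"
  have B: "B \<in> carrier_mat nc nc" by (simp add: B_def)
  have "row B (nc - 1) = 0\<^sub>v nc"
    using less by (intro eq_vecI) (auto simp: B_def)
  have "det B = 0"
    unfolding det_def'[OF B]
  proof (intro sum.neutral ballI)
    fix p assume p: "p \<in> {p. p permutes {0..<nc}}"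
    have "p (nc - 1) < nc" using p less permutes_in_image[of p "{0..<nc}" "nc - 1"] by auto
    then have "B $$ (nc - 1, p (nc - 1)) = 0" using less by (auto simp: B_def)
    then have "(\<Prod>i = 0..<nc. B $$ (i, p i)) = 0"
      using less by (intro prod_zero) (auto intro!: bexI[of _ "nc - 1"])
    then show "signof p * (\<Prod>i = 0..<nc. B $$ (i, p i)) = 0" by simp
  qed
  then obtain v where v: "v \<in> carrier_vec nc" "v \<noteq> 0\<^sub>v nc" "B *\<^sub>v v = 0\<^sub>v nc"
    using det_0_iff_vec_prod_zero_field[OF B] by auto
  have "A *\<^sub>v v = 0\<^sub>v nr"
  proof (rule eq_vecI)
    fix i assume "i < dim_vec (0\<^sub>v nr)"
    then have i: "i < nr" by simp
    have "row A i = row B i" using i less A by (intro eq_vecI) (auto simp: B_def)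
    then have "(A *\<^sub>v v) $ i = (B *\<^sub>v v) $ i" using i less A B by auto
    then show "(A *\<^sub>v v) $ i = 0\<^sub>v nr $ i" using v i less by simp
  qed (use A in auto)
  with v show ?thesis by blast
qed

text \<open>\<open>C\<close> consists of the columns of \<open>A\<close> in a maximal independent set of columns, \<open>J\<close> of their
  indices; adding any other column \<open>a\<close> gives a linear dependence, whose coefficient at \<open>a\<close> is not
  zero, so that \<open>a\<close> is a combination of the columns of \<open>C\<close>.\<close>

lemma rank_factorization:
  fixes A :: "'a::field mat"
  assumes A: "A \<in> carrier_mat nr nc" and rk: "vec_space.rank nr A = r"
  obtains J C D where "length J = r" "distinct J" "set J \<subseteq> {..<nc}"
    "C = mat nr r (\<lambda>(i, j). A $$ (i, J ! j))"
    "\<And>v. v \<in> carrier_vec r \<Longrightarrow> C *\<^sub>v v = 0\<^sub>v nr \<Longrightarrow> v = 0\<^sub>v r"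
    "D \<in> carrier_mat r nc" "A = C * D"
proof -
  interpret vec_space "TYPE('a)" nr .
  obtain S where S: "maximal S (\<lambda>T. T \<subseteq> set (cols A) \<and> lin_indpt T)"
    using maximal_exists[of "(\<lambda>T. T \<subseteq> set (cols A) \<and> lin_indpt T)" "card (set (cols A))" "{}"]
    by (meson List.finite_set card_mono empty_iff empty_subsetI finite_lin_indpt2 rev_finite_subset)
  then have SA: "S \<subseteq> set (cols A)" and Si: "lin_indpt S" by (auto simp: maximal_def)
  have cS: "card S = r" using rank_card_indpt[OF A S] rk by simp
  have fS: "finite S" using SA finite_subset by blast
  obtain bs where bs: "set bs = S" "distinct bs" using finite_distinct_list[OF fS] by blast
  have lbs: "length bs = r" using bs cS distinct_card by fastforce
  have "\<forall>i<r. \<exists>j<nc. bs ! i = col A j"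
  proof safe
    fix i assume "i < r"
    then have "bs ! i \<in> set (cols A)" using SA bs lbs by (metis nth_mem subsetD)
    then show "\<exists>j<nc. bs ! i = col A j" using A by (auto simp: in_set_conv_nth)
  qed
  then obtain f where f: "\<And>i. i < r \<Longrightarrow> f i < nc \<and> bs ! i = col A (f i)" by metis
  define J where "J = map f [0..<r]"
  have J1: "length J = r" by (simp add: J_def)
  have J2: "distinct J" unfolding J_def distinct_map
  proof (intro conjI inj_onI)
    fix x y assume *: "x \<in> set [0..<r]" "y \<in> set [0..<r]" "f x = f y"
    then have "bs ! x = bs ! y" using f[of x] f[of y] by simp
    with * show "x = y" using bs lbs nth_eq_iff_index_eq by fastforce
  qed simp
  have J3: "set J \<subseteq> {..<nc}" using f by (auto simp: J_def)
  define C where "C = mat nr r (\<lambda>(i, j). A $$ (i, J ! j))"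
  have C: "C \<in> carrier_mat nr r" by (simp add: C_def)
  have colC: "col C i = bs ! i" if "i < r" for i
    using that f[OF that] A by (intro eq_vecI) (auto simp: C_def J_def)
  have colsC: "cols C = bs" using lbs C colC by (intro nth_equalityI) auto
  have inj: "v = 0\<^sub>v r" if "v \<in> carrier_vec r" "C *\<^sub>v v = 0\<^sub>v nr" for v
    using lin_depI[OF C that(1) _ that(2)] bs Si colsC by auto
  have ex: "\<exists>d \<in> carrier_vec r. col A j = C *\<^sub>v d" if j: "j < nc" for j
  proof (cases "col A j \<in> S")
    case True
    then obtain i where i: "i < r" "col A j = bs ! i" using bs lbs by (metis in_set_conv_nth)
    then have "col A j = C *\<^sub>v unit_vec r i" using colC mult_mat_unit_vec_col[OF C] by metis
    then show ?thesis by auto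
  next
    case False
    have caj: "col A j \<in> carrier_vec nr" using A j by auto
    have "col A j \<in> set (cols A)" using A j by (auto simp: cols_def)
    then have "insert (col A j) S \<subseteq> set (cols A)" using SA by auto
    then have dep: "lin_dep (insert (col A j) S)" using S False unfolding maximal_def by blast
    define B where "B = mat_of_cols nr (bs @ [col A j])"
    have bsc: "set bs \<subseteq> carrier_vec nr" using SA bs A cols_dim by blast
    have B: "B \<in> carrier_mat nr (Suc r)" using lbs by (intro carrier_matI) (simp_all add: B_def)
    have colsB: "cols B = bs @ [col A j]" unfolding B_def using bsc caj by (intro cols_mat_of_cols) auto
    obtain v where v: "v \<in> carrier_vec (Suc r)" "v \<noteq> 0\<^sub>v (Suc r)" "B *\<^sub>v v = 0\<^sub>v nr"
      using lin_depE[OF B] colsB dep False bs by auto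
    define w where "w = vec r (\<lambda>i. v $ i)"
    have w: "w \<in> carrier_vec r" by (simp add: w_def)
    have eq: "C *\<^sub>v w + v $ r \<cdot>\<^sub>v col A j = 0\<^sub>v nr"
    proof (rule eq_vecI)
      fix i assume "i < dim_vec (0\<^sub>v nr)"
      then have i: "i < nr" by simp
      have "0 = (B *\<^sub>v v) $ i" using v i by simp
      also have "\<dots> = (\<Sum>k<Suc r. B $$ (i, k) * v $ k)"
        using B v(1) i by (simp add: scalar_prod_def lessThan_atLeast0)
      also have "\<dots> = (\<Sum>k<r. B $$ (i, k) * v $ k) + B $$ (i, r) * v $ r" by simp
      also have "B $$ (i, r) = A $$ (i, j)"
        using i j A lbs by (simp add: B_def mat_of_cols_def nth_append)
      also have "(\<Sum>k<r. B $$ (i, k) * v $ k) = (\<Sum>k<r. C $$ (i, k) * w $ k)"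
      proof (rule sum.cong[OF refl], goal_cases)
        case (1 k)
        then have "C $$ (i, k) = col C k $ i" using i C by simp
        also have "\<dots> = B $$ (i, k)" using 1 colC[of k] i lbs by (simp add: B_def mat_of_cols_def nth_append)
        finally show ?case using 1 by (simp add: w_def)
      qed
      finally show "(C *\<^sub>v w + v $ r \<cdot>\<^sub>v col A j) $ i = 0\<^sub>v nr $ i"
        using i j A C w by (simp add: scalar_prod_def lessThan_atLeast0 mult.commute)
    qed (use A in auto)
    have vr: "v $ r \<noteq> 0"
    proof
      assume 0: "v $ r = 0"
      then have "0 \<cdot>\<^sub>v col A j = 0\<^sub>v nr" using A j by (intro eq_vecI) auto
      then have "C *\<^sub>v w = 0\<^sub>v nr" using eq C w A j 0 by auto
      then have "w = 0\<^sub>v r" using inj w by blast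
      then have "v $ i = 0" if "i < Suc r" for i
        using that 0 by (cases "i = r") (auto simp: w_def vec_eq_iff)
      then show False using v by (auto simp: vec_eq_iff)
    qed
    have "col A j = C *\<^sub>v (- (inverse (v $ r)) \<cdot>\<^sub>v w)"
    proof (rule eq_vecI)
      fix i assume "i < dim_vec (C *\<^sub>v (- (inverse (v $ r)) \<cdot>\<^sub>v w))"
      then have i: "i < nr" using C by simp
      have "(C *\<^sub>v w) $ i + v $ r * col A j $ i = 0"
        using arg_cong[OF eq, of "\<lambda>x. x $ i"] i j A C w by simp
      then have "col A j $ i = - inverse (v $ r) * (C *\<^sub>v w) $ i"
        using vr by (simp add: field_simps add_eq_0_iff)
      then show "col A j $ i = (C *\<^sub>v (- (inverse (v $ r)) \<cdot>\<^sub>v w)) $ i"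
        using i C w by (simp add: mult_mat_vec[of C nr r])
    qed (use A C j in auto)
    then show ?thesis using w by auto
  qed
  then obtain d where d: "\<And>j. j < nc \<Longrightarrow> d j \<in> carrier_vec r \<and> col A j = C *\<^sub>v d j" by metis
  define D where "D = mat r nc (\<lambda>(i, j). d j $ i)"
  have D: "D \<in> carrier_mat r nc" by (simp add: D_def)
  have colD: "col D j = d j" if "j < nc" for j using d[OF that] that by (intro eq_vecI) (auto simp: D_def)
  have "A = C * D"
  proof (rule eq_matI)
    fix i j assume "i < dim_row (C * D)" "j < dim_col (C * D)"
    then have ij: "i < nr" "j < nc" using C D by auto
    then have "A $$ (i, j) = col A j $ i" using A by simp
    also have "\<dots> = (C * D) $$ (i, j)" using d[OF ij(2)] ij C D colD by auto
    finally show "A $$ (i, j) = (C * D) $$ (i, j)" .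
  qed (use A C D in auto)
  then show ?thesis using that[OF J1 J2 J3 C_def inj D] by blast
qed

lemma mat_eq_mult_vec_imp:
  fixes A B :: "'a::semiring_1 mat"
  assumes "A \<in> carrier_mat nr nc" "B \<in> carrier_mat nr nc"
    and eq: "\<And>v. v \<in> carrier_vec nc \<Longrightarrow> A *\<^sub>v v = B *\<^sub>v v"
  shows "A = B"
proof (rule eq_matI)
  fix i j assume "i < dim_row B" "j < dim_col B"
  then have ij: "i < nr" "j < nc" using assms by auto
  have "col A j = col B j"
    using eq[of "unit_vec nc j"] ij mult_mat_unit_vec_col[OF assms(1)] mult_mat_unit_vec_col[OF assms(2)] by simp
  then show "A $$ (i, j) = B $$ (i, j)" using ij assms by (metis carrier_matD index_col)
qed (use assms in auto)

lemma cancel_injective_mat: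
  fixes C :: "'a::comm_ring_1 mat"
  assumes C: "C \<in> carrier_mat nr r" and X: "X \<in> carrier_mat r s" and Y: "Y \<in> carrier_mat r s"
    and inj: "\<And>v. v \<in> carrier_vec r \<Longrightarrow> C *\<^sub>v v = 0\<^sub>v nr \<Longrightarrow> v = 0\<^sub>v r"
    and eq: "C * X = C * Y"
  shows "X = Y"
proof (rule mat_eq_mult_vec_imp[OF X Y])
  fix v :: "'a vec" assume v: "v \<in> carrier_vec s"
  have "C *\<^sub>v (X *\<^sub>v v) = C *\<^sub>v (Y *\<^sub>v v)" using eq C X Y v by (metis assoc_mult_mat_vec)
  then have "C *\<^sub>v (X *\<^sub>v v - Y *\<^sub>v v) = 0\<^sub>v nr" using C X Y v
    by (subst mult_minus_distrib_mat_vec[of _ nr r]) auto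
  then have z: "X *\<^sub>v v - Y *\<^sub>v v = 0\<^sub>v r" using inj X Y v by auto
  show "X *\<^sub>v v = Y *\<^sub>v v"
  proof (rule eq_vecI)
    fix i assume "i < dim_vec (Y *\<^sub>v v)"
    then show "(X *\<^sub>v v) $ i = (Y *\<^sub>v v) $ i" using arg_cong[OF z, of "\<lambda>x. x $ i"] X Y v by auto
  qed (use X Y in auto)
qed

text \<open>In a rank factorization of the transpose, injectivity forces the left factor to be square and
  invertible; so some \<open>r\<close> rows of \<open>C\<close> form an invertible matrix, and a left inverse only has to look at these
  rows.\<close>

lemma injective_mat_imp_left_inverse:
  fixes C :: "'a::field mat"
  assumes C: "C \<in> carrier_mat nr r"
    and inj: "\<And>v. v \<in> carrier_vec r \<Longrightarrow> C *\<^sub>v v = 0\<^sub>v nr \<Longrightarrow> v = 0\<^sub>v r"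
  obtains L where "L \<in> carrier_mat r nr" "L * C = 1\<^sub>m r"
proof -
  define s where "s = vec_space.rank r (transpose_mat C)"
  obtain J C2 D2 where J: "length J = s" "distinct J" "set J \<subseteq> {..<nr}"
    and C2_def: "C2 = mat r s (\<lambda>(i, j). transpose_mat C $$ (i, J ! j))"
    and C2i: "\<And>v. v \<in> carrier_vec s \<Longrightarrow> C2 *\<^sub>v v = 0\<^sub>v r \<Longrightarrow> v = 0\<^sub>v s"
    and D2: "D2 \<in> carrier_mat s nr" "transpose_mat C = C2 * D2"
    using rank_factorization[OF _ s_def[symmetric], of nr] C by (metis transpose_carrier_mat)
  have C2: "C2 \<in> carrier_mat r s" by (simp add: C2_def)
  have CD: "C = transpose_mat D2 * transpose_mat C2"
    using D2 C2 by (metis transpose_mult transpose_transpose)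
  have "s = r"
  proof (rule antisym)
    show "s \<le> r" using wide_matrix_kernel[OF C2] C2i by (metis not_less)
    show "r \<le> s"
    proof (rule ccontr)
      assume "\<not> r \<le> s"
      then obtain v where v: "v \<in> carrier_vec r" "v \<noteq> 0\<^sub>v r" "transpose_mat C2 *\<^sub>v v = 0\<^sub>v s"
        using wide_matrix_kernel[of "transpose_mat C2" s r] C2 by auto
      have "C *\<^sub>v v = transpose_mat D2 *\<^sub>v (transpose_mat C2 *\<^sub>v v)"
        unfolding CD using D2 C2 v by (intro assoc_mult_mat_vec) auto
      also have "\<dots> = 0\<^sub>v nr" using v D2 by auto
      finally show False using inj v by blast
    qed
  qed
  with C2 have C2: "C2 \<in> carrier_mat r r" by simp
  have "det C2 \<noteq> 0" using det_0_iff_vec_prod_zero_field[OF C2] C2i \<open>s = r\<close> by auto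
  then have "det (transpose_mat C2) \<noteq> 0" using det_transpose[OF C2] by simp
  then obtain Z where Z: "Z \<in> carrier_mat r r" "Z * transpose_mat C2 = 1\<^sub>m r"
    using det_non_zero_imp_unit[of "transpose_mat C2" r "()"] C2 unfolding Units_def by (auto simp: ring_mat_def)
  \<comment> \<open>Row selection: the rows of C with indices J form the transpose of C2.\<close>
  define T where "T = mat r nr (\<lambda>(i, j). if j = J ! i then 1 else 0 :: 'a)"
  have TC: "T * C = transpose_mat C2"
  proof (rule eq_matI)
    fix i j assume "i < dim_row (transpose_mat C2)" "j < dim_col (transpose_mat C2)"
    then have ij: "i < r" "j < r" using C2 by auto
    have Ji: "J ! i < nr" using J ij \<open>s = r\<close> by (metis lessThan_iff nth_mem subsetD)
    have "(T * C) $$ (i, j) = (\<Sum>k<nr. (if k = J ! i then 1 else 0) * C $$ (k, j))"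
      using ij C by (simp add: T_def scalar_prod_def lessThan_atLeast0)
    also have "\<dots> = (\<Sum>k<nr. if k = J ! i then C $$ (k, j) else 0)"
      by (rule sum.cong) auto
    also have "\<dots> = C $$ (J ! i, j)" using Ji by simp
    finally show "(T * C) $$ (i, j) = transpose_mat C2 $$ (i, j)"
      using ij C Ji \<open>s = r\<close> by (simp add: C2_def)
  qed (use C C2 in \<open>auto simp: T_def\<close>)
  have T: "T \<in> carrier_mat r nr" by (simp add: T_def)
  have "(Z * T) * C = 1\<^sub>m r" using Z TC T C by (metis assoc_mult_mat)
  then show ?thesis using that[of "Z * T"] Z T by auto
qed

text \<open>Rank \<open>r\<close>, expressed by matrix equations alone: \<open>A\<close> is injective on the range of \<open>R\<close>, and the columns of
  \<open>K\<close> form a basis of its kernel. Equations over the field of rational functions persist when values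
  at a point are taken, which is how the rank over that field reaches the values of \<open>\<Phi>\<close>.\<close>

definition rank_split ::
  "nat \<Rightarrow> nat \<Rightarrow> nat \<Rightarrow> 'a::semiring_1 mat \<Rightarrow> 'a mat \<Rightarrow> 'a mat \<Rightarrow> 'a mat \<Rightarrow> 'a mat \<Rightarrow> bool" where
  "rank_split nr nc r A S R K L \<longleftrightarrow>
     S \<in> carrier_mat r nr \<and> R \<in> carrier_mat nc r \<and> S * A * R = 1\<^sub>m r \<and>
     K \<in> carrier_mat nc (nc - r) \<and> A * K = 0\<^sub>m nr (nc - r) \<and>
     L \<in> carrier_mat (nc - r) nc \<and> L * K = 1\<^sub>m (nc - r)"

lemma rank_splitting:
  fixes A :: "'a::field mat"
  assumes A: "A \<in> carrier_mat nr nc" and rk: "vec_space.rank nr A = r"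
  obtains S R K L where "rank_split nr nc r A S R K L" "r \<le> nc"
proof -
  obtain J C D where J: "length J = r" "distinct J" "set J \<subseteq> {..<nc}"
    and C_def: "C = mat nr r (\<lambda>(i, j). A $$ (i, J ! j))"
    and Ci: "\<And>v. v \<in> carrier_vec r \<Longrightarrow> C *\<^sub>v v = 0\<^sub>v nr \<Longrightarrow> v = 0\<^sub>v r"
    and D: "D \<in> carrier_mat r nc" and ACD: "A = C * D"
    using rank_factorization[OF A rk] by metis
  have C: "C \<in> carrier_mat nr r" by (simp add: C_def)
  obtain S where S: "S \<in> carrier_mat r nr" "S * C = 1\<^sub>m r"
    using injective_mat_imp_left_inverse[OF C Ci] by blast
  have Jn: "J ! i < nc" if "i < r" for i using J that by (metis lessThan_iff nth_mem subsetD)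
  define R where "R = mat nc r (\<lambda>(i, j). if i = J ! j then 1 else 0 :: 'a)"
  have R: "R \<in> carrier_mat nc r" by (simp add: R_def)
  have AR: "A * R = C"
  proof (rule eq_matI)
    fix i j assume "i < dim_row C" "j < dim_col C"
    then have ij: "i < nr" "j < r" using C by auto
    have "(A * R) $$ (i, j) = (\<Sum>k<nc. A $$ (i, k) * (if k = J ! j then 1 else 0))"
      using ij A by (simp add: R_def scalar_prod_def lessThan_atLeast0)
    also have "\<dots> = (\<Sum>k<nc. if k = J ! j then A $$ (i, k) else 0)"
      by (rule sum.cong) auto
    also have "\<dots> = A $$ (i, J ! j)" using Jn ij by simp
    finally show "(A * R) $$ (i, j) = C $$ (i, j)" using ij by (simp add: C_def)
  qed (use A C R in auto)
  have DR: "D * R = 1\<^sub>m r"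
  proof (rule cancel_injective_mat[OF C _ _ Ci])
    show "C * (D * R) = C * 1\<^sub>m r" using AR ACD C D R by (metis assoc_mult_mat right_mult_one_mat)
  qed (use D R in auto)
  \<comment> \<open>The projection 1 - R D onto the kernel of A along the coordinate space J; restricted to the
    columns outside J it is the identity in the rows outside J.\<close>
  define P where "P = 1\<^sub>m nc - R * D"
  have P: "P \<in> carrier_mat nc nc" unfolding P_def by (intro minus_carrier_mat mult_carrier_mat[OF R D])
  have AP: "A * P = 0\<^sub>m nr nc"
  proof -
    have "A * P = A * 1\<^sub>m nc - A * (R * D)" unfolding P_def
      using A R D by (intro mult_minus_distrib_mat[of _ nr nc]) auto
    also have "A * (R * D) = A" using A R D AR ACD by (metis assoc_mult_mat)
    finally show ?thesis using A by auto
  qed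
  have card: "card ({..<nc} - set J) = nc - r"
    using J by (simp add: card_Diff_subset distinct_card)
  then obtain I where I: "set I = {..<nc} - set J" "distinct I" "length I = nc - r"
    by (metis distinct_card finite_Diff finite_distinct_list finite_lessThan)
  have In: "I ! i < nc" "I ! i \<notin> set J" if "i < nc - r" for i
    using I that by (metis DiffD1 DiffD2 lessThan_iff nth_mem)+
  define T where "T = mat nc (nc - r) (\<lambda>(i, j). if i = I ! j then 1 else 0 :: 'a)"
  define L where "L = mat (nc - r) nc (\<lambda>(i, j). if j = I ! i then 1 else 0 :: 'a)"
  have T: "T \<in> carrier_mat nc (nc - r)" and L: "L \<in> carrier_mat (nc - r) nc"
    by (auto simp: T_def L_def)
  have AK: "A * (P * T) = 0\<^sub>m nr (nc - r)" using AP A P T by (simp flip: assoc_mult_mat)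
  have LR: "L * R = 0\<^sub>m (nc - r) r"
  proof (rule eq_matI)
    fix i j assume "i < dim_row (0\<^sub>m (nc - r) r)" "j < dim_col (0\<^sub>m (nc - r) r)"
    then have ij: "i < nc - r" "j < r" by auto
    have "I ! i \<noteq> J ! j" using In[OF ij(1)] ij J by auto
    then show "(L * R) $$ (i, j) = 0\<^sub>m (nc - r) r $$ (i, j)" using ij
      by (auto simp: L_def R_def scalar_prod_def intro!: sum.neutral)
  qed (auto simp: L_def R_def)
  have LT: "L * T = 1\<^sub>m (nc - r)"
  proof (rule eq_matI)
    fix i j assume "i < dim_row (1\<^sub>m (nc - r) :: 'a mat)" "j < dim_col (1\<^sub>m (nc - r) :: 'a mat)"
    then have ij: "i < nc - r" "j < nc - r" by auto
    have "(L * T) $$ (i, j) = (\<Sum>k<nc. (if k = I ! i then 1 else 0) * (if k = I ! j then 1 else 0))"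
      using ij by (simp add: L_def T_def scalar_prod_def lessThan_atLeast0)
    also have "\<dots> = (\<Sum>k<nc. if k = I ! i then (if I ! i = I ! j then 1 else 0) else 0)"
      by (rule sum.cong) auto
    also have "\<dots> = (if I ! i = I ! j then 1 else 0)" using In[OF ij(1)] by simp
    also have "\<dots> = (if i = j then 1 else 0)" using I ij nth_eq_iff_index_eq by fastforce
    finally show "(L * T) $$ (i, j) = 1\<^sub>m (nc - r) $$ (i, j)" using ij by simp
  qed (auto simp: L_def T_def)
  have "L * P = L - L * R * D" unfolding P_def
    using L R D by (subst mult_minus_distrib_mat[of _ "nc - r" nc]) auto
  also have "\<dots> = L" using LR D L by auto
  finally have "L * (P * T) = 1\<^sub>m (nc - r)" using LT L P T by (simp flip: assoc_mult_mat)
  moreover have "S * A * R = 1\<^sub>m r" using S AR A R by (simp add: assoc_mult_mat[of S r nr A nc R r])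
  moreover have "r \<le> nc" using J card_mono[of "{..<nc}" "set J"] by (simp add: distinct_card)
  moreover have "P * T \<in> carrier_mat nc (nc - r)" using P T by simp
  ultimately show ?thesis using that[of S R "P * T" L] S(1) R AK L unfolding rank_split_def by blast
qed

section \<open>Adjoints and Hermitian forms\<close>

lemma mat_adjoint_eq: "mat_adjoint M = mat (dim_col M) (dim_row M) (\<lambda>(i, j). conjugate (M $$ (j, i)))"
  by (rule eq_matI) (auto simp: mat_adjoint_def mat_of_rows_def)

lemma mat_adjoint_dim [simp]: "dim_row (mat_adjoint M) = dim_col M" "dim_col (mat_adjoint M) = dim_row M"
  unfolding mat_adjoint_eq by simp_all

lemma mat_adjoint_carrier [simp]: "mat_adjoint M \<in> carrier_mat nc nr \<longleftrightarrow> M \<in> carrier_mat nr nc"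
  unfolding carrier_mat_def mem_Collect_eq mat_adjoint_dim by (rule conj_commute)

lemma mat_adjoint_index [simp]:
  "i < dim_col M \<Longrightarrow> j < dim_row M \<Longrightarrow> mat_adjoint M $$ (i, j) = conjugate (M $$ (j, i))"
  unfolding mat_adjoint_eq by simp

lemma mat_adjoint_adjoint [simp]: "mat_adjoint (mat_adjoint M) = M"
  by (rule eq_matI) auto

lemma mat_adjoint_mult:
  fixes A :: "'a::conjugatable_field mat"
  assumes A: "A \<in> carrier_mat nr n" and B: "B \<in> carrier_mat n nc"
  shows "mat_adjoint (A * B) = mat_adjoint B * mat_adjoint A"
proof (rule eq_matI)
  fix i j assume "i < dim_row (mat_adjoint B * mat_adjoint A)" "j < dim_col (mat_adjoint B * mat_adjoint A)"
  then show "mat_adjoint (A * B) $$ (i, j) = (mat_adjoint B * mat_adjoint A) $$ (i, j)"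
    using assms by (auto simp: scalar_prod_def sum_conjugate conjugate_dist_mul mult.commute)
qed (use assms in auto)

lemma mat_adjoint_smult:
  fixes A :: "'a::conjugatable_field mat"
  shows "mat_adjoint (c \<cdot>\<^sub>m A) = conjugate c \<cdot>\<^sub>m mat_adjoint A"
  by (rule eq_matI) (auto simp: conjugate_dist_mul)

lemma mat_adjoint_four_block:
  fixes A :: "'a::conjugatable_field mat"
  assumes "A \<in> carrier_mat nr1 nc1" "B \<in> carrier_mat nr1 nc2" "C \<in> carrier_mat nr2 nc1" "D \<in> carrier_mat nr2 nc2"
  shows "mat_adjoint (four_block_mat A B C D)
    = four_block_mat (mat_adjoint A) (mat_adjoint C) (mat_adjoint B) (mat_adjoint D)"
  using assms by (intro eq_matI) auto

lemma cscalar_prod_adjoint: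
  fixes A :: "complex mat"
  assumes A: "A \<in> carrier_mat nr nc" and v: "v \<in> carrier_vec nc" and w: "w \<in> carrier_vec nr"
  shows "(A *\<^sub>v v) \<bullet>c w = v \<bullet>c (mat_adjoint A *\<^sub>v w)"
proof -
  have "(A *\<^sub>v v) \<bullet>c w = (\<Sum>i<nr. \<Sum>j<nc. A $$ (i, j) * v $ j * cnj (w $ i))"
    using assms by (simp add: scalar_prod_def lessThan_atLeast0 sum_distrib_right)
  also have "\<dots> = (\<Sum>j<nc. \<Sum>i<nr. A $$ (i, j) * v $ j * cnj (w $ i))" by (rule sum.swap)
  also have "\<dots> = v \<bullet>c (mat_adjoint A *\<^sub>v w)"
    using assms by (auto simp: scalar_prod_def lessThan_atLeast0 sum_distrib_left intro!: sum.cong)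
  finally show ?thesis .
qed

lemma cscalar_prod_commute:
  fixes v w :: "complex vec"
  assumes "v \<in> carrier_vec n" "w \<in> carrier_vec n"
  shows "v \<bullet>c w = cnj (w \<bullet>c v)"
  using assms by (auto simp: scalar_prod_def intro!: sum.cong)

lemma Re_cscalar_prod_commute:
  fixes v w :: "complex vec"
  assumes "v \<in> carrier_vec n" "w \<in> carrier_vec n"
  shows "Re (v \<bullet>c w) = Re (w \<bullet>c v)"
  using cscalar_prod_commute[OF assms] by simp

lemma cscalar_prod_linear:
  fixes u v w :: "complex vec"
  assumes "u \<in> carrier_vec n" "v \<in> carrier_vec n" "w \<in> carrier_vec n"
  shows "(u + v) \<bullet>c w = u \<bullet>c w + v \<bullet>c w" "w \<bullet>c (u + v) = w \<bullet>c u + w \<bullet>c v"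
    "(c \<cdot>\<^sub>v u) \<bullet>c w = c * (u \<bullet>c w)" "w \<bullet>c (c \<cdot>\<^sub>v u) = cnj c * (w \<bullet>c u)"
  using assms by (simp_all add: scalar_prod_def distrib_left distrib_right sum.distrib sum_distrib_left mult_ac)

lemma smult_mat_mult_vec:
  fixes A :: "'a::comm_ring_1 mat"
  assumes "A \<in> carrier_mat nr nc" "v \<in> carrier_vec nc"
  shows "(c \<cdot>\<^sub>m A) *\<^sub>v v = c \<cdot>\<^sub>v (A *\<^sub>v v)"
  using assms by (intro eq_vecI) auto

lemma mult_mat_zero_vec [simp]:
  "dim_col A = nc \<Longrightarrow> A *\<^sub>v 0\<^sub>v nc = (0\<^sub>v (dim_row A) :: 'a::semiring_1 vec)"
  by (intro eq_vecI) (auto simp: scalar_prod_def)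

lemma zero_mat_mult_vec [simp]:
  "dim_vec v = nc \<Longrightarrow> 0\<^sub>m nr nc *\<^sub>v v = (0\<^sub>v nr :: 'a::semiring_1 vec)"
  by (intro eq_vecI) (auto simp: scalar_prod_def)

lemma smult_smult_mat: "a \<cdot>\<^sub>m (b \<cdot>\<^sub>m A) = (a * b :: 'a::semigroup_mult) \<cdot>\<^sub>m A"
  by (rule eq_matI) (auto simp: mult.assoc)

lemma vec_append_cases:
  assumes "v \<in> carrier_vec (k + l)"
  obtains x y where "x \<in> carrier_vec k" "y \<in> carrier_vec l" "v = x @\<^sub>v y"
proof
  show "vec_first v k \<in> carrier_vec k" "vec_last v l \<in> carrier_vec l" by simp_all
  show "v = vec_first v k @\<^sub>v vec_last v l" using assms by simp
qed

lemma append_zero_vec [simp]: "0\<^sub>v k @\<^sub>v 0\<^sub>v l = (0\<^sub>v (k + l) :: 'a::zero vec)"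
  by (intro eq_vecI) auto

lemma append_cols_mult_vec:
  fixes A :: "'a::comm_ring_1 mat"
  assumes "A \<in> carrier_mat nr k" "B \<in> carrier_mat nr l" "x \<in> carrier_vec k" "y \<in> carrier_vec l"
  shows "append_cols A B *\<^sub>v (x @\<^sub>v y) = A *\<^sub>v x + B *\<^sub>v y"
proof -
  have "append_cols A B *\<^sub>v (x @\<^sub>v y)
    = (A *\<^sub>v x + B *\<^sub>v y) @\<^sub>v (0\<^sub>m 0 (dim_col A) *\<^sub>v x + 0\<^sub>m 0 (dim_col B) *\<^sub>v y)"
    unfolding append_cols_def using assms by (intro four_block_mat_mult_vec[of _ nr k _ l _ 0]) auto
  also have "\<dots> = A *\<^sub>v x + B *\<^sub>v y" using assms by (intro eq_vecI) auto
  finally show ?thesis .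
qed

lemma append_cols_carrier [simp]:
  "A \<in> carrier_mat nr k \<Longrightarrow> B \<in> carrier_mat nr l \<Longrightarrow> append_cols A B \<in> carrier_mat nr (k + l)"
  by (auto simp: append_cols_def)

definition hform :: "complex mat \<Rightarrow> complex vec \<Rightarrow> real" where
  "hform H v = Re ((H *\<^sub>v v) \<bullet>c v)"

lemma hform_mult_zero [simp]: "H \<in> carrier_mat N N \<Longrightarrow> V \<in> carrier_mat N k \<Longrightarrow> hform H (V *\<^sub>v 0\<^sub>v k) = 0"
  by (simp add: hform_def)

lemma hform_add:
  assumes D: "D \<in> carrier_mat r r" "mat_adjoint D = D" and "a \<in> carrier_vec r" "b \<in> carrier_vec r"
  shows "hform D (a + b) = hform D a + 2 * Re (a \<bullet>c (D *\<^sub>v b)) + hform D b"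
proof -
  have 1: "(D *\<^sub>v a) \<bullet>c b = a \<bullet>c (D *\<^sub>v b)" using cscalar_prod_adjoint[of D r r a b] assms by simp
  have 2: "Re ((D *\<^sub>v b) \<bullet>c a) = Re (a \<bullet>c (D *\<^sub>v b))"
    using assms by (intro Re_cscalar_prod_commute[of _ r]) auto
  have "D *\<^sub>v (a + b) = D *\<^sub>v a + D *\<^sub>v b" using assms by (intro mult_add_distrib_mat_vec) auto
  then show ?thesis unfolding hform_def using assms 1 2 by (simp add: cscalar_prod_linear[of _ r])
qed

lemma hform_diag:
  assumes "A \<in> carrier_mat p p" "B \<in> carrier_mat r r" "x \<in> carrier_vec p" "y \<in> carrier_vec r"
  shows "hform (four_block_mat A (0\<^sub>m p r) (0\<^sub>m r p) B) (x @\<^sub>v y) = hform A x + hform B y"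
proof -
  have "conjugate (x @\<^sub>v y) = conjugate x @\<^sub>v conjugate y" by (intro eq_vecI) auto
  then show ?thesis unfolding hform_def
    using assms four_block_mat_mult_vec[of A p p "0\<^sub>m p r" r "0\<^sub>m r p" r B x y]
    by (simp add: scalar_prod_append[of _ p _ r])
qed

lemma hform_congruence:
  assumes "H \<in> carrier_mat N N" "U \<in> carrier_mat N k" "x \<in> carrier_vec k"
  shows "hform (mat_adjoint U * H * U) x = hform H (U *\<^sub>v x)"
proof -
  have "(mat_adjoint U * H * U) *\<^sub>v x = mat_adjoint U *\<^sub>v (H *\<^sub>v (U *\<^sub>v x))"
    using assms by (simp add: assoc_mult_mat_vec[of _ k N _ k] assoc_mult_mat_vec[of _ k N _ N])
  then show ?thesis unfolding hform_def
    using assms cscalar_prod_adjoint[of "mat_adjoint U" k N "H *\<^sub>v (U *\<^sub>v x)" x] by simp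
qed

lemma hform_smult_mat:
  assumes "D \<in> carrier_mat r r" "v \<in> carrier_vec r"
  shows "hform (of_real s \<cdot>\<^sub>m D) v = s * hform D v"
  using assms by (simp add: hform_def smult_mat_mult_vec[of _ r r] cscalar_prod_linear[of _ r v v])

lemma hform_smult_vec:
  assumes D: "D \<in> carrier_mat r r" and v: "v \<in> carrier_vec r"
  shows "hform D (c \<cdot>\<^sub>v v) = (cmod c)\<^sup>2 * hform D v"
proof -
  have "(D *\<^sub>v (c \<cdot>\<^sub>v v)) \<bullet>c (c \<cdot>\<^sub>v v) = (c * cnj c) * ((D *\<^sub>v v) \<bullet>c v)"
    using assms by (simp add: mult_mat_vec[of _ r r] cscalar_prod_linear[of _ r v v] conjugate_smult_vec)
  then show ?thesis by (simp add: hform_def complex_norm_square[symmetric] del: of_real_power)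
qed

lemma mat_adjoint_smult_real: "mat_adjoint (D :: complex mat) = D \<Longrightarrow> mat_adjoint (of_real s \<cdot>\<^sub>m D) = of_real s \<cdot>\<^sub>m D"
  by (simp add: mat_adjoint_smult)

text \<open>Moving from \<open>v\<close> in the direction \<open>D v\<close> changes the value of the form to first order by
  \<open>2 t |D v|\<^sup>2\<close>; so it becomes negative for small negative \<open>t\<close> unless \<open>D v = 0\<close>.\<close>

lemma psd_null_vector:
  assumes D: "D \<in> carrier_mat r r" "mat_adjoint D = D"
    and psd: "\<And>u. u \<in> carrier_vec r \<Longrightarrow> hform D u \<ge> 0"
    and v: "v \<in> carrier_vec r" "hform D v = 0"
  shows "D *\<^sub>v v = 0\<^sub>v r"
proof -
  define u where "u = D *\<^sub>v v"
  have u: "u \<in> carrier_vec r" using D v by (simp add: u_def)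
  define a where "a = Re (u \<bullet>c u)"
  define h where "h = hform D u"
  have "v \<bullet>c (D *\<^sub>v u) = u \<bullet>c u"
    using cscalar_prod_adjoint[of D r r v u] D v u by (simp add: u_def)
  then have q: "hform D (v + of_real t \<cdot>\<^sub>v u) = 2 * t * a + t\<^sup>2 * h" for t
    using hform_add[OF D v(1), of "of_real t \<cdot>\<^sub>v u"] hform_smult_vec[OF D(1) u, of "of_real t"] u v D
    by (simp add: mult_mat_vec[of _ r r] cscalar_prod_linear[of _ r v] a_def h_def)
  have pos: "2 * t * a + t\<^sup>2 * h \<ge> 0" for t
    unfolding q[symmetric] using u v by (intro psd) auto
  have a0: "a \<ge> 0" using conjugate_square_ge_0_vec[of u] by (simp add: less_eq_complex_def a_def)
  have h0: "h \<ge> 0" unfolding h_def by (rule psd[OF u])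
  have "a = 0"
  proof (rule ccontr)
    assume "a \<noteq> 0"
    with a0 have a1: "a > 0" by simp
    \<comment> \<open>The quadratic polynomial in \<open>t\<close> is negative at this point, chosen so that \<open>h = 0\<close> is no exception.\<close>
    have "2 * (- a / (h + 1)) * a + (- a / (h + 1))\<^sup>2 * h < 0"
    proof -
      have "2 * (- a / (h + 1)) * a + (- a / (h + 1))\<^sup>2 * h = - (a\<^sup>2 * (h + 2)) / (h + 1)\<^sup>2"
        using h0 by (simp add: divide_simps power2_eq_square add_nonneg_eq_0_iff) (simp add: algebra_simps)
      also have "\<dots> < 0" using a1 h0 by (intro divide_neg_pos) auto
      finally show ?thesis .
    qed
    with pos[of "- a / (h + 1)"] show False by simp
  qed
  moreover have "Im (u \<bullet>c u) = 0" using conjugate_square_ge_0_vec[of u] by (simp add: less_eq_complex_def)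
  ultimately have "u \<bullet>c u = 0" by (simp add: a_def complex_eq_iff)
  then show ?thesis using conjugate_square_eq_0_vec[OF u] by (simp add: u_def)
qed

section \<open>Dimensions of negative and of nonnegative subspaces\<close>

text \<open>Subspaces are given by parametrizations \<open>V\<close>. Negativity of the form makes \<open>V\<close> injective in
  the first definition; in the second this has to be required.\<close>

definition neg_on_dim :: "complex mat \<Rightarrow> nat \<Rightarrow> bool" where
  "neg_on_dim H k \<longleftrightarrow> (\<exists>V \<in> carrier_mat (dim_row H) k.
     \<forall>x \<in> carrier_vec k. x \<noteq> 0\<^sub>v k \<longrightarrow> hform H (V *\<^sub>v x) < 0)"

definition nonneg_on_dim :: "complex mat \<Rightarrow> nat \<Rightarrow> bool" where
  "nonneg_on_dim H k \<longleftrightarrow> (\<exists>V \<in> carrier_mat (dim_row H) k.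
     \<forall>x \<in> carrier_vec k. x \<noteq> 0\<^sub>v k \<longrightarrow> V *\<^sub>v x \<noteq> 0\<^sub>v (dim_row H) \<and> hform H (V *\<^sub>v x) \<ge> 0)"

lemma neg_on_dimI:
  assumes "H \<in> carrier_mat N N" "V \<in> carrier_mat N k"
    and "\<And>x. x \<in> carrier_vec k \<Longrightarrow> x \<noteq> 0\<^sub>v k \<Longrightarrow> hform H (V *\<^sub>v x) < 0"
  shows "neg_on_dim H k"
  using assms unfolding neg_on_dim_def by (metis carrier_matD(1))

lemma nonneg_on_dimI:
  assumes "H \<in> carrier_mat N N" "V \<in> carrier_mat N k"
    and "\<And>x. x \<in> carrier_vec k \<Longrightarrow> x \<noteq> 0\<^sub>v k \<Longrightarrow> V *\<^sub>v x \<noteq> 0\<^sub>v N \<and> hform H (V *\<^sub>v x) \<ge> 0"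
  shows "nonneg_on_dim H k"
  using assms unfolding nonneg_on_dim_def by (metis carrier_matD(1))

lemma neg_on_dimE:
  assumes "neg_on_dim H k" "H \<in> carrier_mat N N"
  obtains V where "V \<in> carrier_mat N k"
    "\<And>x. x \<in> carrier_vec k \<Longrightarrow> x \<noteq> 0\<^sub>v k \<Longrightarrow> hform H (V *\<^sub>v x) < 0"
  using assms unfolding neg_on_dim_def by (metis carrier_matD(1))

lemma nonneg_on_dimE:
  assumes "nonneg_on_dim H k" "H \<in> carrier_mat N N"
  obtains V where "V \<in> carrier_mat N k"
    "\<And>x. x \<in> carrier_vec k \<Longrightarrow> x \<noteq> 0\<^sub>v k \<Longrightarrow> V *\<^sub>v x \<noteq> 0\<^sub>v N \<and> hform H (V *\<^sub>v x) \<ge> 0"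
  using assms unfolding nonneg_on_dim_def by (metis carrier_matD(1))

text \<open>Otherwise the two subspaces have a common vector other than zero.\<close>

lemma neg_nonneg_dim_le:
  assumes H: "H \<in> carrier_mat N N" and neg: "neg_on_dim H k" and nonneg: "nonneg_on_dim H l"
  shows "k + l \<le> N"
proof (rule ccontr)
  assume "\<not> k + l \<le> N"
  then have less: "N < k + l" by simp
  obtain V where V: "V \<in> carrier_mat N k"
    and Vn: "\<And>x. x \<in> carrier_vec k \<Longrightarrow> x \<noteq> 0\<^sub>v k \<Longrightarrow> hform H (V *\<^sub>v x) < 0"
    using neg_on_dimE[OF neg H] by blast
  obtain W where W: "W \<in> carrier_mat N l"
    and Wn: "\<And>x. x \<in> carrier_vec l \<Longrightarrow> x \<noteq> 0\<^sub>v l \<Longrightarrow> W *\<^sub>v x \<noteq> 0\<^sub>v N \<and> hform H (W *\<^sub>v x) \<ge> 0"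
    using nonneg_on_dimE[OF nonneg H] by blast
  have VW: "append_cols V W \<in> carrier_mat N (k + l)" using V W by simp
  obtain v where v: "v \<in> carrier_vec (k + l)" "v \<noteq> 0\<^sub>v (k + l)" "append_cols V W *\<^sub>v v = 0\<^sub>v N"
    using wide_matrix_kernel[OF VW less] by auto
  obtain x y where xy: "x \<in> carrier_vec k" "y \<in> carrier_vec l" "v = x @\<^sub>v y"
    using vec_append_cases[OF v(1)] .
  have sum: "V *\<^sub>v x + W *\<^sub>v y = 0\<^sub>v N"
    using append_cols_mult_vec[OF V W xy(1,2)] v xy by simp
  have y0: "y \<noteq> 0\<^sub>v l"
  proof
    assume y: "y = 0\<^sub>v l"
    then have "V *\<^sub>v x = 0\<^sub>v N" using sum V W xy by simp
    then have "hform H (V *\<^sub>v x) = 0" using H by (simp add: hform_def)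
    then have "x = 0\<^sub>v k" using Vn[OF xy(1)] by force
    with y xy v show False by simp
  qed
  have eq: "W *\<^sub>v y = V *\<^sub>v ((-1) \<cdot>\<^sub>v x)"
  proof (rule eq_vecI)
    fix i assume "i < dim_vec (V *\<^sub>v ((-1) \<cdot>\<^sub>v x))"
    then have i: "i < N" using V by simp
    have "(V *\<^sub>v x) $ i + (W *\<^sub>v y) $ i = 0" using arg_cong[OF sum, of "\<lambda>u. u $ i"] i V W by simp
    moreover have "(V *\<^sub>v ((-1) \<cdot>\<^sub>v x)) $ i = - ((V *\<^sub>v x) $ i)"
      using V xy i by (simp add: scalar_prod_def sum_negf)
    ultimately show "(W *\<^sub>v y) $ i = (V *\<^sub>v ((-1) \<cdot>\<^sub>v x)) $ i"
      by (simp add: add_eq_0_iff)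
  qed (use V W in auto)
  have "(-1) \<cdot>\<^sub>v x \<noteq> 0\<^sub>v k" using eq Wn[OF xy(2) y0] V by auto
  then have "hform H (W *\<^sub>v y) < 0" using eq Vn[of "(-1) \<cdot>\<^sub>v x"] xy by simp
  with Wn[OF xy(2) y0] show False by simp
qed

lemma neg_on_dim_diag:
  assumes A: "A \<in> carrier_mat p p" and B: "B \<in> carrier_mat r r"
    and nA: "neg_on_dim A a" and nB: "neg_on_dim B b"
  shows "neg_on_dim (four_block_mat A (0\<^sub>m p r) (0\<^sub>m r p) B) (a + b)" (is "neg_on_dim ?H _")
proof -
  obtain V where V: "V \<in> carrier_mat p a" "\<And>x. x \<in> carrier_vec a \<Longrightarrow> x \<noteq> 0\<^sub>v a \<Longrightarrow> hform A (V *\<^sub>v x) < 0"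
    using neg_on_dimE[OF nA A] by blast
  obtain W where W: "W \<in> carrier_mat r b" "\<And>x. x \<in> carrier_vec b \<Longrightarrow> x \<noteq> 0\<^sub>v b \<Longrightarrow> hform B (W *\<^sub>v x) < 0"
    using neg_on_dimE[OF nB B] by blast
  let ?V = "four_block_mat V (0\<^sub>m p b) (0\<^sub>m r a) W"
  have "hform ?H (?V *\<^sub>v z) < 0"
    if z: "z \<in> carrier_vec (a + b)" "z \<noteq> 0\<^sub>v (a + b)" for z
  proof -
    obtain x y where xy: "x \<in> carrier_vec a" "y \<in> carrier_vec b" "z = x @\<^sub>v y"
      using vec_append_cases[OF z(1)] .
    have "?V *\<^sub>v z = (V *\<^sub>v x) @\<^sub>v (W *\<^sub>v y)" unfolding xy(3)
      using V W xy by (subst four_block_mat_mult_vec[of _ p a _ b _ r]) auto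
    then have *: "hform ?H (?V *\<^sub>v z) = hform A (V *\<^sub>v x) + hform B (W *\<^sub>v y)"
      using hform_diag[OF A B, of "V *\<^sub>v x" "W *\<^sub>v y"] V W xy by simp
    have "hform A (V *\<^sub>v x) \<le> 0" using V(2)[OF xy(1)] hform_mult_zero[OF A V(1)] by (cases "x = 0\<^sub>v a") (simp_all only: less_imp_le order.refl simp_thms)
    moreover have "hform B (W *\<^sub>v y) \<le> 0" using W(2)[OF xy(2)] hform_mult_zero[OF B W(1)] by (cases "y = 0\<^sub>v b") (simp_all only: less_imp_le order.refl simp_thms)
    moreover have "x \<noteq> 0\<^sub>v a \<or> y \<noteq> 0\<^sub>v b" using xy z by auto
    ultimately have "hform A (V *\<^sub>v x) + hform B (W *\<^sub>v y) < 0"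
      using V(2)[OF xy(1)] W(2)[OF xy(2)] by linarith
    with * show ?thesis by simp
  qed
  moreover have "?V \<in> carrier_mat (p + r) (a + b)" using V W by simp
  moreover have "?H \<in> carrier_mat (p + r) (p + r)" using A B by simp
  ultimately show ?thesis by (intro neg_on_dimI[of _ "p + r" ?V]) blast+
qed

lemma nonneg_on_dim_diag:
  assumes A: "A \<in> carrier_mat p p" and B: "B \<in> carrier_mat r r"
    and nA: "nonneg_on_dim A a" and nB: "nonneg_on_dim B b"
  shows "nonneg_on_dim (four_block_mat A (0\<^sub>m p r) (0\<^sub>m r p) B) (a + b)" (is "nonneg_on_dim ?H _")
proof -
  obtain V where V: "V \<in> carrier_mat p a"
    "\<And>x. x \<in> carrier_vec a \<Longrightarrow> x \<noteq> 0\<^sub>v a \<Longrightarrow> V *\<^sub>v x \<noteq> 0\<^sub>v p \<and> hform A (V *\<^sub>v x) \<ge> 0"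
    using nonneg_on_dimE[OF nA A] by blast
  obtain W where W: "W \<in> carrier_mat r b"
    "\<And>x. x \<in> carrier_vec b \<Longrightarrow> x \<noteq> 0\<^sub>v b \<Longrightarrow> W *\<^sub>v x \<noteq> 0\<^sub>v r \<and> hform B (W *\<^sub>v x) \<ge> 0"
    using nonneg_on_dimE[OF nB B] by blast
  let ?V = "four_block_mat V (0\<^sub>m p b) (0\<^sub>m r a) W"
  have "?V *\<^sub>v z \<noteq> 0\<^sub>v (p + r) \<and> hform ?H (?V *\<^sub>v z) \<ge> 0"
    if z: "z \<in> carrier_vec (a + b)" "z \<noteq> 0\<^sub>v (a + b)" for z
  proof -
    obtain x y where xy: "x \<in> carrier_vec a" "y \<in> carrier_vec b" "z = x @\<^sub>v y"
      using vec_append_cases[OF z(1)] .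
    have Vz: "?V *\<^sub>v z = (V *\<^sub>v x) @\<^sub>v (W *\<^sub>v y)" unfolding xy(3)
      using V W xy by (subst four_block_mat_mult_vec[of _ p a _ b _ r]) auto
    then have *: "hform ?H (?V *\<^sub>v z) = hform A (V *\<^sub>v x) + hform B (W *\<^sub>v y)"
      using hform_diag[OF A B, of "V *\<^sub>v x" "W *\<^sub>v y"] V W xy by simp
    have "hform A (V *\<^sub>v x) \<ge> 0" using V(2)[OF xy(1)] hform_mult_zero[OF A V(1)] by (cases "x = 0\<^sub>v a") (simp_all only: order.refl simp_thms)
    moreover have "hform B (W *\<^sub>v y) \<ge> 0" using W(2)[OF xy(2)] hform_mult_zero[OF B W(1)] by (cases "y = 0\<^sub>v b") (simp_all only: order.refl simp_thms)
    moreover have "x \<noteq> 0\<^sub>v a \<or> y \<noteq> 0\<^sub>v b" using xy z by auto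
    then have "V *\<^sub>v x \<noteq> 0\<^sub>v p \<or> W *\<^sub>v y \<noteq> 0\<^sub>v r" using V(2)[OF xy(1)] W(2)[OF xy(2)] by auto
    then have "?V *\<^sub>v z \<noteq> 0\<^sub>v (p + r)"
      unfolding Vz append_zero_vec[symmetric] using V W xy by (subst append_vec_eq[of _ p]) auto
    ultimately show ?thesis using * by simp
  qed
  moreover have "?V \<in> carrier_mat (p + r) (a + b)" using V W by simp
  moreover have "?H \<in> carrier_mat (p + r) (p + r)" using A B by simp
  ultimately show ?thesis by (intro nonneg_on_dimI[of _ "p + r" ?V]) blast+
qed

lemma neg_on_dim_congruence:
  assumes H: "H \<in> carrier_mat N N" and U: "U \<in> carrier_mat N N"
    and n: "neg_on_dim (mat_adjoint U * H * U) k"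
  shows "neg_on_dim H k"
proof -
  obtain V where V: "V \<in> carrier_mat N k"
    "\<And>x. x \<in> carrier_vec k \<Longrightarrow> x \<noteq> 0\<^sub>v k \<Longrightarrow> hform (mat_adjoint U * H * U) (V *\<^sub>v x) < 0"
    using neg_on_dimE[OF n mult_carrier_mat[OF mult_carrier_mat[OF iffD2[OF mat_adjoint_carrier U] H] U]] by blast
  have "hform H ((U * V) *\<^sub>v x) < 0" if "x \<in> carrier_vec k" "x \<noteq> 0\<^sub>v k" for x
    using V(2)[OF that] hform_congruence[OF H U, of "V *\<^sub>v x"] V(1) that U
    by (simp add: assoc_mult_mat_vec[of _ N N _ k])
  then show ?thesis using H U V by (intro neg_on_dimI[of _ N "U * V"]) auto
qed

lemma nonneg_on_dim_congruence:
  assumes H: "H \<in> carrier_mat N N" and U: "U \<in> carrier_mat N N" and inv: "invertible_mat U"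
    and n: "nonneg_on_dim (mat_adjoint U * H * U) k"
  shows "nonneg_on_dim H k"
proof -
  obtain V where V: "V \<in> carrier_mat N k"
    "\<And>x. x \<in> carrier_vec k \<Longrightarrow> x \<noteq> 0\<^sub>v k \<Longrightarrow> V *\<^sub>v x \<noteq> 0\<^sub>v N \<and> hform (mat_adjoint U * H * U) (V *\<^sub>v x) \<ge> 0"
    using nonneg_on_dimE[OF n mult_carrier_mat[OF mult_carrier_mat[OF iffD2[OF mat_adjoint_carrier U] H] U]] by blast
  obtain B where B: "U * B = 1\<^sub>m N" "B * U = 1\<^sub>m (dim_row B)"
    using inv U by (auto simp: invertible_mat_def inverts_mat_def)
  have Bc: "B \<in> carrier_mat N N"
    using arg_cong[OF B(1), of dim_col] arg_cong[OF B(2), of dim_col] U by (intro carrier_matI) simp_all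
  have Ui: "u = 0\<^sub>v N" if "u \<in> carrier_vec N" "U *\<^sub>v u = 0\<^sub>v N" for u
  proof -
    have "u = (B * U) *\<^sub>v u" using B Bc that by simp
    also have "\<dots> = 0\<^sub>v N" using that Bc U by (simp add: assoc_mult_mat_vec[of _ N N _ N])
    finally show ?thesis .
  qed
  have "(U * V) *\<^sub>v x \<noteq> 0\<^sub>v N \<and> hform H ((U * V) *\<^sub>v x) \<ge> 0" if "x \<in> carrier_vec k" "x \<noteq> 0\<^sub>v k" for x
    using V(2)[OF that] hform_congruence[OF H U, of "V *\<^sub>v x"] V(1) that U Ui[of "V *\<^sub>v x"]
    by (auto simp: assoc_mult_mat_vec[of _ N N _ k])
  then show ?thesis using H U V by (intro nonneg_on_dimI[of _ N "U * V"]) auto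
qed

section \<open>Saddle point matrices\<close>

text \<open>Both the evaluated pencil and its canonical blocks have this shape. The form takes the value
  \<open>2 Re \<langle>Y y, x\<rangle> + \<langle>D y, y\<rangle>\<close> at \<open>(x, y)\<close>; so its indices can be read off from the rank of \<open>Y\<close>
  and the restriction of \<open>D\<close> to the kernel of \<open>Y\<close>.\<close>

definition saddle_mat :: "complex mat \<Rightarrow> complex mat \<Rightarrow> complex mat" where
  "saddle_mat Y D = four_block_mat (0\<^sub>m (dim_row Y) (dim_row Y)) Y (mat_adjoint Y) D"

lemma saddle_mat_carrier [simp]:
  "Y \<in> carrier_mat p r \<Longrightarrow> D \<in> carrier_mat r r \<Longrightarrow> saddle_mat Y D \<in> carrier_mat (p + r) (p + r)"
  by (simp add: saddle_mat_def)

lemma hform_saddle: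
  assumes Y: "Y \<in> carrier_mat p r" and D: "D \<in> carrier_mat r r"
    and x: "x \<in> carrier_vec p" and y: "y \<in> carrier_vec r"
  shows "hform (saddle_mat Y D) (x @\<^sub>v y) = 2 * Re ((Y *\<^sub>v y) \<bullet>c x) + hform D y"
proof -
  have "saddle_mat Y D *\<^sub>v (x @\<^sub>v y) = (Y *\<^sub>v y) @\<^sub>v (mat_adjoint Y *\<^sub>v x + D *\<^sub>v y)"
    unfolding saddle_mat_def using assms
    by (subst four_block_mat_mult_vec[of _ p p _ r _ r]) auto
  moreover have "conjugate (x @\<^sub>v y) = conjugate x @\<^sub>v conjugate y" by (intro eq_vecI) auto
  ultimately have "hform (saddle_mat Y D) (x @\<^sub>v y)
      = Re ((Y *\<^sub>v y) \<bullet>c x + (mat_adjoint Y *\<^sub>v x + D *\<^sub>v y) \<bullet>c y)"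
    unfolding hform_def using assms by (simp add: scalar_prod_append[of _ p _ r])
  also have "\<dots> = Re ((Y *\<^sub>v y) \<bullet>c x) + Re ((mat_adjoint Y *\<^sub>v x) \<bullet>c y) + hform D y"
    using assms by (simp add: cscalar_prod_linear[of _ r] hform_def)
  also have "(mat_adjoint Y *\<^sub>v x) \<bullet>c y = x \<bullet>c (Y *\<^sub>v y)"
    using cscalar_prod_adjoint[of "mat_adjoint Y" r p x y] assms by simp
  also have "Re (x \<bullet>c (Y *\<^sub>v y)) = Re ((Y *\<^sub>v y) \<bullet>c x)"
    using assms by (intro Re_cscalar_prod_commute[of _ p]) auto
  finally show ?thesis by simp
qed

text \<open>The assumption \<open>S Y R = 1\<close> says that \<open>Y\<close> has rank at least \<open>a\<close>. For \<open>y = R x + K w\<close> the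
  component \<open>S\<^sup>* t\<close> is paired with \<open>Y y\<close> to \<open>\<langle>x, t\<rangle>\<close>, and
  \<open>t = - x - R\<^sup>* D R x / 2 - R\<^sup>* D K w\<close> cancels all of \<open>\<langle>D y, y\<rangle>\<close> except \<open>\<langle>D K w, K w\<rangle>\<close>, leaving the value
  \<open>- 2 |x|\<^sup>2 + \<langle>D K w, K w\<rangle>\<close>.\<close>

lemma neg_on_dim_saddle:
  assumes Y: "Y \<in> carrier_mat p r" and D: "D \<in> carrier_mat r r" "mat_adjoint D = D"
    and S: "S \<in> carrier_mat a p" and R: "R \<in> carrier_mat r a" and SYR: "S * Y * R = 1\<^sub>m a"
    and K: "K \<in> carrier_mat r l" and YK: "Y * K = 0\<^sub>m p l"
    and neg: "\<And>w. w \<in> carrier_vec l \<Longrightarrow> w \<noteq> 0\<^sub>v l \<Longrightarrow> hform D (K *\<^sub>v w) < 0"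
  shows "neg_on_dim (saddle_mat Y D) (a + l)"
proof -
  define M where "M = (-1) \<cdot>\<^sub>m 1\<^sub>m a + (-1/2) \<cdot>\<^sub>m (mat_adjoint R * D * R)"
  define N where "N = (-1) \<cdot>\<^sub>m (mat_adjoint R * D * K)"
  have M: "M \<in> carrier_mat a a" and N: "N \<in> carrier_mat a l" using R D K by (auto simp: M_def N_def)
  let ?V = "four_block_mat (mat_adjoint S * M) (mat_adjoint S * N) R K"
  have "hform (saddle_mat Y D) (?V *\<^sub>v z) < 0"
    if z: "z \<in> carrier_vec (a + l)" "z \<noteq> 0\<^sub>v (a + l)" for z
  proof -
    obtain x w where xw: "x \<in> carrier_vec a" "w \<in> carrier_vec l" "z = x @\<^sub>v w"
      using vec_append_cases[OF z(1)] .
    define y1 where "y1 = R *\<^sub>v x"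
    define y2 where "y2 = K *\<^sub>v w"
    define t where "t = M *\<^sub>v x + N *\<^sub>v w"
    have y1: "y1 \<in> carrier_vec r" and y2: "y2 \<in> carrier_vec r" and t: "t \<in> carrier_vec a"
      using R K M N xw by (auto simp: y1_def y2_def t_def)
    have St: "mat_adjoint S * M *\<^sub>v x + mat_adjoint S * N *\<^sub>v w = mat_adjoint S *\<^sub>v t"
      unfolding t_def using S M N xw
      by (simp add: mult_add_distrib_mat_vec[of _ p a] assoc_mult_mat_vec[of _ p a _ a] assoc_mult_mat_vec[of _ p a _ l])
    have "?V *\<^sub>v z = (mat_adjoint S *\<^sub>v t) @\<^sub>v (y1 + y2)"
      unfolding xw(3) St[symmetric] y1_def y2_def using S M N R K xw
      by (intro four_block_mat_mult_vec[of _ p a _ l _ r]) auto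
    then have 1: "hform (saddle_mat Y D) (?V *\<^sub>v z)
        = 2 * Re ((Y *\<^sub>v (y1 + y2)) \<bullet>c (mat_adjoint S *\<^sub>v t)) + hform D (y1 + y2)"
      using hform_saddle[OF Y D(1), of "mat_adjoint S *\<^sub>v t" "y1 + y2"] S t y1 y2 by simp
    have "Y *\<^sub>v y2 = 0\<^sub>v p" unfolding y2_def using Y K YK xw by (simp flip: assoc_mult_mat_vec[of _ p r _ l])
    then have Yy: "Y *\<^sub>v (y1 + y2) = Y *\<^sub>v y1"
      using Y y1 y2 by (simp add: mult_add_distrib_mat_vec[of _ p r])
    have "S *\<^sub>v (Y *\<^sub>v y1) = (S * Y * R) *\<^sub>v x" unfolding y1_def using S Y R xw
      by (simp add: assoc_mult_mat_vec[of _ a p _ a] assoc_mult_mat_vec[of _ p r _ a])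
    then have SY: "S *\<^sub>v (Y *\<^sub>v y1) = x" using SYR xw by simp
    have 2: "(Y *\<^sub>v (y1 + y2)) \<bullet>c (mat_adjoint S *\<^sub>v t) = x \<bullet>c t"
      unfolding Yy using cscalar_prod_adjoint[of S a p "Y *\<^sub>v y1" t] S Y y1 t SY by simp
    have t1: "M *\<^sub>v x = (-1) \<cdot>\<^sub>v x + (-1/2) \<cdot>\<^sub>v (mat_adjoint R *\<^sub>v (D *\<^sub>v y1))"
      unfolding M_def y1_def using R D xw
      by (simp add: add_mult_distrib_mat_vec[of _ a a] smult_mat_mult_vec[of _ a a]
          assoc_mult_mat_vec[of _ a r _ a] assoc_mult_mat_vec[of _ a r _ r])
    have t2: "N *\<^sub>v w = (-1) \<cdot>\<^sub>v (mat_adjoint R *\<^sub>v (D *\<^sub>v y2))"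
      unfolding N_def y2_def using R D K xw
      by (simp add: smult_mat_mult_vec[of _ a l] assoc_mult_mat_vec[of _ a r _ l] assoc_mult_mat_vec[of _ a r _ r])
    have adjR: "x \<bullet>c (mat_adjoint R *\<^sub>v (D *\<^sub>v u)) = y1 \<bullet>c (D *\<^sub>v u)" if "u \<in> carrier_vec r" for u
      unfolding y1_def using cscalar_prod_adjoint[of R r a x "D *\<^sub>v u"] R D that xw by simp
    have "Re (y1 \<bullet>c (D *\<^sub>v y1)) = hform D y1" unfolding hform_def
      using D y1 by (intro Re_cscalar_prod_commute[of _ r]) auto
    then have "2 * Re (x \<bullet>c t) = - 2 * Re (x \<bullet>c x) - hform D y1 - 2 * Re (y1 \<bullet>c (D *\<^sub>v y2))"
      unfolding t_def t1 t2 using xw R D y1 y2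
      by (simp add: cscalar_prod_linear[of _ a] adjR)
    then have main: "hform (saddle_mat Y D) (?V *\<^sub>v z) = - 2 * Re (x \<bullet>c x) + hform D y2"
      unfolding 1 2 using hform_add[OF D y1 y2] by simp
    have x0: "Re (x \<bullet>c x) \<ge> 0" using conjugate_square_ge_0_vec[of x] by (simp add: less_eq_complex_def)
    have x1: "Re (x \<bullet>c x) > 0" if "x \<noteq> 0\<^sub>v a"
      using conjugate_square_greater_0_vec[OF xw(1)] that by (simp add: less_complex_def)
    have w0: "hform D y2 \<le> 0" using neg[OF xw(2)] hform_mult_zero[OF D(1) K] unfolding y2_def
      by (cases "w = 0\<^sub>v l") (simp_all only: less_imp_le order.refl simp_thms)
    have "x \<noteq> 0\<^sub>v a \<or> w \<noteq> 0\<^sub>v l" using xw z by auto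
    then show ?thesis using main x0 x1 w0 neg[OF xw(2)] unfolding y2_def by linarith
  qed
  moreover have "?V \<in> carrier_mat (p + r) (a + l)" using S M N R K by simp
  moreover have "saddle_mat Y D \<in> carrier_mat (p + r) (p + r)" using Y D by simp
  ultimately show ?thesis by (intro neg_on_dimI[of _ "p + r" ?V]) blast+
qed

text \<open>The space of all \<open>(x, K w)\<close>; the mixed term vanishes on it.\<close>

lemma nonneg_on_dim_saddle:
  assumes Y: "Y \<in> carrier_mat p r" and D: "D \<in> carrier_mat r r"
    and K: "K \<in> carrier_mat r l" and YK: "Y * K = 0\<^sub>m p l"
    and nonneg: "\<And>w. w \<in> carrier_vec l \<Longrightarrow> w \<noteq> 0\<^sub>v l \<Longrightarrow> K *\<^sub>v w \<noteq> 0\<^sub>v r \<and> hform D (K *\<^sub>v w) \<ge> 0"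
  shows "nonneg_on_dim (saddle_mat Y D) (p + l)"
proof -
  let ?V = "four_block_mat (1\<^sub>m p) (0\<^sub>m p l) (0\<^sub>m r p) K"
  have "?V *\<^sub>v z \<noteq> 0\<^sub>v (p + r) \<and> hform (saddle_mat Y D) (?V *\<^sub>v z) \<ge> 0"
    if z: "z \<in> carrier_vec (p + l)" "z \<noteq> 0\<^sub>v (p + l)" for z
  proof -
    obtain x w where xw: "x \<in> carrier_vec p" "w \<in> carrier_vec l" "z = x @\<^sub>v w"
      using vec_append_cases[OF z(1)] .
    have Vz: "?V *\<^sub>v z = x @\<^sub>v (K *\<^sub>v w)" unfolding xw(3)
      using K xw by (subst four_block_mat_mult_vec[of _ p p _ l _ r]) auto
    have "Y *\<^sub>v (K *\<^sub>v w) = 0\<^sub>v p" using Y K YK xw by (simp flip: assoc_mult_mat_vec[of _ p r _ l])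
    then have "hform (saddle_mat Y D) (?V *\<^sub>v z) = hform D (K *\<^sub>v w)"
      unfolding Vz using hform_saddle[OF Y D xw(1), of "K *\<^sub>v w"] K xw by simp
    moreover have "hform D (K *\<^sub>v w) \<ge> 0" using nonneg[OF xw(2)] hform_mult_zero[OF D K]
      by (cases "w = 0\<^sub>v l") (simp_all only: order.refl simp_thms)
    moreover have "x \<noteq> 0\<^sub>v p \<or> w \<noteq> 0\<^sub>v l" using xw z by auto
    then have "?V *\<^sub>v z \<noteq> 0\<^sub>v (p + r)"
      unfolding Vz append_zero_vec[symmetric] using xw nonneg[OF xw(2)]
      by (subst append_vec_eq[of _ p]) auto
    ultimately show ?thesis by simp
  qed
  moreover have "?V \<in> carrier_mat (p + r) (p + l)" using K by simp
  moreover have "saddle_mat Y D \<in> carrier_mat (p + r) (p + r)" using Y D by simp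
  ultimately show ?thesis by (intro nonneg_on_dimI[of _ "p + r" ?V]) blast+
qed

lemma neg_on_dim_saddle_full:
  assumes Y: "Y \<in> carrier_mat p r" and D: "D \<in> carrier_mat r r" "mat_adjoint D = D"
    and S: "S \<in> carrier_mat a p" and R: "R \<in> carrier_mat r a" and SYR: "S * Y * R = 1\<^sub>m a"
  shows "neg_on_dim (saddle_mat Y D) a"
proof -
  have "Y * 0\<^sub>m r 0 = 0\<^sub>m p 0" using Y by auto
  then have "neg_on_dim (saddle_mat Y D) (a + 0)"
    by (intro neg_on_dim_saddle[OF Y D S R SYR, of "0\<^sub>m r 0"]) auto
  then show ?thesis by simp
qed

lemma nonneg_on_dim_saddle_isotropic:
  assumes Y: "Y \<in> carrier_mat p r" and D: "D \<in> carrier_mat r r"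
  shows "nonneg_on_dim (saddle_mat Y D) p"
proof -
  have "Y * 0\<^sub>m r 0 = 0\<^sub>m p 0" using Y by auto
  then have "nonneg_on_dim (saddle_mat Y D) (p + 0)"
    by (intro nonneg_on_dim_saddle[OF Y D, of "0\<^sub>m r 0"]) auto
  then show ?thesis by simp
qed

section \<open>Rotating a palindromic pencil into a Hermitian matrix\<close>

definition eval_mat :: "complex \<Rightarrow> complex poly mat \<Rightarrow> complex mat" where
  "eval_mat z P = map_mat (\<lambda>p. poly p z) P"

lemma eval_four_block:
  assumes "A \<in> carrier_mat nr1 nc1" "B \<in> carrier_mat nr1 nc2" "C \<in> carrier_mat nr2 nc1" "D \<in> carrier_mat nr2 nc2"
  shows "eval_mat z (four_block_mat A B C D)
    = four_block_mat (eval_mat z A) (eval_mat z B) (eval_mat z C) (eval_mat z D)"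
  unfolding eval_mat_def using assms by (rule map_four_block_mat)

lemma eval_smult: "eval_mat z (p \<cdot>\<^sub>m A) = poly p z \<cdot>\<^sub>m eval_mat z A"
  by (rule eq_matI) (auto simp: eval_mat_def)

lemma eval_carrier [simp]: "eval_mat z A \<in> carrier_mat nr nc \<longleftrightarrow> A \<in> carrier_mat nr nc"
  by (simp add: eval_mat_def)

lemma pencil_carrier [simp]:
  "X \<in> carrier_mat nr nc \<Longrightarrow> Y \<in> carrier_mat nr nc \<Longrightarrow> pencil X Y \<in> carrier_mat nr nc"
  unfolding pencil_def const_mat_def by (intro minus_carrier_mat) simp

lemma eval_zero_mat: "eval_mat z (0\<^sub>m nr nc) = 0\<^sub>m nr nc"
  by (rule eq_matI) (auto simp: eval_mat_def)

lemma eval_mat_mult: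
  assumes "P \<in> carrier_mat nr k" "P' \<in> carrier_mat k nc"
  shows "eval_mat z (P * P') = eval_mat z P * eval_mat z P'"
  using assms by (intro eq_matI) (auto simp: eval_mat_def scalar_prod_def poly_sum intro!: sum.cong)

lemma eval_const_mat: "eval_mat z (const_mat M) = M"
  by (rule eq_matI) (auto simp: eval_mat_def const_mat_def)

lemma eval_pencil:
  assumes "X \<in> carrier_mat nr nc" "Y \<in> carrier_mat nr nc"
  shows "eval_mat z (pencil X Y) = z \<cdot>\<^sub>m X - Y"
  using assms by (intro eq_matI) (auto simp: eval_mat_def pencil_def const_mat_def)

text \<open>The unimodular factor that turns a palindromic pencil at \<open>cis \<omega>\<close> into a Hermitian matrix, times a real
  \<open>\<sigma>\<close>.\<close>

definition rot :: "real \<Rightarrow> real \<Rightarrow> complex" where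
  "rot \<sigma> \<omega> = - \<i> * of_real \<sigma> * cis (- \<omega> / 2)"

lemma cnj_rot: "cnj (rot \<sigma> \<omega>) = - (rot \<sigma> \<omega> * cis \<omega>)"
proof -
  have "cis (- \<omega> / 2) * cis \<omega> = cis (\<omega> / 2)" by (simp add: cis_mult)
  then show ?thesis by (simp add: rot_def cis_cnj)
qed

lemma cnj_rot_cis: "cnj (rot \<sigma> \<omega>) * cnj (cis \<omega>) = - rot \<sigma> \<omega>"
proof -
  have "cis \<omega> * cis (-\<omega>) = 1" by (simp add: cis_mult)
  then show ?thesis by (simp add: cnj_rot cis_cnj)
qed

lemma rot_nonzero: "\<sigma> \<noteq> 0 \<Longrightarrow> rot \<sigma> \<omega> \<noteq> 0"
  by (simp add: rot_def)

lemma rot_times_difference: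
  "rot \<sigma> \<omega> * (cis \<omega> * cis (- \<theta> / 2) - cis (\<theta> / 2)) = of_real (2 * \<sigma> * sin ((\<omega> - \<theta>) / 2))"
proof -
  have "cis (- \<omega> / 2) * (cis \<omega> * cis (- \<theta> / 2) - cis (\<theta> / 2))
      = cis ((\<omega> - \<theta>) / 2) - cis (- ((\<omega> - \<theta>) / 2))"
    by (simp add: right_diff_distrib cis_mult mult.assoc[symmetric] diff_divide_distrib)
  also have "\<dots> = \<i> * of_real (2 * sin ((\<omega> - \<theta>) / 2))" by (simp add: complex_eq_iff)
  finally have *: "cis (- \<omega> / 2) * (cis \<omega> * cis (- \<theta> / 2) - cis (\<theta> / 2))
    = \<i> * of_real (2 * sin ((\<omega> - \<theta>) / 2))" .
  have H: "- \<i> * s * (\<i> * w) = s * w" for s w :: complex by (auto simp: complex_eq_iff)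
  have "rot \<sigma> \<omega> * (cis \<omega> * cis (- \<theta> / 2) - cis (\<theta> / 2))
      = of_real \<sigma> * of_real (2 * sin ((\<omega> - \<theta>) / 2))"
    unfolding rot_def mult.assoc[of _ "cis (- \<omega> / 2)"] * H ..
  also have "\<dots> = of_real (2 * \<sigma> * sin ((\<omega> - \<theta>) / 2))" by (simp only: of_real_mult mult_ac)
  finally show ?thesis .
qed

lemma rot_times_minus_one: "rot \<sigma> \<omega> * (cis \<omega> - 1) = of_real (2 * \<sigma> * sin (\<omega> / 2))"
  using rot_times_difference[of \<sigma> \<omega> 0] by simp

lemma rot_times_plus_one: "rot \<sigma> \<omega> * (\<i> * cis \<omega> + \<i>) = of_real (2 * \<sigma> * cos (\<omega> / 2))"
proof -
  have "cis (- \<omega> / 2) * (cis \<omega> + 1) = cis (\<omega> / 2) + cis (- (\<omega> / 2))"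
    by (simp add: distrib_left cis_mult)
  also have "\<dots> = of_real (2 * cos (\<omega> / 2))" by (simp add: complex_eq_iff)
  finally have "cis (- \<omega> / 2) * (cis \<omega> + 1) = of_real (2 * cos (\<omega> / 2))" .
  moreover have "rot \<sigma> \<omega> * (\<i> * cis \<omega> + \<i>) = of_real \<sigma> * (cis (- \<omega> / 2) * (cis \<omega> + 1))"
  proof -
    have 1: "\<i> * cis \<omega> + \<i> = \<i> * (cis \<omega> + 1)" by (simp only: distrib_left mult_1_right)
    have H: "- \<i> * s * (\<i> * w) = s * w" for s w :: complex by (auto simp: complex_eq_iff)
    have "rot \<sigma> \<omega> * (\<i> * cis \<omega> + \<i>) = - \<i> * of_real \<sigma> * (\<i> * (cis (- \<omega> / 2) * (cis \<omega> + 1)))"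
      unfolding rot_def 1 by (simp only: mult_ac)
    then show ?thesis unfolding H .
  qed
  ultimately show ?thesis by simp
qed

section \<open>Indices of the canonical blocks\<close>

text \<open>The pencil \<open>z F\<^sub>k - J\<^sub>k(\<mu>)\<close> at the point \<open>z\<close>, for \<open>\<alpha> = z - \<mu>\<close>.\<close>

definition antidiag_mat :: "nat \<Rightarrow> complex \<Rightarrow> complex mat" where
  "antidiag_mat k \<alpha> = mat k k (\<lambda>(i, j). if i + j + 1 = k then \<alpha> else if i + j = k then -1 else 0)"

lemma antidiag_mat_carrier [simp]: "antidiag_mat k \<alpha> \<in> carrier_mat k k"
  by (simp add: antidiag_mat_def)

lemma antidiag_mat_invertible:
  assumes "\<alpha> \<noteq> 0"
  obtains Z where "Z \<in> carrier_mat k k" "Z * antidiag_mat k \<alpha> = 1\<^sub>m k" "antidiag_mat k \<alpha> * Z = 1\<^sub>m k"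
proof -
  \<comment> \<open>Reversing the order of the columns makes the matrix lower triangular.\<close>
  define L where "L = mat k k (\<lambda>(i, j). if i = j then \<alpha> else if i = j + 1 then -1 else 0 :: complex)"
  have L: "L \<in> carrier_mat k k" by (simp add: L_def)
  have "det L = prod_list (diag_mat L)"
    by (rule det_lower_triangular[OF _ L]) (auto simp: L_def)
  also have "diag_mat L = replicate k \<alpha>" by (intro nth_equalityI) (auto simp: diag_mat_def L_def)
  also have "prod_list \<dots> = \<alpha> ^ k" by simp
  finally have "det L \<noteq> 0" using assms by simp
  then obtain X where X: "X \<in> carrier_mat k k" "L * X = 1\<^sub>m k"
    using det_non_zero_imp_unit[OF L] unfolding Units_def by (auto simp: ring_mat_def)
  have FL: "L = antidiag_mat k \<alpha> * F_mat k"
  proof (rule eq_matI)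
    fix i j assume "i < dim_row (antidiag_mat k \<alpha> * F_mat k)" "j < dim_col (antidiag_mat k \<alpha> * F_mat k)"
    then have ij: "i < k" "j < k" by (auto simp: antidiag_mat_def F_mat_def)
    have "(antidiag_mat k \<alpha> * F_mat k) $$ (i, j)
        = (\<Sum>l<k. antidiag_mat k \<alpha> $$ (i, l) * (if l + j + 1 = k then 1 else 0))"
      using ij by (simp add: antidiag_mat_def F_mat_def scalar_prod_def lessThan_atLeast0)
    also have "\<dots> = (\<Sum>l<k. if l = k - 1 - j then antidiag_mat k \<alpha> $$ (i, l) else 0)"
      using ij by (intro sum.cong) auto
    also have "\<dots> = antidiag_mat k \<alpha> $$ (i, k - 1 - j)" using ij by simp
    also have "\<dots> = L $$ (i, j)" using ij by (auto simp: antidiag_mat_def L_def)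
    finally show "L $$ (i, j) = (antidiag_mat k \<alpha> * F_mat k) $$ (i, j)" by simp
  qed (auto simp: antidiag_mat_def F_mat_def L_def)
  have F: "F_mat k \<in> carrier_mat k k" by (simp add: F_mat_def)
  have 1: "antidiag_mat k \<alpha> * (F_mat k * X) = 1\<^sub>m k"
    using X FL F by (simp add: assoc_mult_mat[of _ k k _ k _ k])
  have FX: "F_mat k * X \<in> carrier_mat k k" using F X by simp
  have "(F_mat k * X) * antidiag_mat k \<alpha> = 1\<^sub>m k"
    by (rule mat_mult_left_right_inverse[OF antidiag_mat_carrier FX 1])
  with 1 FX show ?thesis using that by blast
qed

fun block_size :: "pkcf_block \<Rightarrow> nat" where
  "block_size (P1 \<epsilon> k \<mu>) = 2 * k"
| "block_size (P2 \<epsilon> k \<theta>) = 2 * k + 1"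
| "block_size (P3 \<epsilon> k \<theta>) = 2 * k"
| "block_size (P4 \<epsilon> k) = 2 * k"
| "block_size (P5 k) = 2 * k + 1"

text \<open>The largest dimension of a subspace on which the rotated block, times \<open>\<sigma>\<close>, is nonnegative. The last summand for P2
  counts the middle coordinate, where the form is \<open>2 \<sigma> \<epsilon> sin ((\<omega> - \<theta>) / 2)\<close>; the one for P3
  counts the vector \<open>e\<^sub>1\<close>, which lies in the kernel of the off-diagonal part only if \<open>\<omega> = \<theta>\<close>.
  This description refers to the interval \<open>0 < \<omega> < 2 * pi\<close>.\<close>

fun block_nonneg :: "real \<Rightarrow> real \<Rightarrow> pkcf_block \<Rightarrow> nat" where
  "block_nonneg \<sigma> \<omega> (P1 \<epsilon> k \<mu>) = k"
| "block_nonneg \<sigma> \<omega> (P2 \<epsilon> k \<theta>) = k + (if \<sigma> * of_int \<epsilon> * sin ((\<omega> - \<theta>) / 2) \<ge> 0 then 1 else 0)"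
| "block_nonneg \<sigma> \<omega> (P3 \<epsilon> k \<theta>) = k + (if \<omega> = \<theta> \<and> \<sigma> * of_int \<epsilon> \<ge> 0 then 1 else 0)"
| "block_nonneg \<sigma> \<omega> (P4 \<epsilon> k) = k"
| "block_nonneg \<sigma> \<omega> (P5 k) = k + 1"

fun block_angle_free :: "real \<Rightarrow> pkcf_block \<Rightarrow> bool" where
  "block_angle_free \<omega> (P2 \<epsilon> k \<theta>) \<longleftrightarrow> \<omega> \<noteq> \<theta>"
| "block_angle_free \<omega> (P3 \<epsilon> k \<theta>) \<longleftrightarrow> \<omega> \<noteq> \<theta>"
| "block_angle_free \<omega> _ \<longleftrightarrow> True"

lemma block_pencil_carrier: "block_pencil b \<in> carrier_mat (block_size b) (block_size b)"
  by (cases b; intro carrier_matI) (simp_all add: nine_block_mat_def append_cols_def append_rows_def pencil_def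
      const_mat_def F_mat_def J_mat_def e1_mat_def SR_mat_def SL_mat_def)

lemma sin_half_difference_nonzero:
  assumes "0 \<le> \<omega>" "\<omega> < 2 * pi" "0 \<le> \<theta>" "\<theta> < 2 * pi" "\<omega> \<noteq> \<theta>"
  shows "sin ((\<omega> - \<theta>) / 2) \<noteq> 0"
proof (cases "\<omega> < \<theta>")
  case True
  then have "sin ((\<theta> - \<omega>) / 2) > 0" using assms by (intro sin_gt_zero) auto
  then show ?thesis using sin_minus[of "(\<theta> - \<omega>) / 2"] by (simp add: minus_divide_left del: sin_minus)
next
  case False
  then have "sin ((\<omega> - \<theta>) / 2) > 0" using assms by (intro sin_gt_zero) auto
  then show ?thesis by simp
qed

lemma sin_half_difference_nonneg_iff:
  assumes "0 \<le> \<omega>" "\<omega> < 2 * pi" "0 \<le> \<theta>" "\<theta> < 2 * pi"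
  shows "0 \<le> sin ((\<omega> - \<theta>) / 2) \<longleftrightarrow> \<theta> \<le> \<omega>"
proof (cases "\<theta> \<le> \<omega>")
  case True
  then have "0 \<le> sin ((\<omega> - \<theta>) / 2)" using assms by (intro sin_ge_zero) auto
  with True show ?thesis by simp
next
  case False
  then have "0 < sin ((\<theta> - \<omega>) / 2)" using assms by (intro sin_gt_zero) auto
  moreover have "sin ((\<omega> - \<theta>) / 2) = - sin ((\<theta> - \<omega>) / 2)"
    using sin_minus[of "(\<theta> - \<omega>) / 2"] by (simp add: minus_divide_left)
  ultimately show ?thesis using False by simp
qed

lemma cis_eq_imp_angle_eq:
  assumes "0 \<le> \<omega>" "\<omega> < 2 * pi" "0 \<le> \<theta>" "\<theta> < 2 * pi" "cis \<omega> = cis \<theta>"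
  shows "\<omega> = \<theta>"
proof -
  have "cis \<omega> * cis (- \<theta> / 2) = cis (\<theta> / 2)" unfolding assms(5) by (simp add: cis_mult)
  then have "sin ((\<omega> - \<theta>) / 2) = 0" using rot_times_difference[of 1 \<omega> \<theta>] by simp
  with sin_half_difference_nonzero[of \<omega> \<theta>] assms show ?thesis by blast
qed

lemma hform_first_coordinate:
  assumes D: "D \<in> carrier_mat r r" and r: "0 < r" and w: "w \<in> carrier_vec 1"
  shows "hform D (e1_mat r *\<^sub>v w) = Re (D $$ (0, 0)) * (cmod (w $ 0))\<^sup>2"
proof -
  define v where "v = w $ 0 \<cdot>\<^sub>v unit_vec r 0"
  have v: "e1_mat r *\<^sub>v w = v" using w r
    by (intro eq_vecI) (auto simp: e1_mat_def v_def scalar_prod_def)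
  have "conjugate v = cnj (w $ 0) \<cdot>\<^sub>v unit_vec r 0" by (intro eq_vecI) (auto simp: v_def unit_vec_def)
  then have "(D *\<^sub>v v) \<bullet>c v = cnj (w $ 0) * (D *\<^sub>v v) $ 0"
    using D r by (simp add: v_def)
  also have "(D *\<^sub>v v) $ 0 = w $ 0 * D $$ (0, 0)"
    using D r by (simp add: v_def mult_mat_vec[of D r r])
  finally have "(D *\<^sub>v v) \<bullet>c v = D $$ (0, 0) * of_real ((cmod (w $ 0))\<^sup>2)"
    by (simp add: complex_norm_square mult_ac del: of_real_power)
  then show ?thesis unfolding hform_def v by simp
qed

lemma first_coordinate_nonzero:
  assumes "0 < r" "w \<in> carrier_vec 1" "w \<noteq> 0\<^sub>v 1"
  shows "w $ 0 \<noteq> (0 :: complex)" "e1_mat r *\<^sub>v w \<noteq> 0\<^sub>v r"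
proof -
  show 0: "w $ 0 \<noteq> 0" using assms by (auto simp: vec_eq_iff)
  have "(e1_mat r *\<^sub>v w) $ 0 = w $ 0" using assms by (auto simp: e1_mat_def scalar_prod_def)
  then show "e1_mat r *\<^sub>v w \<noteq> 0\<^sub>v r" using 0 assms by auto
qed

lemma block_pencil_components:
  "F_mat k \<in> carrier_mat k k" "J_mat k \<mu> \<in> carrier_mat k k"
  "SR_mat k \<in> carrier_mat (k + 1) k" "SL_mat k \<in> carrier_mat k (k + 1)" "e1_mat k \<in> carrier_mat k 1"
  by (auto simp: F_mat_def J_mat_def SR_mat_def SL_mat_def e1_mat_def)

lemma smult_eval_F_J:
  "c \<cdot>\<^sub>m (z \<cdot>\<^sub>m F_mat k - J_mat k \<mu>) = c \<cdot>\<^sub>m antidiag_mat k (z - \<mu>)"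
  by (rule eq_matI) (auto simp: F_mat_def J_mat_def antidiag_mat_def)

lemma smult_eval_J_F:
  assumes c: "cnj c = - (c * z)" "cnj c * cnj z = - c"
  shows "c \<cdot>\<^sub>m (z \<cdot>\<^sub>m J_mat k (cnj \<mu>) - F_mat k) = mat_adjoint (c \<cdot>\<^sub>m antidiag_mat k (z - \<mu>))"
proof (rule eq_matI)
  have 1: "c * (z * cnj \<mu> - 1) = cnj c * (cnj z - cnj \<mu>)"
    unfolding right_diff_distrib c(2) unfolding c(1) by simp
  fix i j assume "i < dim_row (mat_adjoint (c \<cdot>\<^sub>m antidiag_mat k (z - \<mu>)))"
    "j < dim_col (mat_adjoint (c \<cdot>\<^sub>m antidiag_mat k (z - \<mu>)))"
  then show "(c \<cdot>\<^sub>m (z \<cdot>\<^sub>m J_mat k (cnj \<mu>) - F_mat k)) $$ (i, j) = mat_adjoint (c \<cdot>\<^sub>m antidiag_mat k (z - \<mu>)) $$ (i, j)"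
    using 1 c(1) by (auto simp: F_mat_def J_mat_def antidiag_mat_def add.commute)
qed (auto simp: F_mat_def J_mat_def antidiag_mat_def)

lemma eval_square_block:
  assumes c: "cnj c = - (c * z)" "cnj c * cnj z = - c" and D: "D \<in> carrier_mat k k"
  shows "c \<cdot>\<^sub>m eval_mat z (four_block_mat (0\<^sub>m k k) (pencil (F_mat k) (J_mat k \<mu>))
      (pencil (J_mat k (cnj \<mu>)) (F_mat k)) D)
    = saddle_mat (c \<cdot>\<^sub>m antidiag_mat k (z - \<mu>)) (c \<cdot>\<^sub>m eval_mat z D)"
proof -
  define X Z where "X = z \<cdot>\<^sub>m F_mat k - J_mat k \<mu>" and "Z = z \<cdot>\<^sub>m J_mat k (cnj \<mu>) - F_mat k"
  have comp: "F_mat k \<in> carrier_mat k k" "J_mat k \<nu> \<in> carrier_mat k k" for \<nu>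
    by (rule block_pencil_components)+
  have X: "X \<in> carrier_mat k k" and Z: "Z \<in> carrier_mat k k"
    unfolding X_def Z_def by (intro minus_carrier_mat comp)+
  note 0 = eval_zero_mat[of z k k]
  have "eval_mat z (four_block_mat (0\<^sub>m k k) (pencil (F_mat k) (J_mat k \<mu>))
      (pencil (J_mat k (cnj \<mu>)) (F_mat k)) D) = four_block_mat (0\<^sub>m k k) X Z (eval_mat z D)"
    unfolding X_def Z_def 0[symmetric] eval_pencil[OF comp(1,2), symmetric] eval_pencil[OF comp(2,1), symmetric]
    using D comp by (intro eval_four_block[of _ k k _ k _ k]) simp_all
  also have "c \<cdot>\<^sub>m \<dots> = four_block_mat (0\<^sub>m k k) (c \<cdot>\<^sub>m X) (c \<cdot>\<^sub>m Z) (c \<cdot>\<^sub>m eval_mat z D)"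
    using X Z D by (subst smult_four_block_mat[of _ k k _ k _ k]) simp_all
  also have "c \<cdot>\<^sub>m X = c \<cdot>\<^sub>m antidiag_mat k (z - \<mu>)" unfolding X_def by (rule smult_eval_F_J)
  also have "c \<cdot>\<^sub>m Z = mat_adjoint (c \<cdot>\<^sub>m antidiag_mat k (z - \<mu>))" unfolding Z_def by (rule smult_eval_J_F[OF c])
  finally show ?thesis unfolding saddle_mat_def by (simp add: antidiag_mat_def)
qed

text \<open>The splitting here puts the middle row of the block into the lower part: \<open>Y\<close> has a zero column in front, so that
  the first unit vector spans its kernel if \<open>\<omega> \<noteq> \<theta>\<close>.\<close>

lemma eval_block_P2:
  fixes \<epsilon> :: int and k :: nat and \<theta> \<omega> \<sigma> :: real
  assumes "admissible_block (P2 \<epsilon> k \<theta>)"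
  defines "c \<equiv> rot \<sigma> \<omega> * of_int \<epsilon>"
  defines "Y \<equiv> mat k (k + 1) (\<lambda>(i, j). if j = 0 then 0 else c * antidiag_mat k (cis \<omega> - cis \<theta>) $$ (i, j - 1))"
  defines "D \<equiv> mat (k + 1) (k + 1) (\<lambda>(i, j). if i = 0 \<and> j = 0 then of_real (2 * \<sigma> * of_int \<epsilon> * sin ((\<omega> - \<theta>) / 2))
      else if i = 0 \<and> j = 1 then - c else if i = 1 \<and> j = 0 then c * cis \<omega> else 0)"
  shows "rot \<sigma> \<omega> \<cdot>\<^sub>m eval_mat (cis \<omega>) (block_pencil (P2 \<epsilon> k \<theta>)) = saddle_mat Y D"
    and "mat_adjoint D = D"
proof -
  have cn: "cnj c = - (c * cis \<omega>)" "cnj c * cnj (cis \<omega>) = - c"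
    using cnj_rot[of \<sigma> \<omega>] cnj_rot_cis[of \<sigma> \<omega>] by (auto simp: c_def)
  show "mat_adjoint D = D" using cn by (intro eq_matI) (auto simp: D_def)
  have 1: "c * (cis \<omega> * cnj (cis \<theta>) - 1) = cnj c * (cnj (cis \<omega>) - cnj (cis \<theta>))"
    unfolding right_diff_distrib cn(2) unfolding cn(1) by simp
  have 2: "rot \<sigma> \<omega> * (of_int \<epsilon> * (cis \<omega> * cis (- \<theta> / 2) - cis (\<theta> / 2))) =
      of_real (2 * \<sigma> * of_int \<epsilon> * sin ((\<omega> - \<theta>) / 2))"
    using rot_times_difference[of \<sigma> \<omega> \<theta>] by (simp add: mult.left_commute[of "rot \<sigma> \<omega>"])
  have g: "x * (a * (b * e) - d * e) = x * (e * (a * b - d))" for x a b d e :: complex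
    by (simp add: algebra_simps)
  have 3: "rot \<sigma> \<omega> * (cis \<omega> * (cis (- (\<theta> / 2)) * of_int \<epsilon>) - cis (\<theta> / 2) * of_int \<epsilon>)
      = of_real (2 * \<sigma> * of_int \<epsilon> * sin ((\<omega> - \<theta>) / 2))"
    using 2 unfolding g by (simp only: minus_divide_left)
  have pJ: "c * poly (pencil (J_mat k (cnj (cis \<theta>))) (F_mat k) $$ (i, j)) (cis \<omega>)
      = cnj (c * antidiag_mat k (cis \<omega> - cis \<theta>) $$ (j, i))" if "i < k" "j < k" for i j
    using 1 cn(1) that
    by (auto simp: pencil_def const_mat_def F_mat_def J_mat_def antidiag_mat_def add.commute)
  have pF: "c * poly (pencil (F_mat k) (J_mat k (cis \<theta>)) $$ (i, j)) (cis \<omega>)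
      = c * antidiag_mat k (cis \<omega> - cis \<theta>) $$ (i, j)" if "i < k" "j < k" for i j
    using that by (auto simp: pencil_def const_mat_def F_mat_def J_mat_def antidiag_mat_def)
  show "rot \<sigma> \<omega> \<cdot>\<^sub>m eval_mat (cis \<omega>) (block_pencil (P2 \<epsilon> k \<theta>)) = saddle_mat Y D"
  proof (rule eq_matI)
    fix i j assume "i < dim_row (saddle_mat Y D)" "j < dim_col (saddle_mat Y D)"
    then have ij: "i < 2 * k + 1" "j < 2 * k + 1" by (auto simp: saddle_mat_def Y_def D_def)
    have dims: "dim_row (pencil (F_mat k) (J_mat k (cis \<theta>))) = k" "dim_col (pencil (F_mat k) (J_mat k (cis \<theta>))) = k"
      "dim_row (pencil (J_mat k (cnj (cis \<theta>))) (F_mat k)) = k" "dim_col (pencil (J_mat k (cnj (cis \<theta>))) (F_mat k)) = k"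
      by (auto simp: pencil_def const_mat_def F_mat_def J_mat_def)
    consider "i < k" "j < k" | "i < k" "j = k" | j' where "i < k" "j = k + 1 + j'" "j' < k"
      | "i = k" "j < k" | "i = k" "j = k" | j' where "i = k" "j = k + 1 + j'" "j' < k"
      | i' where "i = k + 1 + i'" "i' < k" "j < k" | i' where "i = k + 1 + i'" "i' < k" "j = k"
      | i' j' where "i = k + 1 + i'" "i' < k" "j = k + 1 + j'" "j' < k"
    proof -
      have "i < k \<or> i = k \<or> (\<exists>i'. i = k + 1 + i' \<and> i' < k)" "j < k \<or> j = k \<or> (\<exists>j'. j = k + 1 + j' \<and> j' < k)"
        using ij by presburger+
      then show ?thesis using that by blast
    qed
    then show "(rot \<sigma> \<omega> \<cdot>\<^sub>m eval_mat (cis \<omega>) (block_pencil (P2 \<epsilon> k \<theta>))) $$ (i, j) = saddle_mat Y D $$ (i, j)"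
      using pJ pF 3
      by cases (simp_all add: eval_mat_def nine_block_mat_def append_cols_def append_rows_def dims
          saddle_mat_def Y_def D_def e1_mat_def const_mat_def c_def mult.assoc)
  qed (auto simp: eval_mat_def nine_block_mat_def append_cols_def append_rows_def
      saddle_mat_def Y_def D_def e1_mat_def const_mat_def pencil_def F_mat_def J_mat_def)
qed

lemma eval_block_P5:
  fixes k :: nat
  assumes c: "cnj c = - (c * z)" "cnj c * cnj z = - c"
  defines "Y \<equiv> mat (k + 1) k (\<lambda>(i, j). if i + j + 1 = k then c * z else if i + j = k then - c else 0)"
  shows "c \<cdot>\<^sub>m eval_mat z (block_pencil (P5 k)) = saddle_mat Y (0\<^sub>m k k)"
proof (rule eq_matI)
  fix i j assume "i < dim_row (saddle_mat Y (0\<^sub>m k k))" "j < dim_col (saddle_mat Y (0\<^sub>m k k))"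
  then have ij: "i < 2 * k + 1" "j < 2 * k + 1" by (auto simp: saddle_mat_def Y_def)
  consider "i < k + 1" "j < k + 1" | j' where "i < k + 1" "j = k + 1 + j'" "j' < k"
    | i' where "i = k + 1 + i'" "i' < k" "j < k + 1" | i' j' where "i = k + 1 + i'" "i' < k" "j = k + 1 + j'" "j' < k"
  proof -
    have "i < k + 1 \<or> (\<exists>i'. i = k + 1 + i' \<and> i' < k)" "j < k + 1 \<or> (\<exists>j'. j = k + 1 + j' \<and> j' < k)"
      using ij by presburger+
    then show ?thesis using that by blast
  qed
  then show "(c \<cdot>\<^sub>m eval_mat z (block_pencil (P5 k))) $$ (i, j) = saddle_mat Y (0\<^sub>m k k) $$ (i, j)"
    using c by cases (auto simp: eval_mat_def saddle_mat_def Y_def SR_mat_def SL_mat_def pencil_def const_mat_def)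
qed (auto simp: eval_mat_def saddle_mat_def Y_def SR_mat_def SL_mat_def pencil_def const_mat_def)

lemma eval_block_e1:
  "c \<cdot>\<^sub>m eval_mat z (p \<cdot>\<^sub>m const_mat (e1_mat k * transpose_mat (e1_mat k)))
    = mat k k (\<lambda>(i, j). if i = 0 \<and> j = 0 then c * poly p z else 0)"
  by (rule eq_matI) (auto simp: eval_mat_def const_mat_def e1_mat_def scalar_prod_def)

lemma e1_outer_carrier: "p \<cdot>\<^sub>m const_mat (e1_mat k * transpose_mat (e1_mat k)) \<in> carrier_mat k k"
  by (intro carrier_matI) (simp_all add: const_mat_def e1_mat_def)

lemma antidiag_split:
  assumes "c \<noteq> 0" "\<alpha> \<noteq> 0"
  obtains R where "R \<in> carrier_mat k k" "1\<^sub>m k * (c \<cdot>\<^sub>m antidiag_mat k \<alpha>) * R = 1\<^sub>m k"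
proof -
  obtain Z where Z: "Z \<in> carrier_mat k k" "antidiag_mat k \<alpha> * Z = 1\<^sub>m k"
    using antidiag_mat_invertible[OF assms(2)] by metis
  have "1\<^sub>m k * (c \<cdot>\<^sub>m antidiag_mat k \<alpha>) = c \<cdot>\<^sub>m antidiag_mat k \<alpha>"
    by (rule left_mult_one_mat[of _ k k]) simp
  then have "1\<^sub>m k * (c \<cdot>\<^sub>m antidiag_mat k \<alpha>) * (inverse c \<cdot>\<^sub>m Z)
      = c \<cdot>\<^sub>m (inverse c \<cdot>\<^sub>m (antidiag_mat k \<alpha> * Z))"
    using Z by (simp add: mult_smult_distrib[of _ k k _ k] mult_smult_assoc_mat[of _ k k _ k] smult_smult_mat mult.commute)
  also have "\<dots> = 1\<^sub>m k" unfolding Z(2) smult_smult_mat using assms(1)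
    by (intro eq_matI) auto
  finally show ?thesis using that[of "inverse c \<cdot>\<^sub>m Z"] Z(1) by simp
qed

lemma of_int_smult_eval:
  "rot \<sigma> \<omega> \<cdot>\<^sub>m eval_mat z (of_int \<epsilon> \<cdot>\<^sub>m M) = (rot \<sigma> \<omega> * of_int \<epsilon>) \<cdot>\<^sub>m eval_mat z M"
  unfolding eval_smult smult_smult_mat by simp

text \<open>The nonnegative subspaces come from the vanishing upper left corner of each block, extended by
  \<open>e\<^sub>1\<close> where it lies in the kernel of the off-diagonal part and \<open>D\<close> is nonnegative on it. For the negative ones the off-diagonal part must have full rank \<open>k\<close>, which
  for P2 and P3 fails at the angle of the block. For P5 the corner has size \<open>k + 1\<close> and the off-diagonal part is
  injective for every \<open>z \<noteq> 0\<close>, its first \<open>k\<close> rows being \<open>z F\<^sub>k - J\<^sub>k(0)\<close>.\<close>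

lemma block_index:
  assumes adm: "admissible_block b" and \<omega>: "0 < \<omega>" "\<omega> < 2 * pi" and \<sigma>: "\<sigma> = 1 \<or> \<sigma> = -1"
  defines "H \<equiv> rot \<sigma> \<omega> \<cdot>\<^sub>m eval_mat (cis \<omega>) (block_pencil b)"
  shows "nonneg_on_dim H (block_nonneg \<sigma> \<omega> b)"
    and "block_angle_free \<omega> b \<Longrightarrow> neg_on_dim H (block_size b - block_nonneg \<sigma> \<omega> b)"
proof -
  define z where "z = cis \<omega>"
  have \<sigma>0: "\<sigma> \<noteq> 0" using \<sigma> by auto
  have cn: "cnj (rot \<sigma> \<omega> * of_int \<epsilon>) = - (rot \<sigma> \<omega> * of_int \<epsilon> * z)"
    "cnj (rot \<sigma> \<omega> * of_int \<epsilon>) * cnj z = - (rot \<sigma> \<omega> * of_int \<epsilon>)" for \<epsilon>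
    using cnj_rot[of \<sigma> \<omega>] cnj_rot_cis[of \<sigma> \<omega>] by (auto simp: z_def)
  have cn0: "rot \<sigma> \<omega> * of_int \<epsilon> \<noteq> 0" if "\<epsilon> \<in> {-1, 1}" for \<epsilon> :: int using that rot_nonzero[OF \<sigma>0] by auto
  have z\<theta>: "z - cis \<theta> \<noteq> 0" if "0 \<le> \<theta>" "\<theta> < 2 * pi" "\<omega> \<noteq> \<theta>" for \<theta>
    using cis_eq_imp_angle_eq[of \<omega> \<theta>] that \<omega> by (auto simp: z_def)
  have z1: "z - 1 \<noteq> 0" using z\<theta>[of 0] \<omega> by simp
  have sin0: "sin (\<omega> / 2) > 0" using \<omega> by (intro sin_gt_zero) auto
  have Kpos: "hform D (e1_mat r *\<^sub>v w) = Re (D $$ (0, 0)) * (cmod (w $ 0))\<^sup>2 \<and> 0 < (cmod (w $ 0))\<^sup>2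
      \<and> e1_mat r *\<^sub>v w \<noteq> 0\<^sub>v r"
    if "D \<in> carrier_mat r r" "0 < r" "w \<in> carrier_vec 1" "w \<noteq> 0\<^sub>v 1" for D r w
    using hform_first_coordinate[OF that(1-3)] first_coordinate_nonzero[OF that(2-4)] by simp
  have "nonneg_on_dim H (block_nonneg \<sigma> \<omega> b) \<and>
      (block_angle_free \<omega> b \<longrightarrow> neg_on_dim H (block_size b - block_nonneg \<sigma> \<omega> b))"
  proof (cases b)
    case (P1 \<epsilon> k \<mu>)
    define c where "c = rot \<sigma> \<omega> * of_int \<epsilon>"
    have c0: "c \<noteq> 0" using cn0[of \<epsilon>] adm P1 by (auto simp: c_def)
    have "z - \<mu> \<noteq> 0" using adm P1 by (auto simp: z_def)
    then obtain R where R: "R \<in> carrier_mat k k" "1\<^sub>m k * (c \<cdot>\<^sub>m antidiag_mat k (z - \<mu>)) * R = 1\<^sub>m k"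
      using antidiag_split[OF c0] by metis
    have z0: "c \<cdot>\<^sub>m eval_mat z (0\<^sub>m k k) = 0\<^sub>m k k" by (rule eq_matI) (auto simp: eval_mat_def)
    have Y: "c \<cdot>\<^sub>m antidiag_mat k (z - \<mu>) \<in> carrier_mat k k" by simp
    have adj0: "mat_adjoint (0\<^sub>m k k :: complex mat) = 0\<^sub>m k k" by (rule eq_matI) auto
    have H: "H = saddle_mat (c \<cdot>\<^sub>m antidiag_mat k (z - \<mu>)) (0\<^sub>m k k)"
      unfolding H_def P1 block_pencil.simps of_int_smult_eval z_def[symmetric] c_def[symmetric]
      using eval_square_block[OF cn[of \<epsilon>, folded c_def], of "0\<^sub>m k k" k \<mu>] unfolding z0 by simp
    show ?thesis
      using nonneg_on_dim_saddle_isotropic[OF Y, of "0\<^sub>m k k"]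
        neg_on_dim_saddle_full[OF Y _ adj0 one_carrier_mat R]
      unfolding H P1 by simp
  next
    case (P4 \<epsilon> k)
    define c where "c = rot \<sigma> \<omega> * of_int \<epsilon>"
    have c0: "c \<noteq> 0" using cn0[of \<epsilon>] adm P4 by (auto simp: c_def)
    obtain R where R: "R \<in> carrier_mat k k" "1\<^sub>m k * (c \<cdot>\<^sub>m antidiag_mat k (z - 1)) * R = 1\<^sub>m k"
      using antidiag_split[OF c0 z1] by metis
    define D where "D = mat k k (\<lambda>(i, j). if i = 0 \<and> j = 0 then c * poly [:\<i>, \<i>:] z else 0)"
    have D: "D \<in> carrier_mat k k" by (simp add: D_def)
    have "c * poly [:\<i>, \<i>:] z = of_real (of_int \<epsilon> * (2 * \<sigma> * cos (\<omega> / 2)))"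
      using rot_times_plus_one[of \<sigma> \<omega>] by (simp add: c_def z_def add.commute mult_ac)
    then have "cnj (c * poly [:\<i>, \<i>:] z) = c * poly [:\<i>, \<i>:] z" by (simp only: complex_cnj_complex_of_real)
    then have adjD: "mat_adjoint D = D" by (intro eq_matI) (auto simp: D_def simp del: poly_pCons)
    have Y: "c \<cdot>\<^sub>m antidiag_mat k (z - 1) \<in> carrier_mat k k" by simp
    have H: "H = saddle_mat (c \<cdot>\<^sub>m antidiag_mat k (z - 1)) D"
      unfolding H_def P4 block_pencil.simps of_int_smult_eval z_def[symmetric] c_def[symmetric]
      using eval_square_block[OF cn[of \<epsilon>, folded c_def] e1_outer_carrier, where \<mu> = 1]
      unfolding eval_block_e1 D_def by simp
    show ?thesis
      using nonneg_on_dim_saddle_isotropic[OF Y D] neg_on_dim_saddle_full[OF Y D adjD one_carrier_mat R]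
      unfolding H P4 by simp
  next
    case (P3 \<epsilon> k \<theta>)
    define c where "c = rot \<sigma> \<omega> * of_int \<epsilon>"
    have c0: "c \<noteq> 0" using cn0[of \<epsilon>] adm P3 by (auto simp: c_def)
    define D where "D = mat k k (\<lambda>(i, j). if i = 0 \<and> j = 0 then c * poly [:-1, 1:] z else 0)"
    have D: "D \<in> carrier_mat k k" by (simp add: D_def)
    have d: "c * poly [:-1, 1:] z = of_real (\<sigma> * of_int \<epsilon> * (2 * sin (\<omega> / 2)))"
      using rot_times_minus_one[of \<sigma> \<omega>] by (simp add: c_def z_def mult_ac)
    then have "cnj (c * poly [:-1, 1:] z) = c * poly [:-1, 1:] z" by (simp only: complex_cnj_complex_of_real)
    then have adjD: "mat_adjoint D = D" by (intro eq_matI) (auto simp: D_def simp del: poly_pCons)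
    define Y where "Y = c \<cdot>\<^sub>m antidiag_mat k (z - cis \<theta>)"
    have Y: "Y \<in> carrier_mat k k" by (simp add: Y_def)
    have H: "H = saddle_mat Y D"
      unfolding H_def P3 block_pencil.simps of_int_smult_eval z_def[symmetric] c_def[symmetric]
      using eval_square_block[OF cn[of \<epsilon>, folded c_def] e1_outer_carrier]
      unfolding eval_block_e1 D_def Y_def by simp
    have 1: "neg_on_dim H k" if "\<omega> \<noteq> \<theta>"
    proof -
      have "z - cis \<theta> \<noteq> 0" using z\<theta>[of \<theta>] adm P3 that by simp
      then obtain R where R: "R \<in> carrier_mat k k" "1\<^sub>m k * Y * R = 1\<^sub>m k"
        using antidiag_split[OF c0] unfolding Y_def by metis
      show ?thesis unfolding H by (rule neg_on_dim_saddle_full[OF Y D adjD one_carrier_mat R])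
    qed
    have 2: "nonneg_on_dim H (k + 1)" if "\<omega> = \<theta>" "\<sigma> * of_int \<epsilon> \<ge> 0"
      unfolding H
    proof (rule nonneg_on_dim_saddle[OF Y D])
      have k: "0 < k" using adm P3 by simp
      show "e1_mat k \<in> carrier_mat k 1" by (simp add: e1_mat_def)
      show "Y * e1_mat k = 0\<^sub>m k 1"
        by (rule eq_matI) (auto simp: Y_def antidiag_mat_def e1_mat_def scalar_prod_def z_def that intro!: sum.neutral)
      fix w :: "complex vec" assume w: "w \<in> carrier_vec 1" "w \<noteq> 0\<^sub>v 1"
      have "D $$ (0, 0) = of_real (\<sigma> * of_int \<epsilon> * (2 * sin (\<omega> / 2)))" using k d by (simp add: D_def)
      then have "Re (D $$ (0, 0)) \<ge> 0" using that sin0 by (simp del: of_real_mult)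
      then show "e1_mat k *\<^sub>v w \<noteq> 0\<^sub>v k \<and> 0 \<le> hform D (e1_mat k *\<^sub>v w)"
        using Kpos[OF D k w] by simp
    qed
    show ?thesis using 1 2 nonneg_on_dim_saddle_isotropic[OF Y D] unfolding P3 H by auto
  next
    case (P2 \<epsilon> k \<theta>)
    define c where "c = rot \<sigma> \<omega> * of_int \<epsilon>"
    have c0: "c \<noteq> 0" using cn0[of \<epsilon>] adm P2 by (auto simp: c_def)
    define d where "d = \<sigma> * of_int \<epsilon> * sin ((\<omega> - \<theta>) / 2)"
    define Y where "Y = mat k (k + 1) (\<lambda>(i, j). if j = 0 then 0 else c * antidiag_mat k (cis \<omega> - cis \<theta>) $$ (i, j - 1))"
    define D where "D = mat (k + 1) (k + 1) (\<lambda>(i, j). if i = 0 \<and> j = 0 then of_real (2 * \<sigma> * of_int \<epsilon> * sin ((\<omega> - \<theta>) / 2))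
      else if i = 0 \<and> j = 1 then - c else if i = 1 \<and> j = 0 then c * cis \<omega> else 0)"
    have Y: "Y \<in> carrier_mat k (k + 1)" and D: "D \<in> carrier_mat (k + 1) (k + 1)" by (auto simp: Y_def D_def)
    have H: "H = saddle_mat Y D" and adjD: "mat_adjoint D = D"
      using eval_block_P2[of \<epsilon> k \<theta> \<sigma> \<omega>] adm P2 unfolding H_def Y_def D_def c_def by auto
    have D0: "Re (D $$ (0, 0)) = 2 * d" by (simp add: D_def d_def)
    have K: "e1_mat (k + 1) \<in> carrier_mat (k + 1) 1" by (simp add: e1_mat_def)
    have YK: "Y * e1_mat (k + 1) = 0\<^sub>m k 1"
      by (rule eq_matI) (auto simp: Y_def e1_mat_def scalar_prod_def intro!: sum.neutral)
    have 1: "nonneg_on_dim H (k + 1)" if "d \<ge> 0"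
      unfolding H
    proof (rule nonneg_on_dim_saddle[OF Y D K YK])
      fix w :: "complex vec" assume w: "w \<in> carrier_vec 1" "w \<noteq> 0\<^sub>v 1"
      show "e1_mat (k + 1) *\<^sub>v w \<noteq> 0\<^sub>v (k + 1) \<and> 0 \<le> hform D (e1_mat (k + 1) *\<^sub>v w)"
        using Kpos[OF D _ w] D0 that by simp
    qed
    have neg: "neg_on_dim H k \<and> (d < 0 \<longrightarrow> neg_on_dim H (k + 1))" if "\<omega> \<noteq> \<theta>"
    proof -
      let ?A = "c \<cdot>\<^sub>m antidiag_mat k (z - cis \<theta>)"
      have "z - cis \<theta> \<noteq> 0" using z\<theta>[of \<theta>] adm P2 that by simp
      then obtain R0 where R0: "R0 \<in> carrier_mat k k" "1\<^sub>m k * ?A * R0 = 1\<^sub>m k"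
        using antidiag_split[OF c0] by metis
      define R where "R = mat (k + 1) k (\<lambda>(i, j). if i = 0 then 0 else R0 $$ (i - 1, j))"
      have R: "R \<in> carrier_mat (k + 1) k" by (simp add: R_def)
      have "Y * R = ?A * R0"
      proof (rule eq_matI)
        fix i j assume "i < dim_row (?A * R0)" "j < dim_col (?A * R0)"
        then have ij: "i < k" "j < k" using R0 by (auto simp: antidiag_mat_def)
        have "(Y * R) $$ (i, j) = (\<Sum>l<Suc k. Y $$ (i, l) * R $$ (l, j))"
          using ij Y R by (simp add: scalar_prod_def lessThan_atLeast0 del: sum.op_ivl_Suc)
        also have "\<dots> = (\<Sum>l<k. Y $$ (i, Suc l) * R $$ (Suc l, j))"
          using ij unfolding sum.lessThan_Suc_shift by (simp add: Y_def R_def)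
        also have "\<dots> = (\<Sum>l<k. ?A $$ (i, l) * R0 $$ (l, j))"
          using ij by (intro sum.cong) (auto simp: Y_def R_def z_def antidiag_mat_def)
        also have "\<dots> = (?A * R0) $$ (i, j)"
          using ij R0(1) by (simp add: scalar_prod_def lessThan_atLeast0 antidiag_mat_def)
        finally show "(Y * R) $$ (i, j) = (?A * R0) $$ (i, j)" .
      qed (use Y R R0 in \<open>auto simp: antidiag_mat_def\<close>)
      moreover have "1\<^sub>m k * ?A = ?A"
        by (rule left_mult_one_mat[of _ k k]) simp
      ultimately have SYR: "1\<^sub>m k * Y * R = 1\<^sub>m k" using R0(2) left_mult_one_mat[OF Y] by metis
      have "neg_on_dim H (k + 1)" if "d < 0"
        unfolding H
      proof (rule neg_on_dim_saddle[OF Y D adjD one_carrier_mat R SYR K YK])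
        fix w :: "complex vec" assume w: "w \<in> carrier_vec 1" "w \<noteq> 0\<^sub>v 1"
        show "hform D (e1_mat (k + 1) *\<^sub>v w) < 0"
          using Kpos[OF D _ w] D0 that by (simp add: mult_neg_pos)
      qed
      then show ?thesis using neg_on_dim_saddle_full[OF Y D adjD one_carrier_mat R SYR] unfolding H by simp
    qed
    show ?thesis
    proof (cases "d \<ge> 0")
      case True
      then show ?thesis using 1 neg unfolding P2 by (simp add: d_def)
    next
      case False
      then show ?thesis using neg nonneg_on_dim_saddle_isotropic[OF Y D] unfolding P2 H by (simp add: d_def)
    qed
  next
    case (P5 k)
    define c where "c = rot \<sigma> \<omega>"
    have c0: "c \<noteq> 0" using rot_nonzero[OF \<sigma>0] by (simp add: c_def)
    define Y where "Y = mat (k + 1) k (\<lambda>(i, j). if i + j + 1 = k then c * z else if i + j = k then - c else 0)"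
    have Y: "Y \<in> carrier_mat (k + 1) k" by (simp add: Y_def)
    have H: "H = saddle_mat Y (0\<^sub>m k k)"
      unfolding H_def P5 Y_def z_def[symmetric] c_def[symmetric] using cn[of 1]
      by (intro eval_block_P5) (auto simp: c_def)
    have "z \<noteq> 0" by (simp add: z_def)
    then obtain Z where Z: "Z \<in> carrier_mat k k" "Z * antidiag_mat k z = 1\<^sub>m k"
      using antidiag_mat_invertible by metis
    define S where "S = mat k (k + 1) (\<lambda>(i, j). if j = k then 0 else inverse c * Z $$ (i, j))"
    have S: "S \<in> carrier_mat k (k + 1)" by (simp add: S_def)
    have "S * Y = Z * antidiag_mat k z"
    proof (rule eq_matI)
      fix i j assume "i < dim_row (Z * antidiag_mat k z)" "j < dim_col (Z * antidiag_mat k z)"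
      then have ij: "i < k" "j < k" using Z by (auto simp: antidiag_mat_def)
      have "(S * Y) $$ (i, j) = (\<Sum>l<Suc k. S $$ (i, l) * Y $$ (l, j))"
        using ij Y S by (simp add: scalar_prod_def lessThan_atLeast0 del: sum.op_ivl_Suc)
      also have "\<dots> = (\<Sum>l<k. S $$ (i, l) * Y $$ (l, j))"
        using ij by (simp add: S_def)
      also have "\<dots> = (\<Sum>l<k. Z $$ (i, l) * antidiag_mat k z $$ (l, j))"
        using ij c0 by (intro sum.cong) (auto simp: Y_def S_def antidiag_mat_def)
      also have "\<dots> = (Z * antidiag_mat k z) $$ (i, j)"
        using ij Z(1) by (simp add: scalar_prod_def lessThan_atLeast0 antidiag_mat_def)
      finally show "(S * Y) $$ (i, j) = (Z * antidiag_mat k z) $$ (i, j)" .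
    qed (use Y S Z in \<open>auto simp: antidiag_mat_def\<close>)
    then have SYR: "S * Y * 1\<^sub>m k = 1\<^sub>m k" using Z S Y by simp
    have adj0: "mat_adjoint (0\<^sub>m k k :: complex mat) = 0\<^sub>m k k" by (rule eq_matI) auto
    show ?thesis
      using nonneg_on_dim_saddle_isotropic[OF Y, of "0\<^sub>m k k"]
        neg_on_dim_saddle_full[OF Y _ adj0 S one_carrier_mat SYR]
      unfolding H P5 by simp
  qed
  then show "nonneg_on_dim H (block_nonneg \<sigma> \<omega> b)"
    "block_angle_free \<omega> b \<Longrightarrow> neg_on_dim H (block_size b - block_nonneg \<sigma> \<omega> b)" by auto
qed

lemma smult_eval_diag_Cons:
  assumes A: "A \<in> carrier_mat p p" and B: "diag_block_mat As \<in> carrier_mat r r"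
  shows "c \<cdot>\<^sub>m eval_mat z (diag_block_mat (A # As))
    = four_block_mat (c \<cdot>\<^sub>m eval_mat z A) (0\<^sub>m p r) (0\<^sub>m r p) (c \<cdot>\<^sub>m eval_mat z (diag_block_mat As))"
proof -
  have "diag_block_mat (A # As) = four_block_mat A (0\<^sub>m p r) (0\<^sub>m r p) (diag_block_mat As)"
    using A B by (simp add: Let_def)
  then have "eval_mat z (diag_block_mat (A # As))
      = four_block_mat (eval_mat z A) (0\<^sub>m p r) (0\<^sub>m r p) (eval_mat z (diag_block_mat As))"
    using A B eval_four_block[of A p p "0\<^sub>m p r" r "0\<^sub>m r p" r "diag_block_mat As" z]
    by (simp add: eval_zero_mat)
  then show ?thesis using A B by (simp add: smult_four_block_mat[of _ p p _ r _ r])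
qed

lemma diag_block_pencils_carrier:
  "diag_block_mat (map block_pencil bs) \<in> carrier_mat (sum_list (map block_size bs)) (sum_list (map block_size bs))"
  using carrier_matD[OF block_pencil_carrier] by (intro carrier_matI) (auto simp: dim_diag_block_mat o_def intro!: arg_cong[of _ _ sum_list])

abbreviation "blocks_form \<sigma> \<omega> bs \<equiv> rot \<sigma> \<omega> \<cdot>\<^sub>m eval_mat (cis \<omega>) (diag_block_mat (map block_pencil bs))"

lemma diag_block_index:
  assumes adm: "\<forall>b \<in> set bs. admissible_block b" and \<omega>: "0 < \<omega>" "\<omega> < 2 * pi" and \<sigma>: "\<sigma> = 1 \<or> \<sigma> = -1"
  defines "H \<equiv> blocks_form \<sigma> \<omega> bs"
  shows "nonneg_on_dim H (\<Sum>b\<leftarrow>bs. block_nonneg \<sigma> \<omega> b)"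
    and "\<forall>b \<in> set bs. block_angle_free \<omega> b \<Longrightarrow> neg_on_dim H (\<Sum>b\<leftarrow>bs. block_size b - block_nonneg \<sigma> \<omega> b)"
proof -
  have "nonneg_on_dim H (\<Sum>b\<leftarrow>bs. block_nonneg \<sigma> \<omega> b) \<and> ((\<forall>b \<in> set bs. block_angle_free \<omega> b)
      \<longrightarrow> neg_on_dim H (\<Sum>b\<leftarrow>bs. block_size b - block_nonneg \<sigma> \<omega> b))"
    unfolding H_def using adm
  proof (induction bs)
    case Nil
    have "blocks_form \<sigma> \<omega> [] = 0\<^sub>m 0 0" by (simp add: eval_zero_mat)
    moreover have "nonneg_on_dim (0\<^sub>m 0 0) 0" by (rule nonneg_on_dimI[of _ 0 "0\<^sub>m 0 0"]) auto
    moreover have "neg_on_dim (0\<^sub>m 0 0) 0" by (rule neg_on_dimI[of _ 0 "0\<^sub>m 0 0"]) auto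
    ultimately show ?case by simp
  next
    case (Cons b bs)
    let ?r = "sum_list (map block_size bs)"
    have B: "diag_block_mat (map block_pencil bs) \<in> carrier_mat ?r ?r" by (rule diag_block_pencils_carrier)
    have A: "block_pencil b \<in> carrier_mat (block_size b) (block_size b)" by (rule block_pencil_carrier)
    have eq: "blocks_form \<sigma> \<omega> (b # bs)
      = four_block_mat (rot \<sigma> \<omega> \<cdot>\<^sub>m eval_mat (cis \<omega>) (block_pencil b)) (0\<^sub>m (block_size b) ?r) (0\<^sub>m ?r (block_size b))
          (blocks_form \<sigma> \<omega> bs)"
      unfolding list.map(2) by (rule smult_eval_diag_Cons[OF A B])
    have A': "rot \<sigma> \<omega> \<cdot>\<^sub>m eval_mat (cis \<omega>) (block_pencil b) \<in> carrier_mat (block_size b) (block_size b)"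
      and B': "blocks_form \<sigma> \<omega> bs \<in> carrier_mat ?r ?r"
      using A B by simp_all
    have adm: "admissible_block b" "\<forall>b \<in> set bs. admissible_block b" using Cons.prems by auto
    note IH = Cons.IH[OF adm(2)] and bi = block_index[OF adm(1) \<omega> \<sigma>]
    show ?case
      unfolding eq using nonneg_on_dim_diag[OF A' B' bi(1)] neg_on_dim_diag[OF A' B' bi(2)] IH by simp
  qed
  then show "nonneg_on_dim H (\<Sum>b\<leftarrow>bs. block_nonneg \<sigma> \<omega> b)"
    "\<forall>b \<in> set bs. block_angle_free \<omega> b \<Longrightarrow> neg_on_dim H (\<Sum>b\<leftarrow>bs. block_size b - block_nonneg \<sigma> \<omega> b)" by auto
qed

section \<open>Values of rational functions\<close>

lemma to_complex_0 [simp]: "to_complex 0 = 0"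
  using to_complex_add[of 0 0] by simp

lemma to_complex_uminus: "to_complex (- a) = - to_complex a"
  using to_complex_add[of a "- a"] by (simp add: eq_neg_iff_add_eq_0 add.commute)

lemma to_complex_eq_0_iff [simp]: "to_complex a = 0 \<longleftrightarrow> a = 0"
proof
  assume *: "to_complex a = 0"
  show "a = 0"
  proof (rule ccontr)
    assume "a \<noteq> 0"
    then have "to_complex a * to_complex (inverse a) = 1"
      using to_complex_mult[of a "inverse a"] to_complex_one[where 'a = 'a] by simp
    with * show False by simp
  qed
qed simp

definition ev :: "complex \<Rightarrow> 'a::real_or_complex poly \<Rightarrow> complex" where
  "ev z p = poly (map_poly to_complex p) z"

lemma coeff_map_to_complex: "coeff (map_poly to_complex p) i = to_complex (coeff p i)"
  by (simp add: coeff_map_poly)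

lemma ev_pCons [simp]: "ev z (pCons a p) = to_complex a + z * ev z p"
  by (cases "a = 0 \<and> p = 0") (auto simp: ev_def map_poly_pCons)

lemma ev_0 [simp]: "ev z 0 = 0" by (simp add: ev_def)

lemma ev_1 [simp]: "ev z 1 = 1"
  unfolding one_pCons by (simp add: to_complex_one)

lemma ev_add [simp]: "ev z (p + q) = ev z p + ev z q"
proof -
  have "map_poly to_complex (p + q) = map_poly to_complex p + map_poly to_complex q"
    by (rule poly_eqI) (simp add: coeff_map_to_complex to_complex_add)
  then show ?thesis by (simp add: ev_def)
qed

lemma ev_mult [simp]: "ev z (p * q) = ev z p * ev z q"
proof -
  have sum: "to_complex (sum f A) = (\<Sum>x\<in>A. to_complex (f x))" for f :: "nat \<Rightarrow> 'a" and A
    by (induction A rule: infinite_finite_induct) (auto simp: to_complex_add)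
  have "map_poly to_complex (p * q) = map_poly to_complex p * map_poly to_complex q"
    by (rule poly_eqI) (simp add: coeff_map_to_complex coeff_mult sum to_complex_mult)
  then show ?thesis by (simp add: ev_def)
qed

lemma ev_comm_ring_hom: "comm_ring_hom (ev z :: 'a::real_or_complex poly \<Rightarrow> complex)"
  by unfold_locales auto

lemma finite_ev_roots: "p \<noteq> 0 \<Longrightarrow> finite {z. ev z p = 0}"
proof -
  assume "p \<noteq> 0"
  then have "map_poly to_complex p \<noteq> 0"
    by (metis coeff_0 coeff_map_to_complex poly_eq_iff to_complex_eq_0_iff)
  then show ?thesis unfolding ev_def by (rule poly_roots_finite)
qed

text \<open>The value at a point that is not a pole. Any fraction whose denominator does not vanish at the
  point may be used, so that values are compatible with the arithmetic operations without
  reduction to lowest terms; \<open>is_val_lowest_terms\<close> connects this to \<open>eval_fract\<close>.\<close>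

definition is_val :: "'a::real_or_complex poly fract \<Rightarrow> complex \<Rightarrow> complex \<Rightarrow> bool" where
  "is_val r z c \<longleftrightarrow> (\<exists>p q. r = to_fract p / to_fract q \<and> ev z q \<noteq> 0 \<and> c = ev z p / ev z q)"

lemma is_valI: "ev z q \<noteq> 0 \<Longrightarrow> is_val (to_fract p / to_fract q) z (ev z p / ev z q)"
  unfolding is_val_def by blast

text \<open>The denominator in lowest terms divides every other denominator.\<close>

lemma is_val_lowest_terms:
  assumes "is_val r z c"
  shows "ev z (snd (quot_of_fract r)) \<noteq> 0"
    and "c = ev z (fst (quot_of_fract r)) / ev z (snd (quot_of_fract r))"
proof -
  obtain p q where pq: "r = to_fract p / to_fract q" "ev z q \<noteq> 0" "c = ev z p / ev z q"
    using assms by (auto simp: is_val_def)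
  define a b where "a = fst (quot_of_fract r)" and "b = snd (quot_of_fract r)"
  have b0: "b \<noteq> 0" by (simp add: b_def)
  have q0: "q \<noteq> 0" using pq by auto
  have "to_fract a / to_fract b = r" using Fract_quot_of_fract[of r] by (simp add: a_def b_def Fract_conv_to_fract)
  then have "to_fract a * to_fract q = to_fract p * to_fract b"
    using pq(1) b0 q0 by (auto simp: field_simps)
  then have eq: "a * q = p * b" by (metis to_fract_eq_iff to_fract_mult)
  have "coprime a b" unfolding a_def b_def by (rule coprime_quot_of_fract)
  moreover have "b dvd a * q" using eq by simp
  ultimately have "b dvd q" by (simp add: coprime_commute coprime_dvd_mult_right_iff)
  then have evb: "ev z b \<noteq> 0" using pq(2) by (elim dvdE) auto
  have "ev z a * ev z q = ev z p * ev z b" using arg_cong[OF eq, of "ev z"] by simp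
  then have "c = ev z a / ev z b" using evb pq(2,3) by (simp add: frac_eq_eq)
  with evb show "ev z (snd (quot_of_fract r)) \<noteq> 0"
    "c = ev z (fst (quot_of_fract r)) / ev z (snd (quot_of_fract r))" by (simp_all add: a_def b_def)
qed

lemma is_val_eval_fract: "is_val r z c \<Longrightarrow> eval_fract r z = c"
  using is_val_lowest_terms[of r z c] by (simp add: eval_fract_def ev_def)

lemma is_val_to_fract: "is_val (to_fract p) z (ev z p)"
  using is_valI[of z 1 p] by simp

lemma is_val_0: "is_val 0 z 0" using is_val_to_fract[of 0 z] by simp

lemma is_val_1: "is_val 1 z 1" using is_val_to_fract[of 1 z] by simp

lemma is_val_add:
  assumes "is_val r z c" "is_val s z d"
  shows "is_val (r + s) z (c + d)"
proof -
  obtain p q where 1: "r = to_fract p / to_fract q" "ev z q \<noteq> 0" "c = ev z p / ev z q"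
    using assms by (auto simp: is_val_def)
  obtain p' q' where 2: "s = to_fract p' / to_fract q'" "ev z q' \<noteq> 0" "d = ev z p' / ev z q'"
    using assms by (auto simp: is_val_def)
  have nz: "to_fract q \<noteq> 0" "to_fract q' \<noteq> 0" using 1 2 by auto
  have "r + s = to_fract (p * q' + p' * q) / to_fract (q * q')"
    unfolding 1(1) 2(1) using nz by (simp add: add_frac_eq)
  moreover have "c + d = ev z (p * q' + p' * q) / ev z (q * q')" using 1 2 by (simp add: add_frac_eq)
  moreover have "ev z (q * q') \<noteq> 0" using 1 2 by simp
  ultimately show ?thesis unfolding is_val_def by blast
qed

lemma is_val_mult:
  assumes "is_val r z c" "is_val s z d"
  shows "is_val (r * s) z (c * d)"
proof -
  obtain p q where 1: "r = to_fract p / to_fract q" "ev z q \<noteq> 0" "c = ev z p / ev z q"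
    using assms by (auto simp: is_val_def)
  obtain p' q' where 2: "s = to_fract p' / to_fract q'" "ev z q' \<noteq> 0" "d = ev z p' / ev z q'"
    using assms by (auto simp: is_val_def)
  have "r * s = to_fract (p * p') / to_fract (q * q')" unfolding 1(1) 2(1) by simp
  moreover have "c * d = ev z (p * p') / ev z (q * q')" using 1 2 by simp
  moreover have "ev z (q * q') \<noteq> 0" using 1 2 by simp
  ultimately show ?thesis unfolding is_val_def by blast
qed

lemma is_val_divide:
  assumes "is_val r z c" "is_val s z d" "d \<noteq> 0"
  shows "is_val (r / s) z (c / d)"
proof -
  obtain p q where 2: "s = to_fract p / to_fract q" "ev z q \<noteq> 0" "d = ev z p / ev z q"
    using assms by (auto simp: is_val_def)
  have "ev z p \<noteq> 0" using 2 assms by auto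
  then have "is_val (to_fract q / to_fract p) z (ev z q / ev z p)" by (rule is_valI)
  from is_val_mult[OF assms(1) this] show ?thesis using 2 by (simp add: divide_inverse mult.commute)
qed

lemma is_val_sum:
  "finite A \<Longrightarrow> (\<And>x. x \<in> A \<Longrightarrow> is_val (f x) z (g x)) \<Longrightarrow> is_val (sum f A) z (sum g A)"
  by (induction A rule: finite_induct) (auto intro: is_val_add is_val_0)

lemma finite_no_value: "finite {z. \<not> (\<exists>c. is_val r z c)}"
proof -
  have "{z. \<not> (\<exists>c. is_val r z c)} \<subseteq> {z. ev z (snd (quot_of_fract r)) = 0}"
    using is_valI[of _ "snd (quot_of_fract r)" "fst (quot_of_fract r)"]
    by (auto simp flip: Fract_conv_to_fract)
  then show ?thesis using finite_ev_roots[of "snd (quot_of_fract r)"] finite_subset by auto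
qed

text \<open>On the unit circle \<open>1 / z = cnj z\<close>, so replacing \<open>z\<close> by \<open>1 / z\<close> and conjugating the coefficients
  conjugates the value.\<close>

lemma is_val_poly_tilde:
  assumes z: "cmod z = 1"
  shows "is_val (poly_tilde p) z (cnj (ev z p))"
proof (induction p)
  case 0
  show ?case using is_val_0 by (simp add: poly_tilde_def)
next
  case (pCons a p)
  have zz: "inverse z = cnj z" using z
    by (metis complex_norm_square inverse_unique mult.commute of_real_1 one_power2)
  have x: "is_val (inverse (to_fract [:0, 1:])) z (inverse z)"
    using is_val_divide[OF is_val_1 is_val_to_fract[of "[:0, 1:]" z]] norm_zero[where 'a = complex] z
    by (cases "z = 0") (auto simp: to_complex_one inverse_eq_divide)
  have a: "is_val (to_fract [:conjugate a:]) z (cnj (to_complex a))"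
    using is_val_to_fract[of "[:conjugate a:]" z] by (simp add: to_complex_conjugate)
  have "poly_tilde (pCons a p) = to_fract [:conjugate a:] + inverse (to_fract [:0, 1:]) * poly_tilde p"
    unfolding poly_tilde_def using pCons.hyps by (subst map_poly_pCons) auto
  then show ?case using is_val_add[OF a is_val_mult[OF x pCons.IH]] zz by simp
qed

lemma is_val_fract_tilde:
  assumes z: "cmod z = 1" and r: "is_val r z c"
  shows "is_val (fract_tilde r) z (cnj c)"
proof -
  note low = is_val_lowest_terms[OF r]
  have "is_val (fract_tilde r) z (cnj (ev z (fst (quot_of_fract r))) / cnj (ev z (snd (quot_of_fract r))))"
    unfolding fract_tilde_def using low(1) by (intro is_val_divide is_val_poly_tilde z) auto
  then show ?thesis by (simp add: low(2))
qed

definition mat_val :: "'a::real_or_complex poly fract mat \<Rightarrow> complex \<Rightarrow> complex mat \<Rightarrow> bool" where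
  "mat_val M z C \<longleftrightarrow> dim_row C = dim_row M \<and> dim_col C = dim_col M \<and>
     (\<forall>i < dim_row M. \<forall>j < dim_col M. is_val (M $$ (i, j)) z (C $$ (i, j)))"

lemma mat_val_carrier: "mat_val M z C \<Longrightarrow> M \<in> carrier_mat nr nc \<Longrightarrow> C \<in> carrier_mat nr nc"
  by (auto simp: mat_val_def)

lemma mat_val_mult:
  assumes M: "mat_val M z C" and N: "mat_val N z D" and dim: "dim_col M = dim_row N"
  shows "mat_val (M * N) z (C * D)"
  unfolding mat_val_def
proof (intro conjI allI impI)
  fix i j assume ij: "i < dim_row (M * N)" "j < dim_col (M * N)"
  then have "(M * N) $$ (i, j) = (\<Sum>k<dim_row N. M $$ (i, k) * N $$ (k, j))"
    using dim by (simp add: scalar_prod_def lessThan_atLeast0)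
  moreover have "(C * D) $$ (i, j) = (\<Sum>k<dim_row N. C $$ (i, k) * D $$ (k, j))"
    using ij M N dim by (simp add: mat_val_def scalar_prod_def lessThan_atLeast0)
  ultimately show "is_val ((M * N) $$ (i, j)) z ((C * D) $$ (i, j))"
    using ij M N dim by (auto simp: mat_val_def intro!: is_val_sum is_val_mult)
qed (use M N in \<open>auto simp: mat_val_def\<close>)

lemma mat_val_tilde:
  assumes "cmod z = 1" "mat_val M z C"
  shows "mat_val (mat_tilde M) z (mat_adjoint C)"
  using assms by (auto simp: mat_val_def mat_tilde_def intro: is_val_fract_tilde)

lemma mat_val_rat_mat: "mat_val (rat_mat M) z (map_mat (ev z) M)"
  by (auto simp: mat_val_def rat_mat_def intro: is_val_to_fract)

lemma mat_val_eval_fract: "mat_val M z C \<Longrightarrow> map_mat (\<lambda>r. eval_fract r z) M = C"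
  by (rule eq_matI) (auto simp: mat_val_def intro: is_val_eval_fract)

lemma mat_val_unique: "mat_val M z C \<Longrightarrow> mat_val M z D \<Longrightarrow> C = D"
  using mat_val_eval_fract by metis

lemma mat_val_one: "mat_val (1\<^sub>m k) z (1\<^sub>m k)"
  by (auto simp: mat_val_def is_val_0 is_val_1)

lemma mat_val_zero: "mat_val (0\<^sub>m k l) z (0\<^sub>m k l)"
  by (auto simp: mat_val_def is_val_0)

lemma finite_no_mat_value: "finite {z. \<not> (\<exists>C. mat_val M z C)}"
proof -
  have "{z. \<not> (\<exists>C. mat_val M z C)} \<subseteq> (\<Union>i<dim_row M. \<Union>j<dim_col M. {z. \<not> (\<exists>c. is_val (M $$ (i, j)) z c)})"
  proof
    fix z assume z: "z \<in> {z. \<not> (\<exists>C. mat_val M z C)}"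
    show "z \<in> (\<Union>i<dim_row M. \<Union>j<dim_col M. {z. \<not> (\<exists>c. is_val (M $$ (i, j)) z c)})"
    proof (rule ccontr)
      assume "\<not> ?thesis"
      then have "\<forall>i j. \<exists>c. i < dim_row M \<longrightarrow> j < dim_col M \<longrightarrow> is_val (M $$ (i, j)) z c" by blast
      then obtain c where c: "\<And>i j. i < dim_row M \<Longrightarrow> j < dim_col M \<Longrightarrow> is_val (M $$ (i, j)) z (c i j)"
        by metis
      then have "mat_val M z (mat (dim_row M) (dim_col M) (\<lambda>(i, j). c i j))" by (auto simp: mat_val_def)
      with z show False by blast
    qed
  qed
  then show ?thesis by (rule finite_subset) (intro finite_UN_I finite_lessThan finite_no_value)
qed

text \<open>The finite set consists of the poles of the matrices that split \<open>A\<close> over the field of rational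
  functions.\<close>

lemma generic_rank_splitting:
  assumes A: "A \<in> carrier_mat nr nc" and rk: "vec_space.rank nr A = r"
  obtains F where "finite F" "r \<le> nc" "\<And>z C. z \<notin> F \<Longrightarrow> mat_val A z C \<Longrightarrow>
    \<exists>S R K L. rank_split nr nc r C S R K L"
proof -
  obtain S R K L where *: "S \<in> carrier_mat r nr" "R \<in> carrier_mat nc r" "S * A * R = 1\<^sub>m r"
    "K \<in> carrier_mat nc (nc - r)" "A * K = 0\<^sub>m nr (nc - r)"
    "L \<in> carrier_mat (nc - r) nc" "L * K = 1\<^sub>m (nc - r)" "r \<le> nc"
    using rank_splitting[OF A rk] unfolding rank_split_def by metis
  define F where "F = {z. \<not> (\<exists>C. mat_val S z C)} \<union> {z. \<not> (\<exists>C. mat_val R z C)}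
    \<union> {z. \<not> (\<exists>C. mat_val K z C)} \<union> {z. \<not> (\<exists>C. mat_val L z C)}"
  have "finite F" unfolding F_def by (intro finite_UnI finite_no_mat_value)
  moreover have "\<exists>S R K L. rank_split nr nc r C S R K L"
    if z: "z \<notin> F" and C: "mat_val A z C" for z C
  proof -
    obtain S' R' K' L' where v: "mat_val S z S'" "mat_val R z R'" "mat_val K z K'" "mat_val L z L'"
      using z by (auto simp: F_def)
    have "mat_val (S * A * R) z (S' * C * R')" using v C * A by (intro mat_val_mult) auto
    then have 1: "S' * C * R' = 1\<^sub>m r" using mat_val_unique mat_val_one *(3) by metis
    have "mat_val (A * K) z (C * K')" using v C * A by (intro mat_val_mult) auto
    then have 2: "C * K' = 0\<^sub>m nr (nc - r)" using mat_val_unique mat_val_zero *(5) by metis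
    have "mat_val (L * K) z (L' * K')" using v * by (intro mat_val_mult) auto
    then have 3: "L' * K' = 1\<^sub>m (nc - r)" using mat_val_unique mat_val_one *(7) by metis
    note c = mat_val_carrier[OF v(1) *(1)] mat_val_carrier[OF v(2) *(2)]
      mat_val_carrier[OF v(3) *(4)] mat_val_carrier[OF v(4) *(6)]
    show ?thesis unfolding rank_split_def
      by (rule exI[of _ S'], rule exI[of _ R'], rule exI[of _ K'], rule exI[of _ L']) (intro conjI c 1 2 3)
  qed
  ultimately show ?thesis by (intro that[of F] *(8))
qed

section \<open>The Popov function on the unit circle\<close>

abbreviation (input) "complex_mat \<equiv> map_mat to_complex"

lemma ev_det:
  assumes "M \<in> carrier_mat n n"
  shows "ev z (det M) = det (map_mat (ev z) M)"
proof -
  interpret comm_ring_hom "ev z :: 'a poly \<Rightarrow> complex" by (rule ev_comm_ring_hom)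
  show ?thesis by (rule hom_det[symmetric])
qed

lemma map_ev_mult:
  fixes M N :: "'a::real_or_complex poly mat"
  assumes "M \<in> carrier_mat nr k" "N \<in> carrier_mat k nc"
  shows "map_mat (ev z) (M * N) = map_mat (ev z) M * map_mat (ev z) N"
proof -
  interpret comm_ring_hom "ev z :: 'a poly \<Rightarrow> complex" by (rule ev_comm_ring_hom)
  show ?thesis using assms by (rule mat_hom_mult)
qed

lemma map_ev_pencil:
  assumes "E \<in> carrier_mat nr nc" "A \<in> carrier_mat nr nc"
  shows "map_mat (ev z) (pencil E A) = z \<cdot>\<^sub>m complex_mat E - complex_mat A"
proof -
  interpret comm_ring_hom "ev z :: 'a poly \<Rightarrow> complex" by (rule ev_comm_ring_hom)
  show ?thesis using assms
    by (intro eq_matI) (auto simp: pencil_def const_mat_def hom_minus to_complex_one to_complex_uminus)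
qed

lemma map_ev_const: "map_mat (ev z) (const_mat M) = complex_mat M"
  by (rule eq_matI) (auto simp: const_mat_def)

lemma const_mat_carrier [simp]: "const_mat M \<in> carrier_mat nr nc \<longleftrightarrow> M \<in> carrier_mat nr nc"
  by (simp add: const_mat_def)

lemma rat_mat_mult:
  assumes "M \<in> carrier_mat nr k" "N \<in> carrier_mat k nc"
  shows "rat_mat (M * N) = rat_mat M * rat_mat N"
  using assms by (intro eq_matI) (auto simp: rat_mat_def scalar_prod_def intro!: sum.cong)

lemma mat_inverse_rat_mat:
  fixes P :: "'a::field_gcd poly mat"
  assumes P: "P \<in> carrier_mat n n" and det: "det P \<noteq> 0"
  shows "the (mat_inverse (rat_mat P)) = inverse (to_fract (det P)) \<cdot>\<^sub>m rat_mat (adj_mat P)"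
proof -
  let ?Y = "inverse (to_fract (det P)) \<cdot>\<^sub>m rat_mat (adj_mat P)"
  note adj = adj_mat[OF P]
  have rP: "rat_mat P \<in> carrier_mat n n" and Y: "?Y \<in> carrier_mat n n"
    using P adj(1) by (auto simp: rat_mat_def)
  have "rat_mat P * ?Y = inverse (to_fract (det P)) \<cdot>\<^sub>m rat_mat (P * adj_mat P)"
    using P adj(1) by (subst rat_mat_mult[of _ n n _ n]) (auto simp: rat_mat_def intro!: mult_smult_distrib)
  also have "\<dots> = 1\<^sub>m n"
    unfolding adj(2) using det by (intro eq_matI) (auto simp: rat_mat_def)
  finally have PY: "rat_mat P * ?Y = 1\<^sub>m n" .
  have YP: "?Y * rat_mat P = 1\<^sub>m n" by (rule mat_mult_left_right_inverse[OF rP Y PY])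
  have "rat_mat P \<in> Units (ring_mat TYPE('a poly fract) n ())"
    unfolding Units_def using rP Y PY YP by (auto simp: ring_mat_def)
  then obtain X where X: "mat_inverse (rat_mat P) = Some X"
    using mat_inverse(1)[OF rP, where b = "()"] by (cases "mat_inverse (rat_mat P)") auto
  note Xp = mat_inverse(2)[OF rP X]
  have "X = X * (rat_mat P * ?Y)" using Xp PY by (metis right_mult_one_mat)
  also have "\<dots> = X * rat_mat P * ?Y" using Xp rP Y by (intro assoc_mult_mat[symmetric]) auto
  also have "\<dots> = ?Y" using Xp left_mult_one_mat[OF Y] by simp
  finally show ?thesis using X by simp
qed

text \<open>By Cramer's rule the matrix \<open>[(z E - A)\<^sup>-\<^sup>1 B; 1]\<close> is a polynomial matrix divided by \<open>det (z E - A)\<close>. The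
  polynomial numerator is defined everywhere, which is what the continuity argument relies on.\<close>

definition graph_poly :: "'a::real_or_complex mat \<Rightarrow> 'a mat \<Rightarrow> 'a mat \<Rightarrow> 'a poly mat" where
  "graph_poly E A B = (adj_mat (pencil E A) * const_mat B) @\<^sub>r (det (pencil E A) \<cdot>\<^sub>m 1\<^sub>m (dim_col B))"

definition graph_at :: "'a::real_or_complex mat \<Rightarrow> 'a mat \<Rightarrow> 'a mat \<Rightarrow> complex \<Rightarrow> complex mat" where
  "graph_at E A B z = inverse (ev z (det (pencil E A))) \<cdot>\<^sub>m map_mat (ev z) (graph_poly E A B)"

definition weight_at :: "'a::real_or_complex mat \<Rightarrow> 'a mat \<Rightarrow> 'a mat \<Rightarrow> complex mat" where
  "weight_at Q S R = complex_mat (four_block_mat Q S (mat_adjoint S) R)"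

text \<open>On the unit circle this is the value of the Popov function, see \<open>popov_value\<close>.\<close>

definition popov_at ::
  "'a::real_or_complex mat \<Rightarrow> 'a mat \<Rightarrow> 'a mat \<Rightarrow> 'a mat \<Rightarrow> 'a mat \<Rightarrow> 'a mat \<Rightarrow> complex \<Rightarrow> complex mat" where
  "popov_at E A B Q S R z = mat_adjoint (graph_at E A B z) * weight_at Q S R * graph_at E A B z"

text \<open>Named for its kernel, which is the range of \<open>graph_at\<close> at regular points.\<close>

definition kernel_pencil ::
  "'a::real_or_complex mat \<Rightarrow> 'a mat \<Rightarrow> 'a mat \<Rightarrow> complex \<Rightarrow> complex mat" where
  "kernel_pencil E A B z = append_cols (z \<cdot>\<^sub>m complex_mat E - complex_mat A) (- complex_mat B)"

lemma append_rows_index: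
  assumes "A \<in> carrier_mat nr1 nc" "B \<in> carrier_mat nr2 nc" "i < nr1 + nr2" "j < nc"
  shows "(A @\<^sub>r B) $$ (i, j) = (if i < nr1 then A $$ (i, j) else B $$ (i - nr1, j))"
  using assms by (auto simp: append_rows_def)

lemma sys_carriers:
  assumes "(E, A, B, Q, S, R) \<in> Sigma_w m n"
  shows "E \<in> carrier_mat n n" "A \<in> carrier_mat n n" "B \<in> carrier_mat n m" "Q \<in> carrier_mat n n"
    "S \<in> carrier_mat n m" "R \<in> carrier_mat m m" "mat_adjoint Q = Q" "mat_adjoint R = R"
    "det (pencil E A) \<noteq> 0"
  using assms by (auto simp: Sigma_w_def Sigma_sys_def)

lemma graph_poly_carrier:
  assumes "E \<in> carrier_mat n n" "A \<in> carrier_mat n n" "B \<in> carrier_mat n m"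
  shows "graph_poly E A B \<in> carrier_mat (n + m) m"
  unfolding graph_poly_def using assms adj_mat(1)[OF pencil_carrier[OF assms(1,2)]]
  by (intro carrier_append_rows) auto

lemma graph_at_carrier:
  assumes "E \<in> carrier_mat n n" "A \<in> carrier_mat n n" "B \<in> carrier_mat n m"
  shows "graph_at E A B z \<in> carrier_mat (n + m) m"
  unfolding graph_at_def using graph_poly_carrier[OF assms] by simp

lemma kernel_pencil_carrier:
  assumes "E \<in> carrier_mat n n" "A \<in> carrier_mat n n" "B \<in> carrier_mat n m"
  shows "kernel_pencil E A B z \<in> carrier_mat n (n + m)"
  unfolding kernel_pencil_def using assms
  by (intro append_cols_carrier minus_carrier_mat) auto

lemma weight_at_carrier:
  assumes "(E, A, B, Q, S, R) \<in> Sigma_w m n"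
  shows "weight_at Q S R \<in> carrier_mat (n + m) (n + m)"
  using sys_carriers[OF assms] by (simp add: weight_at_def)

lemma weight_at_hermitian:
  assumes "(E, A, B, Q, S, R) \<in> Sigma_w m n"
  shows "mat_adjoint (weight_at Q S R) = weight_at Q S R"
proof -
  note c = sys_carriers[OF assms]
  let ?W = "four_block_mat Q S (mat_adjoint S) R"
  have W: "?W \<in> carrier_mat (n + m) (n + m)" using c by simp
  have "mat_adjoint ?W = ?W"
    using c by (subst mat_adjoint_four_block[of _ n n _ m _ m]) auto
  then have "conjugate (?W $$ (j, i)) = ?W $$ (i, j)" if "i < n + m" "j < n + m" for i j
    using mat_adjoint_index[of i ?W j] W that by (metis carrier_matD)
  then show ?thesis unfolding weight_at_def using W
    by (intro eq_matI) (simp_all add: to_complex_conjugate[symmetric] del: index_mat_four_block)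
qed

lemma graph_at_mult_vec:
  assumes c: "E \<in> carrier_mat n n" "A \<in> carrier_mat n n" "B \<in> carrier_mat n m"
    and det: "ev z (det (pencil E A)) \<noteq> 0" and v: "v \<in> carrier_vec m"
  obtains y where "y \<in> carrier_vec n" "graph_at E A B z *\<^sub>v v = y @\<^sub>v v"
    "(z \<cdot>\<^sub>m complex_mat E - complex_mat A) *\<^sub>v y = complex_mat B *\<^sub>v v"
proof -
  let ?P = "pencil E A" and ?\<delta> = "ev z (det (pencil E A))"
  let ?X = "z \<cdot>\<^sub>m complex_mat E - complex_mat A"
  have P: "?P \<in> carrier_mat n n" using c by simp
  note adj = adj_mat[OF P]
  define J where "J = map_mat (ev z) (adj_mat ?P)"
  have J: "J \<in> carrier_mat n n" using adj(1) by (simp add: J_def)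
  have B: "complex_mat B \<in> carrier_mat n m" using c by simp
  have X: "?X \<in> carrier_mat n n" using c by (intro minus_carrier_mat) simp
  have XJ: "?X * J = ?\<delta> \<cdot>\<^sub>m 1\<^sub>m n"
  proof -
    have "?X * J = map_mat (ev z) (?P * adj_mat ?P)"
      unfolding J_def map_ev_pencil[OF c(1,2), symmetric] using P adj(1) by (intro map_ev_mult[symmetric])
    also have "\<dots> = ?\<delta> \<cdot>\<^sub>m 1\<^sub>m n" unfolding adj(2) by (intro eq_matI) auto
    finally show ?thesis .
  qed
  have g: "map_mat (ev z) (graph_poly E A B) = (J * complex_mat B) @\<^sub>r (?\<delta> \<cdot>\<^sub>m 1\<^sub>m m)"
  proof (rule eq_matI)
    have JB: "J * complex_mat B = map_mat (ev z) (adj_mat ?P * const_mat B)"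
      unfolding J_def map_ev_const[where z = z, symmetric] using adj(1) c(3) by (intro map_ev_mult[symmetric]) auto
    fix i j assume "i < dim_row ((J * complex_mat B) @\<^sub>r (?\<delta> \<cdot>\<^sub>m 1\<^sub>m m))"
      "j < dim_col ((J * complex_mat B) @\<^sub>r (?\<delta> \<cdot>\<^sub>m 1\<^sub>m m))"
    then have ij: "i < n + m" "j < m" using J B by (auto simp: append_rows_def)
    have a: "adj_mat ?P * const_mat B \<in> carrier_mat n m" using adj(1) c by auto
    have "graph_poly E A B $$ (i, j) = (if i < n then (adj_mat ?P * const_mat B) $$ (i, j)
        else (det ?P \<cdot>\<^sub>m 1\<^sub>m m) $$ (i - n, j))"
      unfolding graph_poly_def using ij a c by (subst append_rows_index[of _ n m _ m]) auto
    moreover have "((J * complex_mat B) @\<^sub>r (?\<delta> \<cdot>\<^sub>m 1\<^sub>m m)) $$ (i, j)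
        = (if i < n then map_mat (ev z) (adj_mat ?P * const_mat B) $$ (i, j) else (?\<delta> \<cdot>\<^sub>m 1\<^sub>m m) $$ (i - n, j))"
      unfolding JB using ij a by (subst append_rows_index[of _ n m _ m]) auto
    ultimately show "map_mat (ev z) (graph_poly E A B) $$ (i, j)
        = ((J * complex_mat B) @\<^sub>r (?\<delta> \<cdot>\<^sub>m 1\<^sub>m m)) $$ (i, j)"
      using ij carrier_matD[OF a] carrier_matD[OF graph_poly_carrier[OF c]] by (simp del: index_mult_mat)
  qed (use carrier_matD[OF graph_poly_carrier[OF c]] J B in \<open>auto simp: append_rows_def\<close>)
  define y where "y = inverse ?\<delta> \<cdot>\<^sub>v ((J * complex_mat B) *\<^sub>v v)"
  have JB: "J * complex_mat B \<in> carrier_mat n m" using J B by simp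
  have y: "y \<in> carrier_vec n" using JB v by (simp add: y_def)
  have "graph_at E A B z *\<^sub>v v = inverse ?\<delta> \<cdot>\<^sub>v (((J * complex_mat B) *\<^sub>v v) @\<^sub>v ((?\<delta> \<cdot>\<^sub>m 1\<^sub>m m) *\<^sub>v v))"
    unfolding graph_at_def g using JB v
    by (subst smult_mat_mult_vec[of _ "n + m" m]) (auto simp: mat_mult_append[of _ n m _ m] intro: carrier_append_rows)
  also have "(?\<delta> \<cdot>\<^sub>m 1\<^sub>m m) *\<^sub>v v = ?\<delta> \<cdot>\<^sub>v v" using v by (simp add: smult_mat_mult_vec[of _ m m])
  also have "inverse ?\<delta> \<cdot>\<^sub>v (((J * complex_mat B) *\<^sub>v v) @\<^sub>v (?\<delta> \<cdot>\<^sub>v v)) = y @\<^sub>v v"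
    unfolding y_def using det v JB by (intro eq_vecI) auto
  finally have 1: "graph_at E A B z *\<^sub>v v = y @\<^sub>v v" .
  have "?X *\<^sub>v y = inverse ?\<delta> \<cdot>\<^sub>v (?X *\<^sub>v ((J * complex_mat B) *\<^sub>v v))"
    unfolding y_def using X JB v by (intro mult_mat_vec) auto
  also have "?X *\<^sub>v ((J * complex_mat B) *\<^sub>v v) = (?X * J) *\<^sub>v (complex_mat B *\<^sub>v v)"
    using X J B v by (simp add: assoc_mult_mat_vec[of _ n n _ n] assoc_mult_mat_vec[of _ n n _ m])
  also have "\<dots> = ?\<delta> \<cdot>\<^sub>v (complex_mat B *\<^sub>v v)"
    unfolding XJ using B v by (simp add: smult_mat_mult_vec[of _ n n])
  also have "inverse ?\<delta> \<cdot>\<^sub>v (?\<delta> \<cdot>\<^sub>v (complex_mat B *\<^sub>v v)) = complex_mat B *\<^sub>v v"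
    using det by (simp add: smult_smult_assoc)
  finally show ?thesis using that y 1 by blast
qed

lemma kernel_pencil_mult_graph:
  assumes c: "E \<in> carrier_mat n n" "A \<in> carrier_mat n n" "B \<in> carrier_mat n m"
    and det: "ev z (det (pencil E A)) \<noteq> 0"
  shows "kernel_pencil E A B z * graph_at E A B z = 0\<^sub>m n m"
proof (rule mat_eq_mult_vec_imp[of _ n m])
  note K = kernel_pencil_carrier[OF c, of z] and G = graph_at_carrier[OF c, of z]
  show "kernel_pencil E A B z * graph_at E A B z \<in> carrier_mat n m" using K G by simp
  fix v :: "complex vec" assume v: "v \<in> carrier_vec m"
  obtain y where y: "y \<in> carrier_vec n" "graph_at E A B z *\<^sub>v v = y @\<^sub>v v"
    "(z \<cdot>\<^sub>m complex_mat E - complex_mat A) *\<^sub>v y = complex_mat B *\<^sub>v v"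
    by (rule graph_at_mult_vec[OF c det v])
  have "(kernel_pencil E A B z * graph_at E A B z) *\<^sub>v v = kernel_pencil E A B z *\<^sub>v (y @\<^sub>v v)"
    unfolding y(2)[symmetric] using K G v by (rule assoc_mult_mat_vec)
  also have "\<dots> = complex_mat B *\<^sub>v v + (- complex_mat B) *\<^sub>v v"
    unfolding kernel_pencil_def y(3)[symmetric] using c v y(1)
    by (intro append_cols_mult_vec minus_carrier_mat) auto
  also have "\<dots> = 0\<^sub>v n" using c v by (intro eq_vecI) auto
  finally show "(kernel_pencil E A B z * graph_at E A B z) *\<^sub>v v = 0\<^sub>m n m *\<^sub>v v" using v by simp
qed simp

lemma graph_at_injective:
  assumes c: "E \<in> carrier_mat n n" "A \<in> carrier_mat n n" "B \<in> carrier_mat n m"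
    and det: "ev z (det (pencil E A)) \<noteq> 0" and v: "v \<in> carrier_vec m" "v \<noteq> 0\<^sub>v m"
  shows "graph_at E A B z *\<^sub>v v \<noteq> 0\<^sub>v (n + m)"
proof -
  obtain y where y: "y \<in> carrier_vec n" "graph_at E A B z *\<^sub>v v = y @\<^sub>v v"
    by (rule graph_at_mult_vec[OF c det v(1)])
  then show ?thesis unfolding append_zero_vec[symmetric] y(2)
    using v by (subst append_vec_eq[of _ n]) auto
qed

lemma popov_value:
  assumes sys: "(E, A, B, Q, S, R) \<in> Sigma_w m n" and z: "cmod z = 1"
    and det: "ev z (det (pencil E A)) \<noteq> 0"
  shows "mat_val (popov E A B Q S R) z (popov_at E A B Q S R z)"
proof -
  note c = sys_carriers[OF sys]
  let ?P = "pencil E A"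
  have P: "?P \<in> carrier_mat n n" using c by simp
  note adj = adj_mat[OF P]
  define G where "G = (the (mat_inverse (rat_mat ?P)) * rat_mat (const_mat B)) @\<^sub>r 1\<^sub>m (dim_col B)"
  have a: "adj_mat ?P * const_mat B \<in> carrier_mat n m" using adj(1) c by auto
  have "the (mat_inverse (rat_mat ?P)) * rat_mat (const_mat B)
      = inverse (to_fract (det ?P)) \<cdot>\<^sub>m rat_mat (adj_mat ?P * const_mat B)"
    unfolding mat_inverse_rat_mat[OF P c(9)] using adj(1) c(3)
    by (subst rat_mat_mult[of _ n n _ m]) (auto simp: rat_mat_def intro!: mult_smult_assoc_mat)
  then have G: "G = (inverse (to_fract (det ?P)) \<cdot>\<^sub>m rat_mat (adj_mat ?P * const_mat B)) @\<^sub>r 1\<^sub>m m"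
    using c by (simp add: G_def)
  have rG: "inverse (to_fract (det ?P)) \<cdot>\<^sub>m rat_mat (adj_mat ?P * const_mat B) \<in> carrier_mat n m"
    using a by (simp add: rat_mat_def)
  have Gc: "G \<in> carrier_mat (n + m) m" unfolding G using rG by (intro carrier_append_rows) auto
  have gp: "graph_poly E A B \<in> carrier_mat (n + m) m" by (rule graph_poly_carrier[OF c(1-3)])
  have entry: "G $$ (i, j) = to_fract (graph_poly E A B $$ (i, j)) / to_fract (det ?P)" if ij: "i < n + m" "j < m" for i j
  proof -
    have 1: "G $$ (i, j) = (if i < n then (inverse (to_fract (det ?P)) \<cdot>\<^sub>m rat_mat (adj_mat ?P * const_mat B)) $$ (i, j)
        else (1\<^sub>m m) $$ (i - n, j))" unfolding G using ij rG by (subst append_rows_index[of _ n m _ m]) auto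
    have 2: "graph_poly E A B $$ (i, j) = (if i < n then (adj_mat ?P * const_mat B) $$ (i, j)
        else (det ?P \<cdot>\<^sub>m 1\<^sub>m m) $$ (i - n, j))"
      unfolding graph_poly_def using ij a c by (subst append_rows_index[of _ n m _ m]) auto
    show ?thesis unfolding 1 2 using ij carrier_matD[OF a] c(9)
      by (simp add: rat_mat_def divide_inverse mult.commute del: index_mult_mat(1))
  qed
  have mG: "mat_val G z (graph_at E A B z)"
    unfolding mat_val_def
  proof (intro conjI allI impI)
    fix i j assume "i < dim_row G" "j < dim_col G"
    then have ij: "i < n + m" "j < m" using Gc by auto
    have "graph_at E A B z $$ (i, j) = ev z (graph_poly E A B $$ (i, j)) / ev z (det ?P)"
      using ij gp by (simp add: graph_at_def divide_inverse mult.commute)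
    then show "is_val (G $$ (i, j)) z (graph_at E A B z $$ (i, j))"
      unfolding entry[OF ij] using is_valI[OF det] by simp
  qed (use Gc graph_at_carrier[OF c(1-3), of z] in auto)
  have mW: "mat_val (rat_mat (const_mat (four_block_mat Q S (mat_adjoint S) R))) z (weight_at Q S R)"
    using mat_val_rat_mat[of "const_mat (four_block_mat Q S (mat_adjoint S) R)" z]
    unfolding map_ev_const weight_at_def .
  have "popov E A B Q S R = mat_tilde G * rat_mat (const_mat (four_block_mat Q S (mat_adjoint S) R)) * G"
    unfolding popov_def G_def Let_def ..
  moreover have "mat_val (mat_tilde G * rat_mat (const_mat (four_block_mat Q S (mat_adjoint S) R)) * G) z (popov_at E A B Q S R z)"
    unfolding popov_at_def
    by (intro mat_val_mult mat_val_tilde z mG mW)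
      (use Gc c in \<open>auto simp: mat_tilde_def rat_mat_def const_mat_def\<close>)
  ultimately show ?thesis by simp
qed

lemma popov_at_carrier:
  assumes "(E, A, B, Q, S, R) \<in> Sigma_w m n"
  shows "popov_at E A B Q S R z \<in> carrier_mat m m"
  using graph_at_carrier[OF sys_carriers(1-3)[OF assms], of z] weight_at_carrier[OF assms]
  by (simp add: popov_at_def)

lemma popov_at_hermitian:
  assumes sys: "(E, A, B, Q, S, R) \<in> Sigma_w m n"
  shows "mat_adjoint (popov_at E A B Q S R z) = popov_at E A B Q S R z"
proof -
  note G = graph_at_carrier[OF sys_carriers(1-3)[OF sys], of z] and W = weight_at_carrier[OF sys]
  let ?G = "graph_at E A B z" and ?W = "weight_at Q S R"
  have "mat_adjoint (mat_adjoint ?G * ?W * ?G) = mat_adjoint ?G * mat_adjoint (mat_adjoint ?G * ?W)"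
    using G W by (intro mat_adjoint_mult[of _ m "n + m" _ m]) auto
  also have "mat_adjoint (mat_adjoint ?G * ?W) = ?W * ?G"
    using G W weight_at_hermitian[OF sys] by (subst mat_adjoint_mult[of _ m "n + m" _ "n + m"]) auto
  also have "mat_adjoint ?G * (?W * ?G) = mat_adjoint ?G * ?W * ?G"
    using G W by (intro assoc_mult_mat[symmetric, of _ m "n + m" _ "n + m" _ m]) auto
  finally show ?thesis unfolding popov_at_def .
qed

lemma hform_popov_at:
  assumes sys: "(E, A, B, Q, S, R) \<in> Sigma_w m n" and v: "v \<in> carrier_vec m"
  shows "hform (popov_at E A B Q S R z) v = hform (weight_at Q S R) (graph_at E A B z *\<^sub>v v)"
  unfolding popov_at_def
  by (rule hform_congruence[OF weight_at_carrier[OF sys] graph_at_carrier[OF sys_carriers(1-3)[OF sys]] v])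

lemma popov_carrier:
  assumes sys: "(E, A, B, Q, S, R) \<in> Sigma_w m n"
  shows "popov E A B Q S R \<in> carrier_mat m m"
proof -
  note c = sys_carriers[OF sys]
  show ?thesis using c by (intro carrier_matI) (auto simp: popov_def Let_def mat_tilde_def append_rows_def rat_mat_def const_mat_def)
qed

section \<open>The rotated pencil of a system\<close>

text \<open>The lower right part of the pencil is \<open>(z - 1) W\<close>, and the rotation turns the factor \<open>z - 1\<close> into the real number
  \<open>2 \<sigma> sin (\<omega> / 2)\<close>, which has the sign of \<open>\<sigma>\<close> on all of \<open>0 < \<omega> < 2 * pi\<close>.\<close>

lemma eval_pal_pencil:
  assumes sys: "(E, A, B, Q, S, R) \<in> Sigma_w m n"
  shows "rot \<sigma> \<omega> \<cdot>\<^sub>m eval_mat (cis \<omega>) (pal_pencil (complex_mat (pal_mat E A B Q S R)))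
    = saddle_mat (rot \<sigma> \<omega> \<cdot>\<^sub>m kernel_pencil E A B (cis \<omega>)) (of_real (2 * \<sigma> * sin (\<omega> / 2)) \<cdot>\<^sub>m weight_at Q S R)"
proof -
  note c = sys_carriers[OF sys]
  let ?c = "rot \<sigma> \<omega>" and ?z = "cis \<omega>" and ?W = "weight_at Q S R"
  define X where "X = append_cols (complex_mat A) (complex_mat B)"
  define T where "T = mat_adjoint (complex_mat E) @\<^sub>r 0\<^sub>m m n"
  have X: "X \<in> carrier_mat n (n + m)" unfolding X_def using c by simp
  have T: "T \<in> carrier_mat (n + m) n" unfolding T_def using c by (intro carrier_append_rows) auto
  have W: "?W \<in> carrier_mat (n + m) (n + m)" by (rule weight_at_carrier[OF sys])
  define M where "M = complex_mat (pal_mat E A B Q S R)"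
  have M: "M = four_block_mat (0\<^sub>m n n) X T ?W"
    using c by (intro eq_matI) (auto simp: M_def pal_mat_def nine_block_mat_def Let_def X_def T_def weight_at_def
        append_cols_def append_rows_def to_complex_conjugate)
  have adjM: "mat_adjoint M = four_block_mat (0\<^sub>m n n) (mat_adjoint T) (mat_adjoint X) ?W"
    unfolding M using X T W weight_at_hermitian[OF sys]
    by (subst mat_adjoint_four_block[of _ n n _ "n + m" _ "n + m"]) (auto intro!: eq_matI)
  have Mc: "M \<in> carrier_mat (n + (n + m)) (n + (n + m))" unfolding M using W by simp
  have kp: "kernel_pencil E A B ?z = ?z \<cdot>\<^sub>m mat_adjoint T - X"
    using c by (intro eq_matI) (auto simp: kernel_pencil_def T_def X_def append_cols_def append_rows_def)
  have kpc: "?c \<cdot>\<^sub>m (?z \<cdot>\<^sub>m mat_adjoint T - X) \<in> carrier_mat n (n + m)"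
    using X by (intro smult_carrier_mat minus_carrier_mat)
  have 1: "cnj ?c * (cnj ?z * t - x) = ?c * (?z * x - t)" for t x
  proof -
    have "cnj ?c * (cnj ?z * t - x) = (cnj ?c * cnj ?z) * t - cnj ?c * x" by (simp only: right_diff_distrib mult.assoc)
    also have "\<dots> = - ?c * t + ?c * ?z * x" unfolding cnj_rot_cis unfolding cnj_rot by simp
    also have "\<dots> = ?c * (?z * x - t)"
    proof -
      have "- k * t + k * w * x = k * (w * x - t)" for k w :: complex by (simp add: algebra_simps)
      then show ?thesis .
    qed
    finally show ?thesis .
  qed
  have 2: "?c * (?z * w - w) = of_real (2 * \<sigma> * sin (\<omega> / 2)) * w" for w
  proof -
    have "?c * (?z * w - w) = ?c * (?z - 1) * w" by (simp only: left_diff_distrib right_diff_distrib mult_1_left mult.assoc)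
    then show ?thesis unfolding rot_times_minus_one .
  qed
  have eval: "eval_mat ?z (pal_pencil M) = ?z \<cdot>\<^sub>m mat_adjoint M - M"
    unfolding pal_pencil_def using Mc by (intro eval_pencil[of _ "n + (n + m)" "n + (n + m)"]) auto
  have "?c \<cdot>\<^sub>m (?z \<cdot>\<^sub>m mat_adjoint M - M)
      = saddle_mat (?c \<cdot>\<^sub>m (?z \<cdot>\<^sub>m mat_adjoint T - X)) (of_real (2 * \<sigma> * sin (\<omega> / 2)) \<cdot>\<^sub>m ?W)"
    unfolding saddle_mat_def adjM using X T W carrier_matD[OF kpc]
    by (intro eq_matI) (auto simp: M 1 2 simp del: of_real_mult)
  then show ?thesis unfolding kp M_def[symmetric] eval .
qed

lemma controllable_splitting:
  assumes c: "E \<in> carrier_mat n n" "A \<in> carrier_mat n n" "B \<in> carrier_mat n m"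
    and ctrb: "\<not> uncontrollable_mode E A B z" and k: "k \<noteq> 0"
  obtains S R where "S \<in> carrier_mat n n" "R \<in> carrier_mat (n + m) n"
    "S * (k \<cdot>\<^sub>m kernel_pencil E A B z) * R = 1\<^sub>m n"
proof -
  let ?X = "z \<cdot>\<^sub>m complex_mat E - complex_mat A" and ?B = "complex_mat B"
  have X: "?X \<in> carrier_mat n n" and B: "?B \<in> carrier_mat n m" and mB: "- ?B \<in> carrier_mat n m"
    using c by (auto intro!: minus_carrier_mat)
  let ?M = "append_cols ?X ?B"
  have M: "?M \<in> carrier_mat n (n + m)" using X B by simp
  have "vec_space.rank n ?M = n" using ctrb c by (auto simp: uncontrollable_mode_def)
  then obtain S R where SR: "S \<in> carrier_mat n n" "R \<in> carrier_mat (n + m) n" "S * ?M * R = 1\<^sub>m n"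
    using rank_splitting[OF M] unfolding rank_split_def by metis
  define T where "T = four_block_mat (1\<^sub>m n) (0\<^sub>m n m) (0\<^sub>m m n) ((- 1 :: complex) \<cdot>\<^sub>m 1\<^sub>m m)"
  have T: "T \<in> carrier_mat (n + m) (n + m)" by (simp add: T_def)
  note K = kernel_pencil_carrier[OF c, of z]
  have KT: "kernel_pencil E A B z * T = ?M"
  proof (rule mat_eq_mult_vec_imp[OF _ M])
    show "kernel_pencil E A B z * T \<in> carrier_mat n (n + m)" using K T by simp
    fix v :: "complex vec" assume v: "v \<in> carrier_vec (n + m)"
    obtain x y where xy: "x \<in> carrier_vec n" "y \<in> carrier_vec m" "v = x @\<^sub>v y" using vec_append_cases[OF v] .
    have Tv: "T *\<^sub>v v = x @\<^sub>v ((-1) \<cdot>\<^sub>v y)" unfolding T_def xy(3) using xy(1,2)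
      by (subst four_block_mat_mult_vec[of _ n n _ m _ m]) (auto simp: smult_mat_mult_vec[of _ m m])
    have "(kernel_pencil E A B z * T) *\<^sub>v v = kernel_pencil E A B z *\<^sub>v (T *\<^sub>v v)"
      using K T v by (rule assoc_mult_mat_vec)
    also have "\<dots> = ?X *\<^sub>v x + (- ?B) *\<^sub>v ((-1) \<cdot>\<^sub>v y)"
      unfolding Tv kernel_pencil_def using xy by (intro append_cols_mult_vec[OF X mB]) auto
    also have "(- ?B) *\<^sub>v ((-1) \<cdot>\<^sub>v y) = ?B *\<^sub>v y"
      using B xy by (intro eq_vecI) (auto simp: scalar_prod_def sum_negf)
    also have "?X *\<^sub>v x + ?B *\<^sub>v y = ?M *\<^sub>v v"
      unfolding xy(3) using xy by (intro append_cols_mult_vec[OF X B, symmetric]) auto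
    finally show "(kernel_pencil E A B z * T) *\<^sub>v v = ?M *\<^sub>v v" .
  qed
  define R' where "R' = inverse k \<cdot>\<^sub>m (T * R)"
  have TR: "T * R \<in> carrier_mat (n + m) n" using T SR by simp
  have R': "R' \<in> carrier_mat (n + m) n" using TR by (simp add: R'_def)
  have "S * (k \<cdot>\<^sub>m kernel_pencil E A B z) * R' = S * kernel_pencil E A B z * (T * R)"
  proof -
    have "S * (k \<cdot>\<^sub>m kernel_pencil E A B z) = k \<cdot>\<^sub>m (S * kernel_pencil E A B z)"
      using SR K by (intro mult_smult_distrib)
    moreover have "k \<cdot>\<^sub>m (S * kernel_pencil E A B z) * R' = k \<cdot>\<^sub>m (S * kernel_pencil E A B z * R')"
      using SR K R' by (intro mult_smult_assoc_mat[of _ n "n + m"]) auto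
    moreover have "S * kernel_pencil E A B z * R' = inverse k \<cdot>\<^sub>m (S * kernel_pencil E A B z * (T * R))"
      unfolding R'_def using SR K TR by (intro mult_smult_distrib[of _ n "n + m"]) auto
    ultimately show ?thesis using k by (simp add: smult_smult_mat) (intro eq_matI, auto)
  qed
  also have "\<dots> = S * (kernel_pencil E A B z * T) * R"
    using SR K T by (simp add: assoc_mult_mat[of _ n "n + m" _ "n + m" _ n] assoc_mult_mat[of _ n n _ "n + m" _ "n + m"]
        assoc_mult_mat[of _ n n _ "n + m" _ n])
  also have "\<dots> = 1\<^sub>m n" unfolding KT by (rule SR(3))
  finally show ?thesis using that SR(1) R' by blast
qed

definition pal_form ::
  "'a::real_or_complex mat \<Rightarrow> 'a mat \<Rightarrow> 'a mat \<Rightarrow> 'a mat \<Rightarrow> 'a mat \<Rightarrow> 'a mat \<Rightarrow> real \<Rightarrow> real \<Rightarrow> complex mat" where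
  "pal_form E A B Q S R \<sigma> \<omega> =
     rot \<sigma> \<omega> \<cdot>\<^sub>m eval_mat (cis \<omega>) (pal_pencil (complex_mat (pal_mat E A B Q S R)))"

locale popov_system =
  fixes E A B Q S R :: "'a::real_or_complex mat" and m n :: nat
  assumes sys: "(E, A, B, Q, S, R) \<in> Sigma_w m n"
    and ctrb: "\<And>z. cmod z = 1 \<Longrightarrow> \<not> uncontrollable_mode E A B z"
begin

abbreviation "H \<equiv> pal_form E A B Q S R"
abbreviation "\<Phi> \<equiv> popov_at E A B Q S R"
abbreviation "regular z \<equiv> ev z (det (pencil E A)) \<noteq> 0"

abbreviation "G \<equiv> graph_at E A B"
abbreviation "Y \<equiv> kernel_pencil E A B"
abbreviation "W \<equiv> weight_at Q S R"

lemmas carriers = sys_carriers[OF sys]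

lemma H_saddle:
  "H \<sigma> \<omega> = saddle_mat (rot \<sigma> \<omega> \<cdot>\<^sub>m Y (cis \<omega>)) (of_real (2 * \<sigma> * sin (\<omega> / 2)) \<cdot>\<^sub>m W)"
  unfolding pal_form_def by (rule eval_pal_pencil[OF sys])

lemma weight_scaled:
  "of_real s \<cdot>\<^sub>m W \<in> carrier_mat (n + m) (n + m)"
  "mat_adjoint (of_real s \<cdot>\<^sub>m W) = of_real s \<cdot>\<^sub>m W"
  using weight_at_carrier[OF sys] mat_adjoint_smult_real[OF weight_at_hermitian[OF sys]] by auto

lemma kernel_scaled: "c \<cdot>\<^sub>m Y z \<in> carrier_mat n (n + m)"
  using kernel_pencil_carrier[OF carriers(1-3)] by simp

lemma H_carrier: "H \<sigma> \<omega> \<in> carrier_mat (2 * n + m) (2 * n + m)"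
proof -
  have "H \<sigma> \<omega> \<in> carrier_mat (n + (n + m)) (n + (n + m))"
    unfolding H_saddle by (rule saddle_mat_carrier[OF kernel_scaled weight_scaled(1)])
  then show ?thesis by (simp add: mult_2 add.assoc)
qed

text \<open>This rests on the full row rank of \<open>[z E - A, -B]\<close>, and so extends to the points where \<open>z E - A\<close> is
  singular.\<close>

lemma H_neg:
  assumes "\<sigma> \<noteq> 0"
  shows "neg_on_dim (H \<sigma> \<omega>) n"
proof -
  have "rot \<sigma> \<omega> \<noteq> 0" by (rule rot_nonzero[OF assms])
  then obtain L P where "L \<in> carrier_mat n n" "P \<in> carrier_mat (n + m) n"
    "L * (rot \<sigma> \<omega> \<cdot>\<^sub>m Y (cis \<omega>)) * P = 1\<^sub>m n"
    using controllable_splitting[OF carriers(1-3) ctrb[of "cis \<omega>"], of "rot \<sigma> \<omega>"] by auto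
  then show ?thesis unfolding H_saddle
    by (intro neg_on_dim_saddle_full[OF kernel_scaled weight_scaled])
qed

lemma scaled_kernel_graph:
  assumes reg: "regular z" and K: "K \<in> carrier_mat m l"
  shows "(c \<cdot>\<^sub>m Y z) * (G z * K) = 0\<^sub>m n l"
proof -
  note Y = kernel_pencil_carrier[OF carriers(1-3), of z] and G = graph_at_carrier[OF carriers(1-3), of z]
  have "Y z * (G z * K) = Y z * G z * K"
    using Y G K by (intro assoc_mult_mat[symmetric]) auto
  also have "\<dots> = 0\<^sub>m n l" unfolding kernel_pencil_mult_graph[OF carriers(1-3) reg] using K by simp
  finally show ?thesis using Y G K by (subst mult_smult_assoc_mat[of _ n "n + m" _ l]) auto
qed

lemma hform_weight_graph:
  assumes K: "K \<in> carrier_mat m l" and w: "w \<in> carrier_vec l"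
  shows "hform (of_real s \<cdot>\<^sub>m W) (G z * K *\<^sub>v w) = s * hform (\<Phi> z) (K *\<^sub>v w)"
proof -
  note G = graph_at_carrier[OF carriers(1-3), of z] and W = weight_at_carrier[OF sys]
  have "G z * K *\<^sub>v w = G z *\<^sub>v (K *\<^sub>v w)" using G K w by (rule assoc_mult_mat_vec)
  then show ?thesis using hform_smult_mat[OF W, of "G z *\<^sub>v (K *\<^sub>v w)" s]
      hform_popov_at[OF sys, of "K *\<^sub>v w" z] G K w by simp
qed

lemma sin_half_pos: "0 < \<omega> \<Longrightarrow> \<omega> < 2 * pi \<Longrightarrow> 0 < sin (\<omega> / 2)"
  by (intro sin_gt_zero) auto

text \<open>The graph map carries the range of \<open>K\<close> into the kernel of \<open>[z E - A, -B]\<close>, where the weight is given by the Popov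
  function.\<close>

lemma H_nonneg_popov:
  assumes \<omega>: "0 < \<omega>" "\<omega> < 2 * pi" and reg: "regular (cis \<omega>)" and K: "K \<in> carrier_mat m l"
    and nonneg: "\<And>w. w \<in> carrier_vec l \<Longrightarrow> w \<noteq> 0\<^sub>v l \<Longrightarrow>
      K *\<^sub>v w \<noteq> 0\<^sub>v m \<and> 0 \<le> \<sigma> * hform (\<Phi> (cis \<omega>)) (K *\<^sub>v w)"
  shows "nonneg_on_dim (H \<sigma> \<omega>) (n + l)"
  unfolding H_saddle
proof (rule nonneg_on_dim_saddle[OF kernel_scaled weight_scaled(1)])
  note G = graph_at_carrier[OF carriers(1-3), of "cis \<omega>"]
  show "G (cis \<omega>) * K \<in> carrier_mat (n + m) l" using G K by simp
  show "(rot \<sigma> \<omega> \<cdot>\<^sub>m Y (cis \<omega>)) * (G (cis \<omega>) * K) = 0\<^sub>m n l"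
    by (rule scaled_kernel_graph[OF reg K])
  fix w :: "complex vec" assume w: "w \<in> carrier_vec l" "w \<noteq> 0\<^sub>v l"
  have "G (cis \<omega>) * K *\<^sub>v w = G (cis \<omega>) *\<^sub>v (K *\<^sub>v w)"
    using G K w(1) by (rule assoc_mult_mat_vec)
  moreover have "G (cis \<omega>) *\<^sub>v (K *\<^sub>v w) \<noteq> 0\<^sub>v (n + m)"
    using nonneg[OF w] K w by (intro graph_at_injective[OF carriers(1-3) reg]) auto
  moreover have "2 * sin (\<omega> / 2) * (\<sigma> * hform (\<Phi> (cis \<omega>)) (K *\<^sub>v w)) \<ge> 0"
    by (rule mult_nonneg_nonneg) (use nonneg[OF w] sin_half_pos[OF \<omega>] in simp_all)
  ultimately show "G (cis \<omega>) * K *\<^sub>v w \<noteq> 0\<^sub>v (n + m) \<and>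
      0 \<le> hform (of_real (2 * \<sigma> * sin (\<omega> / 2)) \<cdot>\<^sub>m W) (G (cis \<omega>) * K *\<^sub>v w)"
    unfolding hform_weight_graph[OF K w(1)] by (simp add: mult_ac)
qed

lemma H_neg_popov:
  assumes \<omega>: "0 < \<omega>" "\<omega> < 2 * pi" and \<sigma>: "\<sigma> \<noteq> 0" and reg: "regular (cis \<omega>)" and K: "K \<in> carrier_mat m l"
    and neg: "\<And>w. w \<in> carrier_vec l \<Longrightarrow> w \<noteq> 0\<^sub>v l \<Longrightarrow> \<sigma> * hform (\<Phi> (cis \<omega>)) (K *\<^sub>v w) < 0"
  shows "neg_on_dim (H \<sigma> \<omega>) (n + l)"
proof -
  note G = graph_at_carrier[OF carriers(1-3), of "cis \<omega>"]
  have "rot \<sigma> \<omega> \<noteq> 0" by (rule rot_nonzero[OF \<sigma>])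
  then obtain L P where LP: "L \<in> carrier_mat n n" "P \<in> carrier_mat (n + m) n"
    "L * (rot \<sigma> \<omega> \<cdot>\<^sub>m Y (cis \<omega>)) * P = 1\<^sub>m n"
    using controllable_splitting[OF carriers(1-3) ctrb[of "cis \<omega>"], of "rot \<sigma> \<omega>"] by auto
  have GK: "G (cis \<omega>) * K \<in> carrier_mat (n + m) l" using G K by simp
  show ?thesis unfolding H_saddle
  proof (rule neg_on_dim_saddle[OF kernel_scaled weight_scaled LP GK scaled_kernel_graph[OF reg K]])
    fix w :: "complex vec" assume w: "w \<in> carrier_vec l" "w \<noteq> 0\<^sub>v l"
    have "2 * sin (\<omega> / 2) * (\<sigma> * hform (\<Phi> (cis \<omega>)) (K *\<^sub>v w)) < 0"
      by (rule mult_pos_neg) (use neg[OF w] sin_half_pos[OF \<omega>] in simp_all)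
    then show "hform (of_real (2 * \<sigma> * sin (\<omega> / 2)) \<cdot>\<^sub>m W) (G (cis \<omega>) * K *\<^sub>v w) < 0"
      unfolding hform_weight_graph[OF K w(1)] by (simp add: mult_ac)
  qed
qed

lemma regular_iff_det:
  "regular z \<longleftrightarrow> det (z \<cdot>\<^sub>m complex_mat E - complex_mat A) \<noteq> 0"
proof -
  have "pencil E A \<in> carrier_mat n n" using carriers(1,2) by (rule pencil_carrier)
  then show ?thesis by (simp add: ev_det map_ev_pencil[OF carriers(1,2)])
qed

lemma psd_mat_iff_hform:
  "psd_mat (\<Phi> z) \<longleftrightarrow> (\<forall>v \<in> carrier_vec m. 0 \<le> hform (\<Phi> z) v)"
proof -
  note c = popov_at_carrier[OF sys, of z] and h = popov_at_hermitian[OF sys, of z]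
  have "Im ((\<Phi> z *\<^sub>v v) \<bullet>c v) = 0" if v: "v \<in> carrier_vec m" for v
  proof -
    have "(\<Phi> z *\<^sub>v v) \<bullet>c v = v \<bullet>c (\<Phi> z *\<^sub>v v)" using cscalar_prod_adjoint[OF c v v] h by simp
    also have "\<dots> = cnj ((\<Phi> z *\<^sub>v v) \<bullet>c v)" using c v by (intro cscalar_prod_commute) auto
    finally show ?thesis by (metis complex_cnj_cancel_iff Reals_cnj_iff complex_is_Real_iff)
  qed
  then show ?thesis using c h by (auto simp: psd_mat_def hform_def less_eq_complex_def)
qed

lemma psd_on_circle_iff:
  "psd_on_unit_circle E A (popov E A B Q S R) \<longleftrightarrow>
    (\<forall>\<omega> \<in> {0..<2 * pi}. regular (cis \<omega>) \<longrightarrow> (\<forall>v \<in> carrier_vec m. 0 \<le> hform (\<Phi> (cis \<omega>)) v))"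
proof -
  have "map_mat (\<lambda>r. eval_fract r (cis \<omega>)) (popov E A B Q S R) = \<Phi> (cis \<omega>)" if "regular (cis \<omega>)" for \<omega>
    using mat_val_eval_fract[OF popov_value[OF sys _ that]] by simp
  then show ?thesis unfolding psd_on_unit_circle_def regular_iff_det[symmetric]
    using psd_mat_iff_hform by auto
qed

lemma ev_continuous: "continuous_on UNIV (\<lambda>\<omega>. ev (cis \<omega>) p)"
  unfolding ev_def by (intro continuous_intros)

text \<open>Multiplied by \<open>|det (z E - A)|\<^sup>2\<close>, the value of the form at a fixed vector is a continuous function of
  \<open>\<omega>\<close> on the whole line. If negative at a point, it is negative on an interval to the right
  of that point, which contains points outside of \<open>F\<close>; going to the right also covers \<open>\<omega> = 0\<close>.\<close>

lemma generic_psd_imp_psd: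
  assumes fin: "finite F" and psd: "\<And>\<omega> v. \<omega> \<in> {0<..<2 * pi} \<Longrightarrow> \<omega> \<notin> F \<Longrightarrow> regular (cis \<omega>) \<Longrightarrow>
      v \<in> carrier_vec m \<Longrightarrow> 0 \<le> hform (\<Phi> (cis \<omega>)) v"
    and \<omega>: "\<omega> \<in> {0..<2 * pi}" "regular (cis \<omega>)" and v: "v \<in> carrier_vec m"
  shows "0 \<le> hform (\<Phi> (cis \<omega>)) v"
proof (rule ccontr)
  assume "\<not> 0 \<le> hform (\<Phi> (cis \<omega>)) v"
  then have neg: "hform (\<Phi> (cis \<omega>)) v < 0" by simp
  let ?\<delta> = "\<lambda>\<omega>. ev (cis \<omega>) (det (pencil E A))"
  define N where "N \<omega> = map_mat (ev (cis \<omega>)) (graph_poly E A B)" for \<omega>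
  have N: "N \<omega> \<in> carrier_mat (n + m) m" for \<omega>
    unfolding N_def using graph_poly_carrier[OF carriers(1-3)] by simp
  note W = weight_at_carrier[OF sys]
  define g where "g \<omega> = hform W (N \<omega> *\<^sub>v v)" for \<omega>
  have g: "hform (\<Phi> (cis \<omega>)) v = (cmod (inverse (?\<delta> \<omega>)))\<^sup>2 * g \<omega>" for \<omega>
    unfolding hform_popov_at[OF sys v] graph_at_def N_def[symmetric] g_def
    using hform_smult_vec[OF W mult_mat_vec_carrier[OF N v]] N v
    by (simp add: smult_mat_mult_vec[of _ "n + m" m])
  have cont: "continuous_on UNIV g"
  proof -
    let ?r = "\<lambda>\<omega>. Re (\<Sum>i<n+m. (\<Sum>j<n+m. W $$ (i, j) * (\<Sum>k<m. ev (cis \<omega>) (graph_poly E A B $$ (j, k)) * v $ k))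
        * cnj (\<Sum>k<m. ev (cis \<omega>) (graph_poly E A B $$ (i, k)) * v $ k))"
    have "g \<omega> = ?r \<omega>" for \<omega>
      using W N[of \<omega>] v graph_poly_carrier[OF carriers(1-3)]
      by (simp add: g_def hform_def scalar_prod_def N_def lessThan_atLeast0)
    then have "g = ?r" by (rule ext)
    moreover have "continuous_on UNIV ?r" by (intro continuous_intros ev_continuous)
    ultimately show ?thesis by simp
  qed
  let ?U = "{x. g x < 0} \<inter> {x. ?\<delta> x \<noteq> 0} \<inter> {..<2 * pi}"
  have "open {x. g x < 0}" using cont by (intro open_Collect_less continuous_on_const)
  moreover have "open {x. ?\<delta> x \<noteq> 0}" by (intro open_Collect_neq ev_continuous continuous_on_const)
  ultimately have "open ?U" by auto
  moreover have "g \<omega> < 0" using neg unfolding g by (metis mult_less_0_iff not_less zero_le_power2)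
  then have "\<omega> \<in> ?U" using \<omega> by auto
  ultimately obtain d where d: "d > 0" "\<And>y. dist y \<omega> < d \<Longrightarrow> y \<in> ?U" unfolding open_dist by blast
  have "infinite ({\<omega><..<\<omega> + d} - F)" using fin d by (simp add: infinite_Ioo)
  then obtain x where x: "x \<in> {\<omega><..<\<omega> + d}" "x \<notin> F" by (metis Diff_iff ex_in_conv finite.emptyI)
  then have "x \<in> ?U" by (intro d(2)) (auto simp: dist_real_def)
  then have xU: "g x < 0" "?\<delta> x \<noteq> 0" "x < 2 * pi" by auto
  have "0 \<le> hform (\<Phi> (cis x)) v" using x xU \<omega> v by (intro psd) auto
  moreover have "hform (\<Phi> (cis x)) v < 0" unfolding g using xU by (intro mult_pos_neg) auto
  ultimately show False by simp
qed

end

section \<open>Counting the blocks\<close>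

lemma block_nonneg_le_size: "admissible_block b \<Longrightarrow> block_nonneg \<sigma> \<omega> b \<le> block_size b"
  by (cases b) auto

lemma sum_list_diff_nat:
  fixes f g :: "'b \<Rightarrow> nat"
  assumes "\<forall>x \<in> set xs. g x \<le> f x"
  shows "(\<Sum>x\<leftarrow>xs. f x - g x) = (\<Sum>x\<leftarrow>xs. f x) - (\<Sum>x\<leftarrow>xs. g x) \<and> (\<Sum>x\<leftarrow>xs. g x) \<le> (\<Sum>x\<leftarrow>xs. f x)"
  using assms by (induction xs) auto

lemma sum_list_eq_imp_pointwise_eq:
  fixes f g :: "'b \<Rightarrow> nat"
  assumes "\<forall>x \<in> set xs. f x \<le> g x" and "(\<Sum>x\<leftarrow>xs. g x) \<le> (\<Sum>x\<leftarrow>xs. f x)" and "x \<in> set xs"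
  shows "f x = g x"
  using assms
proof (induction xs)
  case (Cons y ys)
  have "(\<Sum>x\<leftarrow>ys. f x) \<le> (\<Sum>x\<leftarrow>ys. g x)" using Cons.prems by (intro sum_list_mono) auto
  moreover have "f y \<le> g y" using Cons.prems by simp
  ultimately have "f y = g y" "(\<Sum>x\<leftarrow>ys. g x) \<le> (\<Sum>x\<leftarrow>ys. f x)" using Cons.prems(2) by auto
  then show ?case using Cons by auto
qed simp

fun block_angle :: "pkcf_block \<Rightarrow> real" where
  "block_angle (P2 \<epsilon> k \<theta>) = \<theta>"
| "block_angle (P3 \<epsilon> k \<theta>) = \<theta>"
| "block_angle _ = 0"

lemma angle_free_if: "\<omega> \<noteq> block_angle b \<Longrightarrow> block_angle_free \<omega> b"
  by (cases b) auto

lemma finite_cis_vimage: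
  assumes "finite F"
  shows "finite {\<omega> \<in> {0..<2 * pi}. cis \<omega> \<in> F}"
proof (rule finite_imageD)
  show "finite (cis ` {\<omega> \<in> {0..<2 * pi}. cis \<omega> \<in> F})" using assms by (rule rev_finite_subset) auto
  show "inj_on cis {\<omega> \<in> {0..<2 * pi}. cis \<omega> \<in> F}"
    by (intro inj_onI) (auto intro: cis_eq_imp_angle_eq)
qed

lemma block_nonneg_P2:
  assumes "admissible_block (P2 \<epsilon> k \<theta>)" "0 < \<omega>" "\<omega> < 2 * pi"
  shows "block_nonneg 1 \<omega> (P2 \<epsilon> k \<theta>) = k + (if \<omega> = \<theta> \<or> (\<theta> < \<omega> \<longleftrightarrow> \<epsilon> = 1) then 1 else 0)"
proof -
  have "\<epsilon> = 1 \<or> \<epsilon> = -1" "0 \<le> \<theta>" "\<theta> < 2 * pi" using assms by auto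
  then show ?thesis
    using sin_half_difference_nonneg_iff[of \<omega> \<theta>] sin_half_difference_nonzero[of \<omega> \<theta>] assms(2,3)
    by (auto simp: not_le le_less)
qed

text \<open>The value can only change at the angle of the block, and there it is largest.\<close>

lemma block_nonneg_le_nearby:
  assumes adm: "admissible_block b" and \<theta>: "0 < \<theta>" "\<theta> < 2 * pi" and \<omega>: "0 < \<omega>" "\<omega> < 2 * pi"
    and free: "\<omega> \<noteq> block_angle b" and near: "block_angle b \<noteq> \<theta> \<Longrightarrow> \<bar>\<omega> - \<theta>\<bar> < \<bar>block_angle b - \<theta>\<bar>"
  shows "block_nonneg 1 \<omega> b \<le> block_nonneg 1 \<theta> b"
proof (cases b)
  case (P2 \<epsilon> k \<phi>)
  then show ?thesis
    using block_nonneg_P2[of \<epsilon> k \<phi> \<omega>] block_nonneg_P2[of \<epsilon> k \<phi> \<theta>] adm \<theta> \<omega> free near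
    by (auto simp del: block_nonneg.simps)
qed (use free in auto)

lemma num_P2_at_one_Cons:
  "num_P2_at_one \<epsilon> (b # bs) = (if \<exists>k. b = P2 \<epsilon> k 0 then 1 else 0) + num_P2_at_one \<epsilon> bs"
  by (simp add: num_P2_at_one_def)

text \<open>Off the angles, only the blocks P2 distinguish the form from its negative.\<close>

lemma block_nonneg_balance:
  assumes adm: "\<forall>b \<in> set bs. admissible_block b" and no: "no_P2_off_one bs"
    and free: "\<forall>b \<in> set bs. block_angle_free \<omega> b" and \<omega>: "0 < \<omega>" "\<omega> < 2 * pi"
  shows "(\<Sum>b\<leftarrow>bs. block_nonneg 1 \<omega> b) + num_P2_at_one (-1) bs
    = (\<Sum>b\<leftarrow>bs. block_nonneg (-1) \<omega> b) + num_P2_at_one 1 bs"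
  using adm no free
proof (induction bs)
  case Nil
  show ?case by (simp add: num_P2_at_one_def)
next
  case (Cons b bs)
  have sin: "sin (\<omega> / 2) > 0" using \<omega> by (intro sin_gt_zero) auto
  have "block_nonneg 1 \<omega> b + (if \<exists>k. b = P2 (-1) k 0 then 1 else 0)
    = block_nonneg (-1) \<omega> b + (if \<exists>k. b = P2 1 k 0 then 1 else 0)"
  proof (cases b)
    case (P2 \<epsilon> k \<theta>)
    then have "\<theta> = 0" "\<epsilon> = 1 \<or> \<epsilon> = -1" using Cons.prems by (auto simp: no_P2_off_one_def)
    then show ?thesis using sin P2 by auto
  qed (use Cons.prems in auto)
  moreover have "no_P2_off_one bs" using Cons.prems by (auto simp: no_P2_off_one_def)
  ultimately show ?case using Cons by (simp add: num_P2_at_one_Cons)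
qed

lemma finite_gap:
  fixes F :: "real set"
  assumes "finite F"
  obtains d where "d > 0" "\<And>x. x \<in> F \<Longrightarrow> x \<noteq> \<theta> \<Longrightarrow> d \<le> \<bar>x - \<theta>\<bar>"
proof
  \<comment> \<open>The element 1 covers the case that no point differs from \<open>\<theta>\<close>.\<close>
  let ?D = "insert 1 ((\<lambda>x. \<bar>x - \<theta>\<bar>) ` (F - {\<theta>}))"
  have fin: "finite ?D" using assms by simp
  show "Min ?D > 0" using fin by (subst Min_gr_iff) auto
  show "Min ?D \<le> \<bar>x - \<theta>\<bar>" if "x \<in> F" "x \<noteq> \<theta>" for x using that fin by (intro Min_le) auto
qed

text \<open>The block sum \<open>T \<sigma> \<omega>\<close> is the dimension of a nonnegative subspace of \<open>H \<sigma> \<omega>\<close>; off the angles of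
  the blocks a negative subspace of complementary dimension shows that it is the largest one.\<close>

locale popov_pkcf = popov_system E A B Q S R m n
  for E A B Q S R :: "'a::real_or_complex mat" and m n :: nat +
  fixes bs :: "pkcf_block list" and q :: nat
  assumes pkcf: "is_pkcf (map_mat to_complex (pal_mat E A B Q S R)) bs"
    and rank: "vec_space.rank m (popov E A B Q S R) = q"
begin

abbreviation "T \<sigma> \<omega> \<equiv> \<Sum>b\<leftarrow>bs. block_nonneg \<sigma> \<omega> b"

lemma admissible: "\<forall>b \<in> set bs. admissible_block b"
  using pkcf by (simp add: is_pkcf_def)

lemma blocks_congruent:
  obtains U where "U \<in> carrier_mat (2 * n + m) (2 * n + m)" "invertible_mat U"
    "\<And>\<sigma> \<omega>. mat_adjoint U * H \<sigma> \<omega> * U = blocks_form \<sigma> \<omega> bs"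
proof -
  define M where "M = complex_mat (pal_mat E A B Q S R)"
  define P where "P = pal_pencil M"
  have H: "H \<sigma> \<omega> = rot \<sigma> \<omega> \<cdot>\<^sub>m eval_mat (cis \<omega>) P" for \<sigma> \<omega> by (simp add: pal_form_def M_def P_def)
  have P: "P \<in> carrier_mat (2 * n + m) (2 * n + m)" 
    using carrier_matD[OF H_carrier[of 1 0]] unfolding H by (intro carrier_matI) (simp_all add: eval_mat_def)
  have dimM: "dim_row M = 2 * n + m" using carrier_matD(1)[OF P] by (simp add: P_def pal_pencil_def pencil_def const_mat_def)
  obtain U where U: "U \<in> carrier_mat (2 * n + m) (2 * n + m)" "invertible_mat U"
    and eq: "const_mat (mat_adjoint U) * P * const_mat U = diag_block_mat (map block_pencil bs)"
    using pkcf unfolding is_pkcf_def M_def[symmetric] dimM P_def by blast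
  have "mat_adjoint U * H \<sigma> \<omega> * U = blocks_form \<sigma> \<omega> bs" for \<sigma> \<omega>
  proof -
    let ?N = "2 * n + m"
    have e: "eval_mat (cis \<omega>) P \<in> carrier_mat ?N ?N" and aU: "mat_adjoint U \<in> carrier_mat ?N ?N" using P U by simp_all
    have "eval_mat (cis \<omega>) (diag_block_mat (map block_pencil bs)) = mat_adjoint U * eval_mat (cis \<omega>) P * U"
      unfolding eq[symmetric] using P U aU
      by (subst eval_mat_mult[of _ ?N ?N _ ?N], simp_all add: eval_const_mat)
        (subst eval_mat_mult[of _ ?N ?N _ ?N], simp_all add: eval_const_mat)
    moreover have "mat_adjoint U * (rot \<sigma> \<omega> \<cdot>\<^sub>m eval_mat (cis \<omega>) P) * U
      = rot \<sigma> \<omega> \<cdot>\<^sub>m (mat_adjoint U * eval_mat (cis \<omega>) P * U)"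
      using e U(1) aU by (simp add: mult_smult_distrib[of _ ?N ?N _ ?N] mult_smult_assoc_mat[of _ ?N ?N _ ?N])
    ultimately show ?thesis unfolding H by simp
  qed
  with U show ?thesis using that by blast
qed

lemma sum_block_size: "(\<Sum>b\<leftarrow>bs. block_size b) = 2 * n + m"
proof -
  obtain U where U: "U \<in> carrier_mat (2 * n + m) (2 * n + m)"
    and eq: "mat_adjoint U * H 1 0 * U = blocks_form 1 0 bs"
    by (rule blocks_congruent) blast
  have "dim_row (mat_adjoint U * H 1 0 * U) = 2 * n + m" using U by simp
  moreover have "dim_row (blocks_form 1 0 bs) = (\<Sum>b\<leftarrow>bs. block_size b)"
    using diag_block_pencils_carrier[of bs] by (simp add: eval_mat_def)
  ultimately show ?thesis using eq by simp
qed

lemma T_le_size: "T \<sigma> \<omega> \<le> 2 * n + m"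
  and sum_block_neg: "(\<Sum>b\<leftarrow>bs. block_size b - block_nonneg \<sigma> \<omega> b) = 2 * n + m - T \<sigma> \<omega>"
  using sum_list_diff_nat[of bs "block_nonneg \<sigma> \<omega>" block_size] admissible block_nonneg_le_size
  unfolding sum_block_size by auto

lemma blocks_nonneg:
  assumes "0 < \<omega>" "\<omega> < 2 * pi" "\<sigma> = 1 \<or> \<sigma> = -1"
  shows "nonneg_on_dim (H \<sigma> \<omega>) (T \<sigma> \<omega>)"
proof -
  obtain U where U: "U \<in> carrier_mat (2 * n + m) (2 * n + m)" "invertible_mat U"
    and eq: "\<And>\<sigma> \<omega>. mat_adjoint U * H \<sigma> \<omega> * U = blocks_form \<sigma> \<omega> bs"
    by (rule blocks_congruent) blast
  show ?thesis using diag_block_index(1)[OF admissible assms] unfolding eq[symmetric]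
    by (rule nonneg_on_dim_congruence[OF H_carrier U])
qed

lemma blocks_neg:
  assumes "0 < \<omega>" "\<omega> < 2 * pi" "\<sigma> = 1 \<or> \<sigma> = -1" and free: "\<forall>b \<in> set bs. block_angle_free \<omega> b"
  shows "neg_on_dim (H \<sigma> \<omega>) (2 * n + m - T \<sigma> \<omega>)"
proof -
  obtain U where U: "U \<in> carrier_mat (2 * n + m) (2 * n + m)"
    and eq: "\<And>\<sigma> \<omega>. mat_adjoint U * H \<sigma> \<omega> * U = blocks_form \<sigma> \<omega> bs"
    by (rule blocks_congruent) blast
  show ?thesis using diag_block_index(2)[OF admissible assms] unfolding eq[symmetric] sum_block_neg
    by (rule neg_on_dim_congruence[OF H_carrier U])
qed

text \<open>Equivalently, \<open>H\<close> has at least \<open>n\<close> negative squares, at every angle between \<open>0\<close> and \<open>2 * pi\<close>.\<close>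

lemma T_upper:
  assumes "0 < \<omega>" "\<omega> < 2 * pi"
  shows "T 1 \<omega> \<le> n + m"
  using neg_nonneg_dim_le[OF H_carrier H_neg blocks_nonneg[OF assms, of 1]] by simp

lemma T_lower:
  assumes \<omega>: "0 < \<omega>" "\<omega> < 2 * pi" and \<sigma>: "\<sigma> = 1 \<or> \<sigma> = -1"
    and free: "\<forall>b \<in> set bs. block_angle_free \<omega> b" and nonneg: "nonneg_on_dim (H \<sigma> \<omega>) d"
  shows "d \<le> T \<sigma> \<omega>"
  using neg_nonneg_dim_le[OF H_carrier blocks_neg[OF \<omega> \<sigma> free] nonneg] T_le_size[of \<sigma> \<omega>] by simp

lemma psd_imp_T_lower:
  assumes \<omega>: "0 < \<omega>" "\<omega> < 2 * pi" and free: "\<forall>b \<in> set bs. block_angle_free \<omega> b"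
    and reg: "regular (cis \<omega>)" and psd: "\<And>v. v \<in> carrier_vec m \<Longrightarrow> 0 \<le> hform (\<Phi> (cis \<omega>)) v"
  shows "n + m \<le> T 1 \<omega>"
proof (rule T_lower[OF \<omega> _ free])
  show "nonneg_on_dim (H 1 \<omega>) (n + m)"
    by (rule H_nonneg_popov[OF \<omega> reg one_carrier_mat]) (use psd in auto)
qed simp

definition "special_angles = block_angle ` set bs \<union> {\<omega> \<in> {0..<2 * pi}. \<not> regular (cis \<omega>)}"

lemma finite_special_angles: "finite special_angles"
proof -
  have "finite {z. ev z (det (pencil E A)) = 0}" by (rule finite_ev_roots[OF carriers(9)])
  from finite_cis_vimage[OF this] show ?thesis by (simp add: special_angles_def)
qed

lemma not_special:
  assumes "\<omega> \<notin> special_angles"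
  shows "b \<in> set bs \<Longrightarrow> \<omega> \<noteq> block_angle b" "\<forall>b \<in> set bs. block_angle_free \<omega> b"
    "0 \<le> \<omega> \<Longrightarrow> \<omega> < 2 * pi \<Longrightarrow> regular (cis \<omega>)"
  using assms by (auto simp: special_angles_def intro!: angle_free_if)

text \<open>Next to \<open>\<theta>\<close>, on either side, the total is at least \<open>n + m\<close> because \<open>\<Phi>\<close> is positive semidefinite, while at \<open>\<theta>\<close> it
  is at most \<open>n + m\<close>. As no single block has a larger number near \<open>\<theta>\<close> than at \<open>\<theta>\<close>, the numbers
  agree block by block. The side is selected by \<open>s\<close>.\<close>

lemma psd_imp_pointwise:
  assumes psd: "psd_on_unit_circle E A (popov E A B Q S R)" and \<theta>: "0 < \<theta>" "\<theta> < 2 * pi"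
    and s: "s = 1 \<or> s = (-1 :: real)"
  shows "\<exists>\<omega>. 0 < \<omega> \<and> \<omega> < 2 * pi \<and> 0 < s * (\<omega> - \<theta>) \<and> (\<forall>b \<in> set bs. block_nonneg 1 \<omega> b = block_nonneg 1 \<theta> b)"
proof -
  obtain d where d: "d > 0" "\<And>x. x \<in> special_angles \<union> {0, 2 * pi} \<Longrightarrow> x \<noteq> \<theta> \<Longrightarrow> d \<le> \<bar>x - \<theta>\<bar>"
    using finite_gap[of "special_angles \<union> {0, 2 * pi}"] finite_special_angles
    by (metis finite.emptyI finite.insertI finite_UnI)
  define \<omega> where "\<omega> = \<theta> + s * (d / 2)"
  have near: "\<bar>\<omega> - \<theta>\<bar> < d" "\<omega> \<noteq> \<theta>" "0 < s * (\<omega> - \<theta>)" using s d(1) by (auto simp: \<omega>_def)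
  have "d \<le> \<bar>0 - \<theta>\<bar>" "d \<le> \<bar>2 * pi - \<theta>\<bar>" using d(2)[of 0] d(2)[of "2 * pi"] \<theta> by auto
  then have \<omega>: "0 < \<omega>" "\<omega> < 2 * pi" using near \<theta> by auto
  have ns: "\<omega> \<notin> special_angles" using d(2)[of \<omega>] near by force
  have reg: "regular (cis \<omega>)" using not_special(3)[OF ns] \<omega> by simp
  have "0 \<le> hform (\<Phi> (cis \<omega>)) v" if "v \<in> carrier_vec m" for v
    using psd \<omega> reg that unfolding psd_on_circle_iff by auto
  then have "n + m \<le> T 1 \<omega>" by (rule psd_imp_T_lower[OF \<omega> not_special(2)[OF ns] reg])
  then have le: "T 1 \<theta> \<le> T 1 \<omega>" using T_upper[OF \<theta>] by simp
  have "\<forall>b \<in> set bs. block_nonneg 1 \<omega> b \<le> block_nonneg 1 \<theta> b"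
  proof
    fix b assume b: "b \<in> set bs"
    have "d \<le> \<bar>block_angle b - \<theta>\<bar>" if "block_angle b \<noteq> \<theta>"
      using b that by (intro d(2)) (auto simp: special_angles_def)
    then show "block_nonneg 1 \<omega> b \<le> block_nonneg 1 \<theta> b"
      using admissible b near(1) by (intro block_nonneg_le_nearby \<theta> \<omega> not_special(1)[OF ns]) auto
  qed
  then have "\<forall>b \<in> set bs. block_nonneg 1 \<omega> b = block_nonneg 1 \<theta> b"
    using sum_list_eq_imp_pointwise_eq[OF _ le] by blast
  with \<omega> near show ?thesis by blast
qed

text \<open>Seen from the side where \<open>\<epsilon> * (\<omega> - \<theta>) < 0\<close>, the number of a block P2 is smaller than at \<open>\<theta>\<close>.\<close>

lemma psd_imp_no_P2_off_one:
  assumes psd: "psd_on_unit_circle E A (popov E A B Q S R)"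
  shows "no_P2_off_one bs"
  unfolding no_P2_off_one_def
proof (intro allI impI)
  fix \<epsilon> k \<theta> assume b: "P2 \<epsilon> k \<theta> \<in> set bs"
  then have adm: "admissible_block (P2 \<epsilon> k \<theta>)" using admissible by blast
  then have \<epsilon>: "\<epsilon> = 1 \<or> \<epsilon> = -1" and \<theta>: "0 \<le> \<theta>" "\<theta> < 2 * pi" by auto
  show "\<theta> = 0"
  proof (rule ccontr)
    assume "\<theta> \<noteq> 0"
    with \<theta> have \<theta>: "0 < \<theta>" "\<theta> < 2 * pi" by auto
    have "- of_int \<epsilon> = 1 \<or> - of_int \<epsilon> = (-1 :: real)" using \<epsilon> by auto
    from psd_imp_pointwise[OF psd \<theta> this] obtain \<omega> where \<omega>: "0 < \<omega>" "\<omega> < 2 * pi"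
      "0 < - of_int \<epsilon> * (\<omega> - \<theta>)" "block_nonneg 1 \<omega> (P2 \<epsilon> k \<theta>) = block_nonneg 1 \<theta> (P2 \<epsilon> k \<theta>)"
      using b by blast
    then show False using \<epsilon> unfolding block_nonneg_P2[OF adm \<omega>(1,2)] block_nonneg_P2[OF adm \<theta>]
      by (auto split: if_splits)
  qed
qed

text \<open>With positive sign, the number of a block P3 is larger at \<open>\<theta>\<close> than at any other angle.\<close>

lemma psd_imp_all_P3_negative:
  assumes psd: "psd_on_unit_circle E A (popov E A B Q S R)"
  shows "all_P3_negative bs"
  unfolding all_P3_negative_def
proof (intro allI impI)
  fix \<epsilon> k \<theta> assume b: "P3 \<epsilon> k \<theta> \<in> set bs"
  then have adm: "admissible_block (P3 \<epsilon> k \<theta>)" using admissible by blast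
  then have \<epsilon>: "\<epsilon> = 1 \<or> \<epsilon> = -1" and \<theta>: "0 < \<theta>" "\<theta> < 2 * pi" by auto
  obtain \<omega> where \<omega>: "0 < 1 * (\<omega> - \<theta>)" "block_nonneg 1 \<omega> (P3 \<epsilon> k \<theta>) = block_nonneg 1 \<theta> (P3 \<epsilon> k \<theta>)"
    using psd_imp_pointwise[OF psd \<theta>, of 1] b by blast
  then show "\<epsilon> = -1" using \<epsilon> by auto
qed

definition "generic \<omega> \<longleftrightarrow> regular (cis \<omega>) \<and>
    (\<forall>b \<in> set bs. block_angle_free \<omega> b) \<and> q \<le> m \<and>
    (\<exists>L P K K'. rank_split m m q (\<Phi> (cis \<omega>)) L P K K')"

lemma generic_angles:
  obtains F where "finite F" "\<And>\<omega>. 0 < \<omega> \<Longrightarrow> \<omega> < 2 * pi \<Longrightarrow> \<omega> \<notin> F \<Longrightarrow> generic \<omega>"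
proof -
  obtain F where F: "finite F" "q \<le> m" "\<And>z C. z \<notin> F \<Longrightarrow> mat_val (popov E A B Q S R) z C \<Longrightarrow>
    \<exists>L P K K'. rank_split m m q C L P K K'"
    using generic_rank_splitting[OF popov_carrier[OF sys] rank] by metis
  let ?F = "special_angles \<union> {\<omega> \<in> {0..<2 * pi}. cis \<omega> \<in> F}"
  show ?thesis
  proof (rule that[of ?F])
    show "finite ?F" using finite_special_angles finite_cis_vimage[OF F(1)] by simp
    fix \<omega> assume \<omega>: "0 < \<omega>" "\<omega> < 2 * pi" "\<omega> \<notin> ?F"
    then have ns: "\<omega> \<notin> special_angles" and nF: "cis \<omega> \<notin> F" by auto
    have reg: "regular (cis \<omega>)" using not_special(3)[OF ns] \<omega> by simp
    show "generic \<omega>"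
      using F(3)[OF nF popov_value[OF sys _ reg]] reg not_special(2)[OF ns] F(2) by (simp add: generic_def)
  qed
qed

lemma left_inverse_injective:
  fixes K :: "complex mat"
  assumes "K \<in> carrier_mat m l" "K' \<in> carrier_mat l m" "K' * K = 1\<^sub>m l" "w \<in> carrier_vec l" "K *\<^sub>v w = 0\<^sub>v m"
  shows "w = 0\<^sub>v l"
proof -
  have "w = (K' * K) *\<^sub>v w" using assms by simp
  also have "\<dots> = K' *\<^sub>v (K *\<^sub>v w)" using assms(2,1,4) by (rule assoc_mult_mat_vec)
  finally show ?thesis using assms by simp
qed

text \<open>At a generic angle \<open>T 1 \<omega> = n + m\<close>. For \<open>-H\<close>, the kernel of \<open>\<Phi>\<close> gives a nonnegative subspace of
  dimension \<open>n + (m - q)\<close>, and a complement of the kernel, on which the semidefinite \<open>\<Phi>\<close> is definite,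
  a negative one of dimension \<open>n + q\<close>; so \<open>T (-1) \<omega> = n + (m - q)\<close>. The difference \<open>q\<close> comes from the blocks
  P2.\<close>

lemma psd_imp_count:
  assumes psd: "psd_on_unit_circle E A (popov E A B Q S R)"
  shows "num_P2_at_one 1 bs = num_P2_at_one (-1) bs + q"
proof -
  obtain F where F: "finite F" "\<And>\<omega>. 0 < \<omega> \<Longrightarrow> \<omega> < 2 * pi \<Longrightarrow> \<omega> \<notin> F \<Longrightarrow> generic \<omega>"
    by (rule generic_angles) blast
  have "infinite ({0<..<2 * pi} - F)" using F(1) by (simp add: infinite_Ioo)
  then obtain \<omega> where "\<omega> \<in> {0<..<2 * pi}" "\<omega> \<notin> F" by (metis Diff_iff ex_in_conv finite.emptyI)
  then have \<omega>: "0 < \<omega>" "\<omega> < 2 * pi" "\<omega> \<notin> F" by auto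
  obtain L P K K' where reg: "regular (cis \<omega>)" and free: "\<forall>b \<in> set bs. block_angle_free \<omega> b" and qm: "q \<le> m"
    and LP: "L \<in> carrier_mat q m" "P \<in> carrier_mat m q" "L * \<Phi> (cis \<omega>) * P = 1\<^sub>m q"
    and K: "K \<in> carrier_mat m (m - q)" "\<Phi> (cis \<omega>) * K = 0\<^sub>m m (m - q)"
    and K': "K' \<in> carrier_mat (m - q) m" "K' * K = 1\<^sub>m (m - q)"
    using F(2)[OF \<omega>] unfolding generic_def rank_split_def by blast
  note \<Phi> = popov_at_carrier[OF sys, of "cis \<omega>"] popov_at_hermitian[OF sys, of "cis \<omega>"]
  have pos: "0 \<le> hform (\<Phi> (cis \<omega>)) v" if "v \<in> carrier_vec m" for v
    using psd \<omega> reg that unfolding psd_on_circle_iff by auto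
  have T1: "T 1 \<omega> = n + m"
    using psd_imp_T_lower[OF \<omega>(1,2) free reg pos] T_upper[OF \<omega>(1,2)] by simp
  have "nonneg_on_dim (H (-1) \<omega>) (n + (m - q))"
  proof (rule H_nonneg_popov[OF \<omega>(1,2) reg K(1)])
    fix w :: "complex vec" assume w: "w \<in> carrier_vec (m - q)" "w \<noteq> 0\<^sub>v (m - q)"
    have "\<Phi> (cis \<omega>) *\<^sub>v (K *\<^sub>v w) = 0\<^sub>v m"
      using assoc_mult_mat_vec[OF \<Phi>(1) K(1) w(1)] K w by simp
    moreover have "K *\<^sub>v w \<noteq> 0\<^sub>v m" using left_inverse_injective[OF K(1) K' w(1)] w(2) by blast
    ultimately show "K *\<^sub>v w \<noteq> 0\<^sub>v m \<and> 0 \<le> - 1 * hform (\<Phi> (cis \<omega>)) (K *\<^sub>v w)"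
      using K(1) w by (simp add: hform_def)
  qed
  then have lower: "n + (m - q) \<le> T (-1) \<omega>" by (intro T_lower[OF \<omega>(1,2) _ free]) auto
  have "neg_on_dim (H (-1) \<omega>) (n + q)"
  proof (rule H_neg_popov[OF \<omega>(1,2) _ reg LP(2)])
    fix w :: "complex vec" assume w: "w \<in> carrier_vec q" "w \<noteq> 0\<^sub>v q"
    have Pw: "P *\<^sub>v w \<in> carrier_vec m" using LP w by simp
    have "hform (\<Phi> (cis \<omega>)) (P *\<^sub>v w) \<noteq> 0"
    proof
      assume null: "hform (\<Phi> (cis \<omega>)) (P *\<^sub>v w) = 0"
      have z: "\<Phi> (cis \<omega>) *\<^sub>v (P *\<^sub>v w) = 0\<^sub>v m" by (rule psd_null_vector[OF \<Phi> pos Pw null])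
      have "w = (L * \<Phi> (cis \<omega>) * P) *\<^sub>v w" using LP w by simp
      also have "\<dots> = (L * \<Phi> (cis \<omega>)) *\<^sub>v (P *\<^sub>v w)" using LP \<Phi> w by (intro assoc_mult_mat_vec[of _ q m]) auto
      also have "\<dots> = L *\<^sub>v (\<Phi> (cis \<omega>) *\<^sub>v (P *\<^sub>v w))" using LP(1) \<Phi>(1) Pw by (rule assoc_mult_mat_vec)
      also have "\<dots> = 0\<^sub>v q" unfolding z using LP by simp
      finally show False using w by simp
    qed
    then show "- 1 * hform (\<Phi> (cis \<omega>)) (P *\<^sub>v w) < 0" using pos[OF Pw] by simp
  qed simp
  then have "n + q + T (-1) \<omega> \<le> 2 * n + m"
    using neg_nonneg_dim_le[OF H_carrier _ blocks_nonneg[OF \<omega>(1,2), of "-1"]] by simp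
  then have "T (-1) \<omega> = n + (m - q)" using lower by simp
  then show ?thesis
    using block_nonneg_balance[OF admissible psd_imp_no_P2_off_one[OF psd] free \<omega>(1,2)] T1 qm by simp
qed

text \<open>A vector \<open>u\<close> at which \<open>\<Phi>\<close> is negative could be added to the kernel of \<open>\<Phi>\<close>, giving a nonnegative
  subspace for \<open>-H\<close> of dimension \<open>n + (m - q + 1)\<close>. Then \<open>T (-1) \<omega> \<ge> n + m - q + 1\<close>, and the count
  yields \<open>T 1 \<omega> \<ge> n + m + 1\<close>, against the bound \<open>T 1 \<omega> \<le> n + m\<close>.\<close>

lemma count_imp_generic_psd:
  assumes no: "no_P2_off_one bs" and count: "num_P2_at_one 1 bs = num_P2_at_one (-1) bs + q"
    and \<omega>: "0 < \<omega>" "\<omega> < 2 * pi" and reg: "regular (cis \<omega>)" and free: "\<forall>b \<in> set bs. block_angle_free \<omega> b"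
    and qm: "q \<le> m" and K: "K \<in> carrier_mat m (m - q)" "\<Phi> (cis \<omega>) * K = 0\<^sub>m m (m - q)"
    and K': "K' \<in> carrier_mat (m - q) m" "K' * K = 1\<^sub>m (m - q)" and u: "u \<in> carrier_vec m"
  shows "0 \<le> hform (\<Phi> (cis \<omega>)) u"
proof (rule ccontr)
  assume "\<not> 0 \<le> hform (\<Phi> (cis \<omega>)) u"
  then have neg: "hform (\<Phi> (cis \<omega>)) u < 0" by simp
  note \<Phi> = popov_at_carrier[OF sys, of "cis \<omega>"] popov_at_hermitian[OF sys, of "cis \<omega>"]
  define C where "C = mat_of_cols m [u]"
  have C: "C \<in> carrier_mat m 1" by (intro carrier_matI) (simp_all add: C_def)
  have Cy: "C *\<^sub>v y = y $ 0 \<cdot>\<^sub>v u" if "y \<in> carrier_vec 1" for y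
    using that u by (intro eq_vecI) (auto simp: C_def mat_of_cols_def scalar_prod_def)
  have "nonneg_on_dim (H (-1) \<omega>) (n + (m - q + 1))"
  proof (rule H_nonneg_popov[OF \<omega> reg append_cols_carrier[OF K(1) C]])
    fix w :: "complex vec" assume w: "w \<in> carrier_vec (m - q + 1)" "w \<noteq> 0\<^sub>v (m - q + 1)"
    obtain x y where xy: "x \<in> carrier_vec (m - q)" "y \<in> carrier_vec 1" "w = x @\<^sub>v y"
      using vec_append_cases[OF w(1)] .
    have Kx: "K *\<^sub>v x \<in> carrier_vec m" and yu: "y $ 0 \<cdot>\<^sub>v u \<in> carrier_vec m" using K xy u by auto
    have KC: "append_cols K C *\<^sub>v w = K *\<^sub>v x + y $ 0 \<cdot>\<^sub>v u"
      unfolding xy(3) Cy[OF xy(2), symmetric] by (rule append_cols_mult_vec[OF K(1) C xy(1,2)])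
    have ker: "\<Phi> (cis \<omega>) *\<^sub>v (K *\<^sub>v x) = 0\<^sub>v m"
      using assoc_mult_mat_vec[OF \<Phi>(1) K(1) xy(1)] K xy by simp
    have "(K *\<^sub>v x) \<bullet>c (\<Phi> (cis \<omega>) *\<^sub>v (y $ 0 \<cdot>\<^sub>v u)) = (\<Phi> (cis \<omega>) *\<^sub>v (K *\<^sub>v x)) \<bullet>c (y $ 0 \<cdot>\<^sub>v u)"
      using cscalar_prod_adjoint[OF \<Phi>(1) Kx yu] \<Phi>(2) by simp
    then have "hform (\<Phi> (cis \<omega>)) (K *\<^sub>v x + y $ 0 \<cdot>\<^sub>v u) = hform (\<Phi> (cis \<omega>)) (y $ 0 \<cdot>\<^sub>v u)"
      using hform_add[OF \<Phi> Kx yu] ker Kx yu by (simp add: hform_def)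
    then have form: "hform (\<Phi> (cis \<omega>)) (append_cols K C *\<^sub>v w) = (cmod (y $ 0))\<^sup>2 * hform (\<Phi> (cis \<omega>)) u"
      unfolding KC hform_smult_vec[OF \<Phi>(1) u] .
    have "append_cols K C *\<^sub>v w \<noteq> 0\<^sub>v m"
    proof (cases "y $ 0 = 0")
      case True
      then have "y = 0\<^sub>v 1" using xy(2) by (intro eq_vecI) auto
      then have "x \<noteq> 0\<^sub>v (m - q)" using w(2) xy(3) by auto
      then have "K *\<^sub>v x \<noteq> 0\<^sub>v m" using left_inverse_injective[OF K(1) K' xy(1)] by blast
      moreover have "K *\<^sub>v x + y $ 0 \<cdot>\<^sub>v u = K *\<^sub>v x" using True u K(1) xy(1) by (intro eq_vecI) auto
      ultimately show ?thesis unfolding KC by simp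
    next
      case False
      then have "hform (\<Phi> (cis \<omega>)) (append_cols K C *\<^sub>v w) \<noteq> 0" unfolding form using neg by simp
      then show ?thesis using \<Phi>(1) by (auto simp: hform_def)
    qed
    moreover have "0 \<le> - 1 * hform (\<Phi> (cis \<omega>)) (append_cols K C *\<^sub>v w)"
      unfolding form using neg by (simp add: mult_nonneg_nonpos)
    ultimately show "append_cols K C *\<^sub>v w \<noteq> 0\<^sub>v m \<and> 0 \<le> - 1 * hform (\<Phi> (cis \<omega>)) (append_cols K C *\<^sub>v w)" by blast
  qed
  then have "n + (m - q + 1) \<le> T (-1) \<omega>" by (intro T_lower[OF \<omega> _ free]) auto
  moreover have "T 1 \<omega> = T (-1) \<omega> + q"
    using block_nonneg_balance[OF admissible no free \<omega>] count by simp
  ultimately show False using T_upper[OF \<omega>] qm by simp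
qed

lemma count_imp_psd:
  assumes no: "no_P2_off_one bs" and count: "num_P2_at_one 1 bs = num_P2_at_one (-1) bs + q"
  shows "psd_on_unit_circle E A (popov E A B Q S R)"
  unfolding psd_on_circle_iff
proof (intro ballI impI)
  fix \<omega> and v :: "complex vec"
  assume \<omega>: "\<omega> \<in> {0..<2 * pi}" "regular (cis \<omega>)" and v: "v \<in> carrier_vec m"
  obtain F where F: "finite F" "\<And>\<omega>. 0 < \<omega> \<Longrightarrow> \<omega> < 2 * pi \<Longrightarrow> \<omega> \<notin> F \<Longrightarrow> generic \<omega>"
    by (rule generic_angles) blast
  show "0 \<le> hform (\<Phi> (cis \<omega>)) v"
  proof (rule generic_psd_imp_psd[OF F(1) _ \<omega> v])
    fix \<omega> and v :: "complex vec"
    assume "\<omega> \<in> {0<..<2 * pi}" and \<omega>F: "\<omega> \<notin> F" and v: "v \<in> carrier_vec m"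
    then have \<omega>: "0 < \<omega>" "\<omega> < 2 * pi" by auto
    obtain K K' where "regular (cis \<omega>)" "\<forall>b \<in> set bs. block_angle_free \<omega> b" "q \<le> m"
      "K \<in> carrier_mat m (m - q)" "\<Phi> (cis \<omega>) * K = 0\<^sub>m m (m - q)"
      "K' \<in> carrier_mat (m - q) m" "K' * K = 1\<^sub>m (m - q)"
      using F(2)[OF \<omega> \<omega>F] unfolding generic_def rank_split_def by blast
    then show "0 \<le> hform (\<Phi> (cis \<omega>)) v" using v by (rule count_imp_generic_psd[OF no count \<omega>])
  qed
qed

end

theorem theorem5p2:
  fixes E A B Q S R :: "'a::real_or_complex mat" and m n q :: nat and bs :: "pkcf_block list"
  assumes sys: "(E, A, B, Q, S, R) \<in> Sigma_w m n"
    and rank: "vec_space.rank m (popov E A B Q S R) = q"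
    and ctrb: "\<And>z. cmod z = 1 \<Longrightarrow> \<not> uncontrollable_mode E A B z"
    and pkcf: "is_pkcf (map_mat to_complex (pal_mat E A B Q S R)) bs"
  shows "(psd_on_unit_circle E A (popov E A B Q S R) \<longleftrightarrow>
            no_P2_off_one bs \<and> all_P3_negative bs \<and> num_P2_at_one 1 bs = num_P2_at_one (-1) bs + q)
       \<and> (psd_on_unit_circle E A (popov E A B Q S R) \<longleftrightarrow>
            no_P2_off_one bs \<and> num_P2_at_one 1 bs = num_P2_at_one (-1) bs + q)"
proof -
  interpret popov_pkcf E A B Q S R m n bs q
    using sys ctrb pkcf rank by unfold_locales
  show ?thesis
    using psd_imp_no_P2_off_one psd_imp_all_P3_negative psd_imp_count count_imp_psd by blast
qed

end
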